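(* Let $H(K)$ be a separable reproducing kernel Hilbert space of complex-valued functions on a subset $D\subset\mathbb{R}^d$ with positive definite Hermitian kernel $K$ such that $\int_D K(\mathbf{x},\mathbf{x})\,d\varrho_D(\mathbf{x})<\infty$ for some measure $\varrho_D$ on $D$, and let $(\sigma_k)_k$ denote the non-increasing sequence of singular numbers of the embedding $\mathrm{Id}:H(K)\to L_2(D,\varrho_D)$. Let $r>1$, $n\in\mathbb{N}$, $n\ge3$, and $$m:=\Big\lfloor\frac{n}{14\,r\log n}\Big\rfloor,\qquad m\ge2.$$ Then $$\mathbb{P}\Big(\sup_{\|f\|_{H(K)}\le1}\|f-\widetilde S^m_{\mathbf{X}}f\|^2_{L_2(D,\varrho_D)}\le 5\max\Big\{\sigma_m^2,\ \frac{16\,r\,\kappa^2\log n}{n}\sum_{j=m}^\infty\sigma_j^2\Big\}\Big)\ge1-\eta\, n^{1-r},$$ where $\eta=2^{3/4}+1$, $\kappa=\frac{1+\sqrt5}{2}$, the nodes $\mathbf{X}=(\mathbf{x}^1,\dots,\mathbf{x}^n)$ are sampled i.i.d. according to $\varrho_m(\mathbf{x})\,d\varrho_D(\mathbf{x})$ with $$\varrho_m(\mathbf{x})=\frac12\bigg(\frac1{m-1}\sum_{j=1}^{m-1}|\eta_j(\mathbf{x})|^2+\frac{K(\mathbf{x},\mathbf{x})-\sum_{j=1}^{m-1}|e_j(\mathbf{x})|^2}{\int_D K(\mathbf{x},\mathbf{x})\,d\varrho_D(\mathbf{x})-\sum_{j=1}^{m-1}\lambda_j}\bigg),$$ and $\widetilde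 S^m_{\mathbf{X}}$ is the weighted least squares operator built with this density $\varrho_m$.
   Context: $L_2(D,\varrho_D)$ is the space of complex-valued square-integrable functions; $\log$ is the natural logarithm. The finite trace condition implies that the embedding $\mathrm{Id}:H(K)\to L_2(D,\varrho_D)$ is Hilbert–Schmidt (it need not be injective). $H(K)$ is infinite-dimensional, and the strictly positive eigenvalues of $\mathrm{Id}^*\circ\mathrm{Id}:H(K)\to H(K)$, counted with multiplicity, form a sequence $\lambda_1\ge\lambda_2\ge\cdots>0$, $(\lambda_j)_{j\in\mathbb{N}}$. Put $\sigma_j:=\sqrt{\lambda_j}$ (singular numbers of $\mathrm{Id}$). Let $(e_j)_{j}\subset H(K)$ be a corresponding orthonormal system (in $H(K)$) of eigenvectors, and $\eta_j:=\sigma_j^{-1}e_j$ (defined pointwise on $D$), which is an orthonormal system in $L_2(D,\varrho_D)$. (The functions $\eta_j$ are not to be confused with the constant $\eta$.) Weighted least squares operator $\widetilde S^m_{\mathbf{X}}$ for a density $\varrho_m$ and nodes $\mathbf{X}=(\mathbf{x}^1,\dots,\mathbf{x}^n)\in D^n$: given $f$, put $g_j:=f(\mathbf{x}^j)/\sqrt{\varrho_m(\mathbf{x}^j)}$ if $\varrho_m(\mathbf{x}^j)\ne0$ and $g_j:=0$ otherwise, $\mathbf{g}=(g_j)_{j=1}^n$; let $\widetilde{\mathbf{L}}_m=(l_{j,k})\in\mathbb{C}^{n\times(m-1)}$ with $l_{j,k}:=\eta_k(\mathbf{x}^j)/\sqrt{\varrho_m(\mathbf{x}^j)}$ if $\varrho_m(\mathbf{x}^j)\neq0$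 and $l_{j,k}:=0$ otherwise. If $\widetilde{\mathbf{L}}_m$ has full column rank, put $(\tilde c_1,\dots,\tilde c_{m-1})^\top:=(\widetilde{\mathbf{L}}_m^*\widetilde{\mathbf{L}}_m)^{-1}\widetilde{\mathbf{L}}_m^*\mathbf{g}$ and $\widetilde S^m_{\mathbf{X}}f:=\sum_{k=1}^{m-1}\tilde c_k\eta_k$. The probability statement refers to the event that $\widetilde S^m_{\mathbf{X}}$ is defined and the inequality holds. *)

theory Defs
  imports
    "HOL-Probability.Probability"
    "Jordan_Normal_Form.DL_Rank"
    "Jordan_Normal_Form.Schur_Decomposition"
begin

section \<open>Reproducing kernel Hilbert spaces of complex-valued functions\<close>

text \<open>
  Functions on a set \<open>D\<close> are represented by functions on the ambient type vanishing off \<open>D\<close>,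
  so that equality of functions on \<open>D\<close> is equality in HOL.  Complex Hilbert spaces of functions
  are given by a carrier \<open>H\<close> and an inner product \<open>ip\<close> that is only relevant on \<open>H\<close>; it is
  linear in the first argument.
\<close>

definition pos_def_hermitian :: "'x set \<Rightarrow> ('x \<Rightarrow> 'x \<Rightarrow> complex) \<Rightarrow> bool" where
  "pos_def_hermitian D K \<longleftrightarrow>
     (\<forall>x\<in>D. \<forall>y\<in>D. K x y = cnj (K y x)) \<and>
     (\<forall>A c. finite A \<and> A \<subseteq> D \<longrightarrow> 0 \<le> Re (\<Sum>x\<in>A. \<Sum>y\<in>A. c x * cnj (c y) * K x y))"

definition hnorm :: "(('x \<Rightarrow> complex) \<Rightarrow> ('x \<Rightarrow> complex) \<Rightarrow> complex) \<Rightarrow> ('x \<Rightarrow> complex) \<Rightarrow> real" where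
  "hnorm ip f = sqrt (Re (ip f f))"

text \<open>
  The value 0 outside the carrier makes this a metric in the sense of the locale
  \<open>Metric_space\<close>, which asks for nonnegativity and symmetry on the whole type.
\<close>

definition hdist :: "('x \<Rightarrow> complex) set \<Rightarrow> (('x \<Rightarrow> complex) \<Rightarrow> ('x \<Rightarrow> complex) \<Rightarrow> complex) \<Rightarrow>
    ('x \<Rightarrow> complex) \<Rightarrow> ('x \<Rightarrow> complex) \<Rightarrow> real" where
  "hdist H ip f g = (if f \<in> H \<and> g \<in> H then hnorm ip (\<lambda>x. f x - g x) else 0)"

definition inner_product_on ::
    "('x \<Rightarrow> complex) set \<Rightarrow> (('x \<Rightarrow> complex) \<Rightarrow> ('x \<Rightarrow> complex) \<Rightarrow> complex) \<Rightarrow> bool" where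
  "inner_product_on H ip \<longleftrightarrow>
     (\<lambda>x. 0) \<in> H \<and>
     (\<forall>f\<in>H. \<forall>g\<in>H. (\<lambda>x. f x + g x) \<in> H) \<and>
     (\<forall>f\<in>H. \<forall>c. (\<lambda>x. c * f x) \<in> H) \<and>
     (\<forall>f\<in>H. \<forall>g\<in>H. \<forall>h\<in>H. ip (\<lambda>x. f x + g x) h = ip f h + ip g h) \<and>
     (\<forall>f\<in>H. \<forall>h\<in>H. \<forall>c. ip (\<lambda>x. c * f x) h = c * ip f h) \<and>
     (\<forall>f\<in>H. \<forall>g\<in>H. ip f g = cnj (ip g f)) \<and>
     (\<forall>f\<in>H. f \<noteq> (\<lambda>x. 0) \<longrightarrow> 0 < Re (ip f f))"

definition hilbert_on ::
    "('x \<Rightarrow> complex) set \<Rightarrow> (('x \<Rightarrow> complex) \<Rightarrow> ('x \<Rightarrow> complex) \<Rightarrow> complex) \<Rightarrow> bool" where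
  "hilbert_on H ip \<longleftrightarrow> inner_product_on H ip \<and> Metric_space.mcomplete H (hdist H ip)"

definition separable_on ::
    "('x \<Rightarrow> complex) set \<Rightarrow> (('x \<Rightarrow> complex) \<Rightarrow> ('x \<Rightarrow> complex) \<Rightarrow> complex) \<Rightarrow> bool" where
  "separable_on H ip \<longleftrightarrow> separable_space (Metric_space.mtopology H (hdist H ip))"

definition kernel_section :: "'x set \<Rightarrow> ('x \<Rightarrow> 'x \<Rightarrow> complex) \<Rightarrow> 'x \<Rightarrow> 'x \<Rightarrow> complex" where
  "kernel_section D K x = (\<lambda>y. if y \<in> D then K y x else 0)"

text \<open>
  By the Moore--Aronszajn theorem the pair \<open>(H, ip)\<close> is determined by \<open>D\<close> and \<open>K\<close>
  (the inner product up to its irrelevant values outside \<open>H\<close>).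
\<close>

definition rkhs :: "'x set \<Rightarrow> ('x \<Rightarrow> 'x \<Rightarrow> complex) \<Rightarrow>
    ('x \<Rightarrow> complex) set \<Rightarrow> (('x \<Rightarrow> complex) \<Rightarrow> ('x \<Rightarrow> complex) \<Rightarrow> complex) \<Rightarrow> bool" where
  "rkhs D K H ip \<longleftrightarrow>
     hilbert_on H ip \<and>
     (\<forall>f\<in>H. \<forall>x. x \<notin> D \<longrightarrow> f x = 0) \<and>
     (\<forall>x\<in>D. kernel_section D K x \<in> H) \<and>
     (\<forall>f\<in>H. \<forall>x\<in>D. f x = ip f (kernel_section D K x))"


section \<open>The embedding into \<open>L\<^sub>2\<close> and its singular system\<close>

definition l2_inner :: "'x measure \<Rightarrow> ('x \<Rightarrow> complex) \<Rightarrow> ('x \<Rightarrow> complex) \<Rightarrow> complex" where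
  "l2_inner M f g = (LINT x|M. f x * cnj (g x))"

definition l2_norm_sq :: "'x measure \<Rightarrow> ('x \<Rightarrow> complex) \<Rightarrow> ennreal" where
  "l2_norm_sq M f = (\<integral>\<^sup>+x. ennreal ((cmod (f x))\<^sup>2) \<partial>M)"

text \<open>
  The Hilbert space adjoint of the embedding of \<open>H\<close> into \<open>L\<^sub>2(M)\<close>, evaluated at (the class of) \<open>g\<close>.
\<close>

definition Id_adjoint :: "'x measure \<Rightarrow> ('x \<Rightarrow> complex) set \<Rightarrow>
    (('x \<Rightarrow> complex) \<Rightarrow> ('x \<Rightarrow> complex) \<Rightarrow> complex) \<Rightarrow> ('x \<Rightarrow> complex) \<Rightarrow> ('x \<Rightarrow> complex)" where
  "Id_adjoint M H ip g = (THE h. h \<in> H \<and> (\<forall>f\<in>H. l2_inner M f g = ip f h))"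

text \<open>
  On \<open>H\<close> this is the operator \<open>Id\<^sup>* \<circ> Id\<close>: as \<open>Id f\<close> is the class of \<open>f\<close>, no separate symbol for
  the embedding is needed.
\<close>

definition Id_adjoint_Id :: "'x measure \<Rightarrow> ('x \<Rightarrow> complex) set \<Rightarrow>
    (('x \<Rightarrow> complex) \<Rightarrow> ('x \<Rightarrow> complex) \<Rightarrow> complex) \<Rightarrow> ('x \<Rightarrow> complex) \<Rightarrow> ('x \<Rightarrow> complex)" where
  "Id_adjoint_Id M H ip f = Id_adjoint M H ip f"

text \<open>
  \<open>lam 1 \<ge> lam 2 \<ge> \<dots> > 0\<close> are all the positive eigenvalues of \<open>Id\<^sup>* \<circ> Id\<close>, counted with
  multiplicity, and \<open>e 1, e 2, \<dots>\<close> is a corresponding orthonormal system of eigenvectors; the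
  values at index 0 are irrelevant.  The last clause says that the \<open>e j\<close> belonging to a positive
  number \<open>\<mu>\<close> span its eigenspace; it also forces \<open>{j. 1 \<le> j \<and> lam j = \<mu>}\<close> to be finite, since a
  sum over an infinite set is 0.  The sequence being infinite, \<open>H\<close> is infinite-dimensional.
\<close>

definition eigensystem :: "'x measure \<Rightarrow> ('x \<Rightarrow> complex) set \<Rightarrow>
    (('x \<Rightarrow> complex) \<Rightarrow> ('x \<Rightarrow> complex) \<Rightarrow> complex) \<Rightarrow>
    (nat \<Rightarrow> real) \<Rightarrow> (nat \<Rightarrow> 'x \<Rightarrow> complex) \<Rightarrow> bool" where
  "eigensystem M H ip lam e \<longleftrightarrow>
     (\<forall>j\<ge>1. 0 < lam j) \<and>
     (\<forall>i\<ge>1. \<forall>j\<ge>i. lam j \<le> lam i) \<and>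
     (\<forall>j\<ge>1. e j \<in> H) \<and>
     (\<forall>i\<ge>1. \<forall>j\<ge>1. ip (e i) (e j) = (if i = j then 1 else 0)) \<and>
     (\<forall>j\<ge>1. Id_adjoint_Id M H ip (e j) = (\<lambda>x. of_real (lam j) * e j x)) \<and>
     (\<forall>\<mu>>0. \<forall>f\<in>H. Id_adjoint_Id M H ip f = (\<lambda>x. of_real \<mu> * f x) \<longrightarrow>
        (\<exists>c. f = (\<lambda>x. \<Sum>j | 1 \<le> j \<and> lam j = \<mu>. c j * e j x)))"

definition sing :: "(nat \<Rightarrow> real) \<Rightarrow> nat \<Rightarrow> real" where
  "sing lam j = sqrt (lam j)"

definition eta :: "(nat \<Rightarrow> real) \<Rightarrow> (nat \<Rightarrow> 'x \<Rightarrow> complex) \<Rightarrow> nat \<Rightarrow> 'x \<Rightarrow> complex" where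
  "eta lam e j x = e j x / of_real (sing lam j)"

definition sampling_density :: "'x measure \<Rightarrow> ('x \<Rightarrow> 'x \<Rightarrow> complex) \<Rightarrow>
    (nat \<Rightarrow> real) \<Rightarrow> (nat \<Rightarrow> 'x \<Rightarrow> complex) \<Rightarrow> nat \<Rightarrow> 'x \<Rightarrow> real" where
  "sampling_density M K lam e m x =
     1/2 * (1 / (real m - 1) * (\<Sum>j=1..m-1. (cmod (eta lam e j x))\<^sup>2)
          + (Re (K x x) - (\<Sum>j=1..m-1. (cmod (e j x))\<^sup>2))
            / ((LINT y|M. Re (K y y)) - (\<Sum>j=1..m-1. lam j)))"


section \<open>Weighted least squares\<close>

text \<open>
  Nodes \<open>X 1, \<dots>, X n\<close> and basis functions \<open>b 1, \<dots>, b (m-1)\<close> are indexed from 1, matrix and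
  vector entries from 0; \<open>rho\<close> is the sampling density.
\<close>

definition wls_matrix :: "('x \<Rightarrow> real) \<Rightarrow> (nat \<Rightarrow> 'x \<Rightarrow> complex) \<Rightarrow> nat \<Rightarrow> nat \<Rightarrow> (nat \<Rightarrow> 'x) \<Rightarrow> complex mat" where
  "wls_matrix rho b m n X = mat n (m - 1) (\<lambda>(j, k).
     if rho (X (Suc j)) \<noteq> 0 then b (Suc k) (X (Suc j)) / of_real (sqrt (rho (X (Suc j)))) else 0)"

definition wls_data :: "('x \<Rightarrow> real) \<Rightarrow> nat \<Rightarrow> (nat \<Rightarrow> 'x) \<Rightarrow> ('x \<Rightarrow> complex) \<Rightarrow> complex vec" where
  "wls_data rho n X f = vec n (\<lambda>j.
     if rho (X (Suc j)) \<noteq> 0 then f (X (Suc j)) / of_real (sqrt (rho (X (Suc j)))) else 0)"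

definition wls_defined :: "('x \<Rightarrow> real) \<Rightarrow> (nat \<Rightarrow> 'x \<Rightarrow> complex) \<Rightarrow> nat \<Rightarrow> nat \<Rightarrow> (nat \<Rightarrow> 'x) \<Rightarrow> bool" where
  "wls_defined rho b m n X \<longleftrightarrow> vec_space.rank n (wls_matrix rho b m n X) = m - 1"

definition wls_coeffs :: "('x \<Rightarrow> real) \<Rightarrow> (nat \<Rightarrow> 'x \<Rightarrow> complex) \<Rightarrow> nat \<Rightarrow> nat \<Rightarrow> (nat \<Rightarrow> 'x) \<Rightarrow>
    ('x \<Rightarrow> complex) \<Rightarrow> complex vec" where
  "wls_coeffs rho b m n X f =
     (let L = wls_matrix rho b m n X
      in (the (mat_inverse (mat_adjoint L * L)) * mat_adjoint L) *\<^sub>v wls_data rho n X f)"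

definition wls :: "('x \<Rightarrow> real) \<Rightarrow> (nat \<Rightarrow> 'x \<Rightarrow> complex) \<Rightarrow> nat \<Rightarrow> nat \<Rightarrow> (nat \<Rightarrow> 'x) \<Rightarrow>
    ('x \<Rightarrow> complex) \<Rightarrow> 'x \<Rightarrow> complex" where
  "wls rho b m n X f x = (\<Sum>k=1..m-1. vec_index (wls_coeffs rho b m n X f) (k - 1) * b k x)"

end

theory Submission
  imports Defs "HOL-Complex_Analysis.Great_Picard"
begin

text \<open>
  With \<open>y k = \<eta> k / sqrt \<rho>\<close> and \<open>z j = e j / sqrt \<rho>\<close> evaluated at the nodes, the squared error on the unit
  ball is at most \<open>\<sigma> m ^ 2\<close> plus \<open>2/n\<close> times the largest eigenvalue of the sum of the rank-one matrices
  \<open>z z\<^sup>*\<close> (\<open>j \<ge> m\<close>), provided that the smallest eigenvalue of the sum of the \<open>y y\<^sup>*\<close> (\<open>k < m\<close>) is at least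
  \<open>n/2\<close>.  The density makes the rank-one summands bounded, and both eigenvalues are controlled by a matrix
  Chernoff argument with the trace exponential.  As all summands have rank one, the Golden--Thompson
  inequality needed there is elementary: along \<open>A + s v v\<^sup>*\<close> the derivative \<open>g\<close> of the trace of the (truncated)
  exponential satisfies \<open>g' \<le> \<parallel>v\<parallel>\<^sup>2 g\<close>, because the moments \<open>k \<mapsto> v\<^sup>* A\<^sup>k v\<close> are log-convex.  For the infinitely many
  \<open>z j\<close> one truncates; subtracting the dimension from the trace keeps the bounds independent of the truncation.
  That the remainder of an \<open>f \<in> H\<close> vanishes almost surely at the nodes, and that the trace of \<open>K\<close> is the sum of
  the eigenvalues, follows from the spectral theorem for the compact embedding and the separability of \<open>H\<close>.
\<close>

text \<open>Matrix functions never appear: Taylor polynomials replace the exponential, so traces,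
  derivatives along an update and expectations are finite sums of polynomials in the entries, and
  independence can be applied entry by entry; the degree is sent to infinity afterwards.
  Log-convexity of moments requires a positive semidefinite base point. For the upper tail this is
  automatic. For the lower tail, where rank-one matrices are subtracted, a multiple of the identity
  is added, and its exponential cancels against the threshold. Let T be the sum of
  \<open>lam j\<close> over j >= m and \<mu> the maximum in the theorem. The density bounds the
  squared norms of the summands by 2 (m - 1) and 2 T, which sets the scale of the two exponents.
  With large probability the tail sum has its largest eigenvalue at most 2 n \<mu>, so the
  coefficients contribute (2/n) 2 n \<mu> = 4 \<mu>; together with sigma_m^2 <= \<mu> this gives the
  factor 5.\<close>

section \<open>Positive semidefinite sesquilinear forms\<close>

text \<open>Four forms are instances: the inner product of \<open>H\<close>, the L2 product on
  \<open>H\<close>, the forms given by powers of a positive semidefinite matrix, and \<mu> times the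
  first minus the second in the spectral argument. Definiteness is available for the first alone, so
  the locale stops at semidefiniteness.\<close>

locale psd_form =
  fixes V :: "('a \<Rightarrow> complex) set" and b :: "('a \<Rightarrow> complex) \<Rightarrow> ('a \<Rightarrow> complex) \<Rightarrow> complex"
  assumes add_closed: "f \<in> V \<Longrightarrow> g \<in> V \<Longrightarrow> (\<lambda>x. f x + g x) \<in> V"
    and scale_closed: "f \<in> V \<Longrightarrow> (\<lambda>x. c * f x) \<in> V"
    and add_left: "f \<in> V \<Longrightarrow> g \<in> V \<Longrightarrow> h \<in> V \<Longrightarrow> b (\<lambda>x. f x + g x) h = b f h + b g h"
    and scale_left: "f \<in> V \<Longrightarrow> h \<in> V \<Longrightarrow> b (\<lambda>x. c * f x) h = c * b f h"
    and herm: "f \<in> V \<Longrightarrow> g \<in> V \<Longrightarrow> b f g = cnj (b g f)"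
    and nonneg: "f \<in> V \<Longrightarrow> 0 \<le> Re (b f f)"
begin

lemma add_right:
  assumes "f \<in> V" "g \<in> V" "h \<in> V"
  shows "b h (\<lambda>x. f x + g x) = b h f + b h g"
proof -
  have "b h (\<lambda>x. f x + g x) = cnj (b (\<lambda>x. f x + g x) h)" using assms add_closed herm by blast
  also have "\<dots> = cnj (b f h) + cnj (b g h)" using assms add_left by simp
  finally show ?thesis using assms herm by metis
qed

lemma scale_right:
  assumes "f \<in> V" "h \<in> V"
  shows "b h (\<lambda>x. c * f x) = cnj c * b h f"
proof -
  have "b h (\<lambda>x. c * f x) = cnj (b (\<lambda>x. c * f x) h)" using assms scale_closed herm by blast
  also have "\<dots> = cnj c * cnj (b f h)" using assms scale_left by simp
  finally show ?thesis using assms herm by metis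
qed

lemma diff_closed: "f \<in> V \<Longrightarrow> g \<in> V \<Longrightarrow> (\<lambda>x. f x - g x) \<in> V"
  using add_closed[of f "\<lambda>x. (-1) * g x"] scale_closed[of g "-1"] by simp

lemma diff_left:
  assumes "f \<in> V" "g \<in> V" "h \<in> V"
  shows "b (\<lambda>x. f x - g x) h = b f h - b g h"
  using add_left[of f "\<lambda>x. (-1) * g x" h] scale_closed[of g "-1"] scale_left[of g h "-1"] assms
  by simp

lemma diff_right:
  assumes "f \<in> V" "g \<in> V" "h \<in> V"
  shows "b h (\<lambda>x. f x - g x) = b h f - b h g"
  using add_right[of f "\<lambda>x. (-1) * g x" h] scale_closed[of g "-1"] scale_right[of g h "-1"] assms
  by simp

lemma add_scale_sq:
  assumes "f \<in> V" "g \<in> V"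
  shows "Re (b (\<lambda>x. f x + c * g x) (\<lambda>x. f x + c * g x))
    = Re (b f f) + 2 * Re (c * b g f) + (cmod c)\<^sup>2 * Re (b g g)"
proof -
  have cg: "(\<lambda>x. c * g x) \<in> V" using assms scale_closed by blast
  have s: "(\<lambda>x. f x + c * g x) \<in> V" using add_closed[OF assms(1) cg] .
  have fg: "b f g = cnj (b g f)" using assms herm by blast
  have "b (\<lambda>x. f x + c * g x) (\<lambda>x. f x + c * g x)
      = b f f + (cnj c * b f g + c * b g f) + (c * cnj c) * b g g"
    using assms cg s
    by (simp add: add_left add_right scale_left scale_right algebra_simps)
  moreover have "c * cnj c = of_real ((cmod c)\<^sup>2)" by (simp add: complex_norm_square[symmetric])
  moreover have "Re (cnj c * b f g) = Re (c * b g f)" unfolding fg by simp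
  ultimately show ?thesis by simp
qed

lemma diff_sq:
  assumes "f \<in> V" "g \<in> V"
  shows "Re (b (\<lambda>x. f x - g x) (\<lambda>x. f x - g x)) = Re (b f f) - 2 * Re (b g f) + Re (b g g)"
  using add_scale_sq[OF assms, of "-1"] by simp

lemma add_sq:
  assumes "f \<in> V" "g \<in> V"
  shows "Re (b (\<lambda>x. f x + g x) (\<lambda>x. f x + g x)) = Re (b f f) + 2 * Re (b g f) + Re (b g g)"
  using add_scale_sq[OF assms, of 1] by simp

lemma diff_sq_le:
  assumes "f \<in> V" "g \<in> V"
  shows "Re (b (\<lambda>x. f x - g x) (\<lambda>x. f x - g x)) \<le> 2 * Re (b f f) + 2 * Re (b g g)"
  using add_sq[OF assms] diff_sq[OF assms] nonneg[OF add_closed[OF assms]] by linarith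

lemma cauchy_schwarz:
  assumes "f \<in> V" "g \<in> V"
  shows "(cmod (b f g))\<^sup>2 \<le> Re (b f f) * Re (b g g)"
proof -
  define z where "z = b f g"
  have gf: "b g f = cnj z" using herm[OF assms(2,1)] by (simp add: z_def)
  \<comment> \<open>Subtracting \<open>t * z\<close> times \<open>g\<close>, with
    \<open>z = b f g\<close>, turns the phase of the cross term into the real number -2 t
    |z|^2.\<close>
  have q: "0 \<le> Re (b f f) - 2 * t * (cmod z)\<^sup>2 + t\<^sup>2 * (cmod z)\<^sup>2 * Re (b g g)" for t :: real
  proof -
    have "0 \<le> Re (b (\<lambda>x. f x + (- of_real t * z) * g x) (\<lambda>x. f x + (- of_real t * z) * g x))"
      using assms scale_closed add_closed nonneg by presburger
    also have "\<dots> = Re (b f f) + 2 * Re ((- of_real t * z) * cnj z)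
        + (cmod (- of_real t * z))\<^sup>2 * Re (b g g)"
      by (rule add_scale_sq[OF assms, unfolded gf])
    also have "Re ((- of_real t * z) * cnj z) = - t * (cmod z)\<^sup>2"
      unfolding cmod_power2 by (simp add: power2_eq_square algebra_simps)
    finally show ?thesis by (simp add: norm_mult power_mult_distrib)
  qed
  show ?thesis
  proof (cases "Re (b g g) = 0")
    case True
    have "(cmod z)\<^sup>2 = 0"
    proof (rule ccontr)
      assume "(cmod z)\<^sup>2 \<noteq> 0"
      then have p: "(cmod z)\<^sup>2 > 0" by simp
      \<comment> \<open>For \<open>Re (b g g) = 0\<close> the polynomial is affine in
        \<open>t\<close>, so a nonzero slope drives it below 0; this \<open>t\<close> gives the
        value - Re (b f f) - 2.\<close>
      have "0 \<le> Re (b f f) - 2 * ((Re (b f f) + 1) / (cmod z)\<^sup>2) * (cmod z)\<^sup>2"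
        using q[of "(Re (b f f) + 1) / (cmod z)\<^sup>2"] True by simp
      also have "\<dots> = - Re (b f f) - 2" using p by simp
      finally show False using nonneg[OF assms(1)] by linarith
    qed
    then show ?thesis using True by (simp add: z_def)
  next
    case False
    then have p: "Re (b g g) > 0" using nonneg[OF assms(2)] by linarith
    show ?thesis using q[of "1 / Re (b g g)"] p by (simp add: z_def field_simps power2_eq_square)
  qed
qed

lemma sum_closed:
  assumes "(\<lambda>x. 0) \<in> V" "\<And>j. j \<in> J \<Longrightarrow> g j \<in> V"
  shows "(\<lambda>x. \<Sum>j\<in>J. c j * g j x) \<in> V"
  using assms(2)
  by (induction J rule: infinite_finite_induct) (simp_all add: assms(1) add_closed scale_closed)

lemma zero_left: "h \<in> V \<Longrightarrow> b (\<lambda>x. 0) h = 0"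
  using scale_left[of h h 0] by simp

lemma sum_left:
  assumes "\<And>j. j \<in> J \<Longrightarrow> g j \<in> V" "h \<in> V"
  shows "b (\<lambda>x. \<Sum>j\<in>J. c j * g j x) h = (\<Sum>j\<in>J. c j * b (g j) h)"
  using assms(1)
proof (induction J rule: infinite_finite_induct)
  case (insert a J)
  have "(\<lambda>x. 0) \<in> V" using scale_closed[OF assms(2), of 0] by simp
  then have "(\<lambda>x. \<Sum>j\<in>J. c j * g j x) \<in> V" using insert.prems by (intro sum_closed) auto
  then show ?case using insert by (simp add: add_left scale_left scale_closed assms(2))
qed (simp_all add: zero_left assms(2))

lemma sum_right:
  assumes "\<And>j. j \<in> J \<Longrightarrow> g j \<in> V" "h \<in> V"
  shows "b h (\<lambda>x. \<Sum>j\<in>J. c j * g j x) = (\<Sum>j\<in>J. cnj (c j) * b h (g j))"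
proof -
  have "(\<lambda>x. 0) \<in> V" using scale_closed[OF assms(2), of 0] by simp
  then have "(\<lambda>x. \<Sum>j\<in>J. c j * g j x) \<in> V" using assms(1) by (intro sum_closed) auto
  then have "b h (\<lambda>x. \<Sum>j\<in>J. c j * g j x) = cnj (b (\<lambda>x. \<Sum>j\<in>J. c j * g j x) h)"
    using herm assms(2) by blast
  also have "\<dots> = (\<Sum>j\<in>J. cnj (c j) * cnj (b (g j) h))" using assms by (simp add: sum_left)
  also have "\<dots> = (\<Sum>j\<in>J. cnj (c j) * b h (g j))"
    by (intro sum.cong refl) (metis assms herm)
  finally show ?thesis .
qed

definition sn :: "('a \<Rightarrow> complex) \<Rightarrow> real" where "sn f = sqrt (Re (b f f))"

lemma sn_sq: "f \<in> V \<Longrightarrow> (sn f)\<^sup>2 = Re (b f f)"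
  by (simp add: sn_def nonneg)

lemma sn_nonneg: "f \<in> V \<Longrightarrow> 0 \<le> sn f"
  by (simp add: sn_def nonneg)

lemma cauchy_schwarz_sn: "f \<in> V \<Longrightarrow> g \<in> V \<Longrightarrow> cmod (b f g) \<le> sn f * sn g"
proof -
  assume "f \<in> V" "g \<in> V"
  then have "(cmod (b f g))\<^sup>2 \<le> (sn f * sn g)\<^sup>2" using cauchy_schwarz by (simp add: power_mult_distrib sn_sq)
  then show ?thesis using power2_le_imp_le \<open>f \<in> V\<close> \<open>g \<in> V\<close> sn_nonneg by simp
qed

lemma sn_triangle:
  assumes "f \<in> V" "g \<in> V"
  shows "sn (\<lambda>x. f x + g x) \<le> sn f + sn g"
proof (rule power2_le_imp_le)
  have "Re (b g f) \<le> sn g * sn f"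
    using cauchy_schwarz_sn[OF assms(2,1)] complex_Re_le_cmod[of "b g f"] by linarith
  then show "(sn (\<lambda>x. f x + g x))\<^sup>2 \<le> (sn f + sn g)\<^sup>2"
    using assms by (simp add: sn_sq add_closed add_sq power2_sum mult.commute)
qed (use assms sn_nonneg in simp)

lemma sn_scale:
  assumes "f \<in> V"
  shows "sn (\<lambda>x. c * f x) = cmod c * sn f"
proof -
  have "b (\<lambda>x. c * f x) (\<lambda>x. c * f x) = of_real ((cmod c)\<^sup>2) * b f f"
    using assms by (subst complex_norm_square) (simp add: scale_left scale_right scale_closed)
  then show ?thesis by (simp add: sn_def real_sqrt_mult)
qed

lemma sn_minus_commute: "f \<in> V \<Longrightarrow> g \<in> V \<Longrightarrow> sn (\<lambda>x. f x - g x) = sn (\<lambda>x. g x - f x)"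
  using sn_scale[OF diff_closed, of g f "-1"] by simp

lemma sn_diff_triangle:
  assumes "f \<in> V" "g \<in> V" "h \<in> V"
  shows "sn (\<lambda>x. f x - h x) \<le> sn (\<lambda>x. f x - g x) + sn (\<lambda>x. g x - h x)"
  using sn_triangle[OF diff_closed diff_closed, of f g g h] assms by simp

lemma sn_abs_diff:
  assumes "f \<in> V" "g \<in> V"
  shows "\<bar>sn f - sn g\<bar> \<le> sn (\<lambda>x. f x - g x)"
proof -
  have "sn f \<le> sn (\<lambda>x. f x - g x) + sn g" using sn_triangle[OF diff_closed, of f g g] assms by simp
  moreover have "sn g \<le> sn (\<lambda>x. f x - g x) + sn f"
    using sn_triangle[OF diff_closed, of g f f] assms sn_minus_commute[OF assms] by simp
  ultimately show ?thesis by linarith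
qed

end

section \<open>The trace exponential under rank-one updates\<close>

text \<open>Vectors and matrices are functions on all indices, and the size \<open>d\<close> enters
  through the ranges of the sums. Differentiation and measurability can then be done entrywise
  without carrier conditions.\<close>

definition dotc :: "nat \<Rightarrow> (nat \<Rightarrow> complex) \<Rightarrow> (nat \<Rightarrow> complex) \<Rightarrow> complex" where
  "dotc d u w = (\<Sum>i<d. u i * cnj (w i))"

definition matvec :: "nat \<Rightarrow> (nat \<Rightarrow> nat \<Rightarrow> complex) \<Rightarrow> (nat \<Rightarrow> complex) \<Rightarrow> nat \<Rightarrow> complex" where
  "matvec d A w = (\<lambda>i. \<Sum>j<d. A i j * w j)"

abbreviation matpow :: "nat \<Rightarrow> (nat \<Rightarrow> nat \<Rightarrow> complex) \<Rightarrow> nat \<Rightarrow> (nat \<Rightarrow> complex) \<Rightarrow> nat \<Rightarrow> complex" where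
  "matpow d A k \<equiv> matvec d A ^^ k"

definition unitv :: "nat \<Rightarrow> nat \<Rightarrow> complex" where
  "unitv i = (\<lambda>j. if j = i then 1 else 0)"

definition moment :: "nat \<Rightarrow> (nat \<Rightarrow> nat \<Rightarrow> complex) \<Rightarrow> (nat \<Rightarrow> complex) \<Rightarrow> nat \<Rightarrow> real" where
  "moment d A w k = Re (dotc d (matpow d A k w) w)"

definition power_trace :: "nat \<Rightarrow> (nat \<Rightarrow> nat \<Rightarrow> complex) \<Rightarrow> nat \<Rightarrow> real" where
  "power_trace d A k = (\<Sum>i<d. moment d A (unitv i) k)"

definition hermitian_mat :: "nat \<Rightarrow> (nat \<Rightarrow> nat \<Rightarrow> complex) \<Rightarrow> bool" where
  "hermitian_mat d A \<longleftrightarrow> (\<forall>i<d. \<forall>j<d. A i j = cnj (A j i))"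

definition psd_mat :: "nat \<Rightarrow> (nat \<Rightarrow> nat \<Rightarrow> complex) \<Rightarrow> bool" where
  "psd_mat d A \<longleftrightarrow> hermitian_mat d A \<and> (\<forall>w. 0 \<le> Re (dotc d (matvec d A w) w))"

lemma dotc_add_left: "dotc d (\<lambda>i. u i + u' i) w = dotc d u w + dotc d u' w"
  by (simp add: dotc_def algebra_simps sum.distrib)

lemma dotc_scale_left: "dotc d (\<lambda>i. c * u i) w = c * dotc d u w"
  by (simp add: dotc_def algebra_simps sum_distrib_left)

lemma dotc_cnj: "dotc d u w = cnj (dotc d w u)"
  by (simp add: dotc_def mult.commute)

lemma dotc_unitv_right: "i < d \<Longrightarrow> dotc d u (unitv i) = u i"
  by (simp add: dotc_def unitv_def if_distrib sum.delta cong: if_cong)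

lemma dotc_unitv_left: "i < d \<Longrightarrow> dotc d (unitv i) u = cnj (u i)"
  by (simp add: dotc_cnj[of d "unitv i"] dotc_unitv_right)

lemma dotc_self: "dotc d u u = of_real (\<Sum>i<d. (cmod (u i))\<^sup>2)"
  by (simp only: dotc_def of_real_sum complex_norm_square)

lemma matvec_add: "matvec d A (\<lambda>i. u i + w i) = (\<lambda>i. matvec d A u i + matvec d A w i)"
  by (simp add: matvec_def algebra_simps sum.distrib)

lemma matvec_scale: "matvec d A (\<lambda>i. c * u i) = (\<lambda>i. c * matvec d A u i)"
  by (simp add: matvec_def algebra_simps sum_distrib_left)

lemma matpow_add: "matpow d A k (\<lambda>i. u i + w i) = (\<lambda>i. matpow d A k u i + matpow d A k w i)"
  by (induction k) (simp_all add: matvec_add)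

lemma matpow_scale: "matpow d A k (\<lambda>i. c * u i) = (\<lambda>i. c * matpow d A k u i)"
  by (induction k) (simp_all add: matvec_scale)

text \<open>Linearity in the start vector. In the expectations this separates the matrix power, a
  function of the earlier nodes, from the vector, a function of the next node.\<close>

lemma matpow_expand:
  assumes "i < d"
  shows "matpow d A k w i = (\<Sum>j<d. w j * matpow d A k (unitv j) i)"
  using assms
proof (induction k arbitrary: i)
  case 0
  then show ?case by (simp add: unitv_def if_distrib sum.delta' cong: if_cong)
next
  case (Suc k)
  have "matpow d A (Suc k) w i = (\<Sum>l<d. A i l * (\<Sum>j<d. w j * matpow d A k (unitv j) l))"
    by (simp add: matvec_def[of d A "matpow d A k w"] Suc.IH)
  also have "\<dots> = (\<Sum>j<d. \<Sum>l<d. A i l * (w j * matpow d A k (unitv j) l))"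
    unfolding sum_distrib_left by (rule sum.swap)
  also have "\<dots> = (\<Sum>j<d. w j * matpow d A (Suc k) (unitv j) i)"
    by (simp add: matvec_def sum_distrib_left algebra_simps)
  finally show ?case .
qed

section \<open>Moments of positive semidefinite matrices\<close>

lemma dotc_matvec:
  assumes "hermitian_mat d A"
  shows "dotc d (matvec d A u) w = dotc d u (matvec d A w)"
proof -
  have "dotc d (matvec d A u) w = (\<Sum>i<d. \<Sum>j<d. A i j * u j * cnj (w i))"
    by (simp add: dotc_def matvec_def sum_distrib_right)
  also have "\<dots> = (\<Sum>j<d. \<Sum>i<d. A i j * u j * cnj (w i))" by (rule sum.swap)
  also have "\<dots> = (\<Sum>j<d. \<Sum>i<d. u j * (cnj (A j i) * cnj (w i)))"
  proof (intro sum.cong refl)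
    fix i j assume "j \<in> {..<d}" "i \<in> {..<d}"
    then have "A i j = cnj (A j i)" using assms unfolding hermitian_mat_def by blast
    then show "A i j * u j * cnj (w i) = u j * (cnj (A j i) * cnj (w i))" by simp
  qed
  finally show ?thesis by (simp add: dotc_def matvec_def sum_distrib_left)
qed

lemma dotc_matpow:
  assumes "hermitian_mat d A"
  shows "dotc d (matpow d A k u) w = dotc d u (matpow d A k w)"
  by (induction k arbitrary: u) (simp_all add: funpow_swap1 dotc_matvec[OF assms])

text \<open>Powers can be moved from one argument to the other, so the value depends on
  \<open>a + b\<close> alone and is real; the \<open>Re\<close> in \<open>moment\<close> discards
  nothing for a hermitian matrix.\<close>

lemma dotc_matpow_matpow:
  assumes "hermitian_mat d A"
  shows "dotc d (matpow d A a u) (matpow d A b u) = of_real (moment d A u (a + b))"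
proof -
  have "dotc d (matpow d A a u) (matpow d A b u) = dotc d (matpow d A (a + b) u) u"
    by (subst dotc_matpow[OF assms, symmetric]) (metis add.commute comp_apply funpow_add)
  moreover have "cnj (dotc d (matpow d A (a + b) u) u) = dotc d (matpow d A (a + b) u) u"
    using dotc_matpow[OF assms, of "a + b" u u] dotc_cnj by metis
  ultimately show ?thesis
    by (metis Reals_cnj_iff complex_is_Real_iff moment_def of_real_Re)
qed

text \<open>Half of the power goes to either side: an even moment is the squared norm of
  \<open>matpow d A j u\<close>, an odd one is the form of \<open>A\<close> at that vector.\<close>

lemma moment_nonneg:
  assumes "psd_mat d A"
  shows "0 \<le> moment d A u k"
proof -
  have h: "hermitian_mat d A" using assms by (simp add: psd_mat_def)
  define j where "j = k div 2"
  have "k = j + j \<or> k = Suc j + j" unfolding j_def by presburger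
  then consider "k = j + j" | "k = Suc j + j" by blast
  then show ?thesis
  proof cases
    case 1
    have "of_real (moment d A u k) = dotc d (matpow d A j u) (matpow d A j u)"
      using 1 dotc_matpow_matpow[OF h] by simp
    then have "complex_of_real (moment d A u k) = of_real (\<Sum>i<d. (cmod (matpow d A j u i))\<^sup>2)"
      by (simp only: dotc_self)
    then have "moment d A u k = (\<Sum>i<d. (cmod (matpow d A j u i))\<^sup>2)"
      using of_real_eq_iff by blast
    then show ?thesis by (simp add: sum_nonneg)
  next
    case 2
    have "of_real (moment d A u k) = dotc d (matvec d A (matpow d A j u)) (matpow d A j u)"
      using 2 dotc_matpow_matpow[OF h, of "Suc j" u j] by simp
    then have "moment d A u k = Re (dotc d (matvec d A (matpow d A j u)) (matpow d A j u))"
      by (metis Re_complex_of_real)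
    then show ?thesis using assms by (simp add: psd_mat_def)
  qed
qed

lemma psd_form_matpow:
  assumes "psd_mat d A"
  shows "psd_form UNIV (\<lambda>u w. dotc d (matpow d A k u) w)"
proof
  show "0 \<le> Re (dotc d (matpow d A k f) f)" for f
    using moment_nonneg[OF assms] by (simp add: moment_def)
  show "dotc d (matpow d A k f) g = cnj (dotc d (matpow d A k g) f)" for f g
    using assms dotc_matpow[of d A k f g] dotc_cnj[of d f] by (simp add: psd_mat_def)
qed (simp_all add: matpow_add matpow_scale dotc_add_left dotc_scale_left)

text \<open>Cauchy-Schwarz for the form of the \<open>k\<close>-th power, applied to
  \<open>u\<close> and \<open>A u\<close>; the three values that occur are consecutive
  moments.\<close>

lemma moment_log_convex:
  assumes "psd_mat d A"
  shows "(moment d A u (Suc k))\<^sup>2 \<le> moment d A u k * moment d A u (Suc (Suc k))"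
proof -
  have h: "hermitian_mat d A" using assms by (simp add: psd_mat_def)
  interpret psd_form UNIV "\<lambda>u w. dotc d (matpow d A k u) w" by (rule psd_form_matpow[OF assms])
  have "dotc d (matpow d A k u) (matvec d A u) = of_real (moment d A u (Suc k))"
    using dotc_matpow_matpow[OF h, of k u 1] by simp
  moreover have "dotc d (matpow d A k (matvec d A u)) (matvec d A u)
      = of_real (moment d A u (Suc (Suc k)))"
    using dotc_matpow_matpow[OF h, of "Suc k" u 1] by (simp add: funpow_swap1)
  ultimately show ?thesis
    using cauchy_schwarz[of u "matvec d A u"] by (simp add: moment_def)
qed

text \<open>The quotients \<open>h (Suc k) / h k\<close> increase. The product form also covers
  zeros of \<open>h\<close>, which propagate upwards by log-convexity.\<close>

lemma log_convex_shift:
  fixes h :: "nat \<Rightarrow> real"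
  assumes nn: "\<And>k. 0 \<le> h k" and lc: "\<And>k. (h (Suc k))\<^sup>2 \<le> h k * h (Suc (Suc k))"
    and "a \<le> c"
  shows "h (Suc a) * h c \<le> h a * h (Suc c)"
  using assms(3)
proof (induction c rule: dec_induct)
  case (step c)
  show ?case
  proof (cases "h c = 0")
    case True
    then have "h (Suc c) = 0" using lc[of c] by simp
    then show ?thesis using nn by simp
  next
    case False
    then have p: "h c > 0" using nn[of c] by simp
    have "h c * (h (Suc a) * h (Suc c)) = (h (Suc a) * h c) * h (Suc c)" by simp
    also have "\<dots> \<le> (h a * h (Suc c)) * h (Suc c)" using step.IH nn mult_right_mono by blast
    also have "\<dots> = h a * (h (Suc c))\<^sup>2" by (simp add: power2_eq_square)
    also have "\<dots> \<le> h a * (h c * h (Suc (Suc c)))" using lc nn mult_left_mono by blast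
    finally have "h c * (h (Suc a) * h (Suc c)) \<le> h c * (h a * h (Suc (Suc c)))"
      by (simp add: algebra_simps)
    then show ?thesis using p by simp
  qed
qed simp

text \<open>Unit steps are moved from the smaller index to the larger one until the smaller one is
  0.\<close>

lemma log_convex_supermult:
  fixes h :: "nat \<Rightarrow> real"
  assumes nn: "\<And>k. 0 \<le> h k" and lc: "\<And>k. (h (Suc k))\<^sup>2 \<le> h k * h (Suc (Suc k))"
  shows "h a * h c \<le> h 0 * h (a + c)"
proof -
  have *: "h a * h c \<le> h 0 * h (a + c)" if "a \<le> c" for a c
    using that
  proof (induction a arbitrary: c)
    case (Suc a)
    have "h (Suc a) * h c \<le> h a * h (Suc c)"
      using log_convex_shift[of h, OF nn lc] Suc.prems by simp
    also have "\<dots> \<le> h 0 * h (a + Suc c)" using Suc.IH[of "Suc c"] Suc.prems by simp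
    finally show ?case by simp
  qed simp
  show ?thesis using *[of a c] *[of c a] by (cases "a \<le> c") (simp_all add: ac_simps)
qed

lemmas moment_supermult =
  log_convex_supermult[of "moment d A u" for d A u, OF moment_nonneg moment_log_convex]

lemma moment_0: "moment d A u 0 = (\<Sum>i<d. (cmod (u i))\<^sup>2)"
  by (simp add: moment_def dotc_self)

text \<open>Jensen's inequality for the spectral measure of \<open>u\<close>, obtained by induction
  from \<open>moment_supermult\<close> with the 0-th moment equal to 1.\<close>

lemma moment_ge_power:
  assumes "psd_mat d A" "(\<Sum>i<d. (cmod (u i))\<^sup>2) = 1"
  shows "moment d A u 1 ^ k \<le> moment d A u k"
proof (induction k)
  case 0
  then show ?case using assms(2) by (simp add: moment_0)
next
  case (Suc k)
  have "moment d A u 1 ^ Suc k \<le> moment d A u 1 * moment d A u k"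
    using Suc moment_nonneg[OF assms(1)] by (simp add: mult_left_mono)
  also have "\<dots> \<le> moment d A u 0 * moment d A u (1 + k)" by (rule moment_supermult[OF assms(1) assms(1)])
  finally show ?case using assms(2) by (simp add: moment_0)
qed

text \<open>Cauchy-Schwarz for the form of the \<open>k\<close>-th power bounds its entries by
  products of roots of diagonal entries; a second Cauchy-Schwarz, over the indices, sums these
  against the unit vector. This takes the place of comparing the largest eigenvalue with the
  trace.\<close>

lemma moment_le_power_trace:
  assumes "psd_mat d A" "(\<Sum>i<d. (cmod (u i))\<^sup>2) = 1"
  shows "moment d A u k \<le> power_trace d A k"
proof -
  interpret psd_form UNIV "\<lambda>u w. dotc d (matpow d A k u) w" by (rule psd_form_matpow[OF assms(1)])
  define g where "g i = sqrt (moment d A (unitv i) k)" for i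
  have g2: "(g i)\<^sup>2 = moment d A (unitv i) k" for i
    using moment_nonneg[OF assms(1)] by (simp add: g_def)
  have g0: "0 \<le> g i" for i using moment_nonneg[OF assms(1)] by (simp add: g_def)
  have B: "cmod (matpow d A k (unitv j) i) \<le> g j * g i" if "i < d" for i j
  proof -
    have "(cmod (dotc d (matpow d A k (unitv j)) (unitv i)))\<^sup>2 \<le> (g j * g i)\<^sup>2"
      using cauchy_schwarz[of "unitv j" "unitv i"]
      by (simp add: power_mult_distrib g2 moment_def)
    then show ?thesis using that g0 by (simp add: dotc_unitv_right power2_le_iff_abs_le)
  qed
  have "dotc d (matpow d A k u) u = (\<Sum>i<d. (\<Sum>j<d. u j * matpow d A k (unitv j) i) * cnj (u i))"
    unfolding dotc_def by (intro sum.cong refl) (metis lessThan_iff matpow_expand)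
  then have "moment d A u k = Re (\<Sum>i<d. (\<Sum>j<d. u j * matpow d A k (unitv j) i) * cnj (u i))"
    by (simp only: moment_def)
  also have "\<dots> \<le> cmod (\<Sum>i<d. (\<Sum>j<d. u j * matpow d A k (unitv j) i) * cnj (u i))"
    by (rule complex_Re_le_cmod)
  also have "\<dots> \<le> (\<Sum>i<d. (\<Sum>j<d. cmod (u j) * (g j * g i)) * cmod (u i))"
    by (intro sum_norm_le)
       (auto simp: norm_mult intro!: mult_right_mono sum_norm_le mult_left_mono B)
  also have "\<dots> = (\<Sum>i<d. cmod (u i) * g i)\<^sup>2"
    by (simp add: power2_eq_square sum_distrib_left sum_distrib_right algebra_simps)
  also have "\<dots> \<le> (\<Sum>i<d. (cmod (u i))\<^sup>2) * (\<Sum>i<d. (g i)\<^sup>2)"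
    by (rule Cauchy_Schwarz_ineq_sum)
  also have "\<dots> = power_trace d A k" by (simp add: assms(2) power_trace_def g2)
  finally show ?thesis .
qed

lemma power_trace_nonneg: "psd_mat d A \<Longrightarrow> 0 \<le> power_trace d A k"
  by (simp add: power_trace_def sum_nonneg moment_nonneg)

lemma power_trace_0: "power_trace d A 0 = real d"
  by (simp add: power_trace_def moment_def dotc_self) (simp add: unitv_def if_distrib[of "\<lambda>x. (cmod x)\<^sup>2"] cong: if_cong)

section \<open>Differentiation along a rank-one update\<close>

definition rank1_update :: "(nat \<Rightarrow> nat \<Rightarrow> complex) \<Rightarrow> (nat \<Rightarrow> complex) \<Rightarrow> real \<Rightarrow> nat \<Rightarrow> nat \<Rightarrow> complex" where
  "rank1_update A v s i j = A i j + of_real s * (v i * cnj (v j))"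

lemma matvec_rank1_update:
  "matvec d (rank1_update A v s) w = (\<lambda>i. matvec d A w i + (of_real s * dotc d w v) * v i)"
  by (simp add: matvec_def rank1_update_def dotc_def algebra_simps sum.distrib sum_distrib_left)

lemma dotc_rank1_update:
  "Re (dotc d (matvec d (rank1_update A v s) w) w)
    = Re (dotc d (matvec d A w) w) + s * (cmod (dotc d w v))\<^sup>2"
proof -
  have "dotc d (matvec d (rank1_update A v s) w) w
      = dotc d (matvec d A w) w + of_real s * (dotc d w v * dotc d v w)"
    unfolding matvec_rank1_update dotc_add_left dotc_scale_left by simp
  moreover have "dotc d w v * dotc d v w = of_real ((cmod (dotc d w v))\<^sup>2)"
    using dotc_cnj[of d v w] by (simp add: complex_norm_square[symmetric])
  ultimately show ?thesis by simp
qed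

text \<open>Positivity at the smaller endpoint serves a whole interval of parameters, as the
  Gronwall estimates require.\<close>

lemma psd_rank1_update:
  assumes "psd_mat d (rank1_update A v s)" "s \<le> t"
  shows "psd_mat d (rank1_update A v t)"
  unfolding psd_mat_def
proof (intro conjI allI)
  show "hermitian_mat d (rank1_update A v t)"
    unfolding hermitian_mat_def
  proof (intro allI impI)
    fix i j assume "i < d" "j < d"
    then have "rank1_update A v s i j = cnj (rank1_update A v s j i)"
      using assms(1) unfolding psd_mat_def hermitian_mat_def by blast
    then show "rank1_update A v t i j = cnj (rank1_update A v t j i)"
      by (simp add: rank1_update_def mult.commute)
  qed
  fix w
  have "0 \<le> Re (dotc d (matvec d (rank1_update A v s) w) w)" using assms(1) by (simp add: psd_mat_def)
  also have "\<dots> \<le> Re (dotc d (matvec d (rank1_update A v t) w) w)"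
    unfolding dotc_rank1_update using assms(2) by (simp add: mult_right_mono)
  finally show "0 \<le> Re (dotc d (matvec d (rank1_update A v t) w) w)" .
qed

text \<open>Leibniz rule over the \<open>k\<close> factors: if the factor with \<open>a\<close>
  others to its left is replaced by its derivative \<open>v v\<^sup>*\<close>, what remains is
  \<open>matpow\<close> of order \<open>a\<close> at \<open>v\<close>, times the scalar product of
  the other iterate with \<open>v\<close>.\<close>

lemma matpow_rank1_has_derivative:
  "((\<lambda>s. matpow d (rank1_update A v s) k w i) has_vector_derivative
    (\<Sum>a<k. matpow d (rank1_update A v s) a v i * dotc d (matpow d (rank1_update A v s) (k - 1 - a) w) v))
    (at s)"
proof (induction k arbitrary: i)
  case 0
  then show ?case by simp
next
  case (Suc k)
  let ?P = "\<lambda>s k. matpow d (rank1_update A v s) k"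
  let ?A = "rank1_update A v s"
  have A': "((\<lambda>s. rank1_update A v s i j) has_vector_derivative v i * cnj (v j)) (at s)" for i j
    unfolding rank1_update_def by (auto intro!: derivative_eq_intros simp: scaleR_conv_of_real)
  have "((\<lambda>s. \<Sum>j<d. rank1_update A v s i j * ?P s k w j) has_vector_derivative
     (\<Sum>j<d. ?A i j * (\<Sum>a<k. ?P s a v j * dotc d (?P s (k - 1 - a) w) v) + v i * cnj (v j) * ?P s k w j))
     (at s)"
    by (intro has_vector_derivative_sum has_vector_derivative_mult A' Suc.IH)
  moreover have "(\<Sum>j<d. ?A i j * (\<Sum>a<k. ?P s a v j * dotc d (?P s (k - 1 - a) w) v) + v i * cnj (v j) * ?P s k w j)
     = (\<Sum>a<Suc k. ?P s a v i * dotc d (?P s (Suc k - 1 - a) w) v)"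
  proof -
    have "(\<Sum>j<d. ?A i j * (\<Sum>a<k. ?P s a v j * dotc d (?P s (k - 1 - a) w) v))
      = (\<Sum>a<k. \<Sum>j<d. ?A i j * ?P s a v j * dotc d (?P s (k - 1 - a) w) v)"
      unfolding sum_distrib_left by (subst sum.swap) (simp add: mult.assoc)
    also have "\<dots> = (\<Sum>a<k. ?P s (Suc a) v i * dotc d (?P s (k - 1 - a) w) v)"
      by (simp add: matvec_def sum_distrib_right)
    also have "\<dots> = (\<Sum>a<k. ?P s (Suc a) v i * dotc d (?P s (Suc k - 1 - Suc a) w) v)"
      by (intro sum.cong) auto
    finally have 1: "(\<Sum>j<d. ?A i j * (\<Sum>a<k. ?P s a v j * dotc d (?P s (k - 1 - a) w) v))
      = (\<Sum>a<k. ?P s (Suc a) v i * dotc d (?P s (Suc k - 1 - Suc a) w) v)" .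
    have 2: "(\<Sum>j<d. v i * cnj (v j) * ?P s k w j) = v i * dotc d (?P s k w) v"
      by (simp add: dotc_def sum_distrib_left algebra_simps)
    show ?thesis unfolding sum.distrib 1 2 by (subst sum.lessThan_Suc_shift) simp
  qed
  moreover have "?P t (Suc k) w i = (\<Sum>j<d. rank1_update A v t i j * ?P t k w j)" for t
    by (simp add: matvec_def[of d _ "?P t k w"])
  ultimately show ?case by (simp only:)
qed

lemma moment_rank1_has_derivative:
  assumes "hermitian_mat d (rank1_update A v s)"
  shows "((\<lambda>s. moment d (rank1_update A v s) w k) has_real_derivative
    (\<Sum>a<k. Re (dotc d (matpow d (rank1_update A v s) a v) w
       * dotc d w (matpow d (rank1_update A v s) (k - 1 - a) v)))) (at s)"
proof -
  let ?P = "\<lambda>s k. matpow d (rank1_update A v s) k"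
  have "((\<lambda>s. \<Sum>i<d. ?P s k w i * cnj (w i)) has_vector_derivative
     (\<Sum>i<d. (\<Sum>a<k. ?P s a v i * dotc d (?P s (k - 1 - a) w) v) * cnj (w i))) (at s)"
    by (intro has_vector_derivative_sum has_vector_derivative_mult_left matpow_rank1_has_derivative)
  moreover have "(\<Sum>i<d. (\<Sum>a<k. ?P s a v i * dotc d (?P s (k - 1 - a) w) v) * cnj (w i))
     = (\<Sum>a<k. dotc d (?P s a v) w * dotc d (?P s (k - 1 - a) w) v)"
    unfolding sum_distrib_right by (subst sum.swap) (simp add: dotc_def sum_distrib_right algebra_simps)
  ultimately have "((\<lambda>s. dotc d (?P s k w) w) has_vector_derivative
     (\<Sum>a<k. dotc d (?P s a v) w * dotc d w (?P s (k - 1 - a) v))) (at s)"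
    by (simp add: dotc_def[of d "?P _ k w"] dotc_matpow[OF assms])
  from bounded_linear.has_vector_derivative[OF bounded_linear_Re this]
  show ?thesis by (simp add: moment_def has_real_derivative_iff_has_vector_derivative)
qed

lemma moment_rank1_derivative_self:
  assumes "hermitian_mat d (rank1_update A v s)"
  shows "((\<lambda>s. moment d (rank1_update A v s) v k) has_real_derivative
    (\<Sum>a<k. moment d (rank1_update A v s) v a * moment d (rank1_update A v s) v (k - 1 - a))) (at s)"
proof -
  let ?A = "rank1_update A v s"
  have "dotc d (matpow d ?A a v) v * dotc d v (matpow d ?A c v)
      = of_real (moment d ?A v a * moment d ?A v c)" for a c
    using dotc_matpow_matpow[OF assms, of a v 0] dotc_matpow_matpow[OF assms, of 0 v c] by simp
  then show ?thesis using moment_rank1_has_derivative[OF assms, of v k] by simp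
qed

text \<open>Cyclicity of the trace: all \<open>k\<close> positions of the differentiated factor
  contribute the same number.\<close>

lemma power_trace_rank1_derivative:
  assumes "hermitian_mat d (rank1_update A v s)"
  shows "((\<lambda>s. power_trace d (rank1_update A v s) k) has_real_derivative
    real k * moment d (rank1_update A v s) v (k - 1)) (at s)"
proof -
  let ?A = "rank1_update A v s"
  have "((\<lambda>s. power_trace d (rank1_update A v s) k) has_real_derivative
    (\<Sum>i<d. \<Sum>a<k. Re (dotc d (matpow d ?A a v) (unitv i) * dotc d (unitv i) (matpow d ?A (k - 1 - a) v)))) (at s)"
    unfolding power_trace_def by (intro DERIV_sum moment_rank1_has_derivative assms)
  moreover have "(\<Sum>i<d. \<Sum>a<k. Re (dotc d (matpow d ?A a v) (unitv i) * dotc d (unitv i) (matpow d ?A (k - 1 - a) v)))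
    = (\<Sum>a<k. Re (dotc d (matpow d ?A a v) (matpow d ?A (k - 1 - a) v)))"
  proof (subst sum.swap, intro sum.cong refl)
    fix a
    show "(\<Sum>i<d. Re (dotc d (matpow d ?A a v) (unitv i) * dotc d (unitv i) (matpow d ?A (k - 1 - a) v)))
        = Re (dotc d (matpow d ?A a v) (matpow d ?A (k - 1 - a) v))"
      by (simp add: dotc_unitv_left dotc_unitv_right) (simp add: dotc_def sum.distrib)
  qed
  moreover have "\<dots> = (\<Sum>a<k. moment d ?A v (k - 1))"
    by (intro sum.cong refl) (simp add: dotc_matpow_matpow[OF assms])
  ultimately show ?thesis by simp
qed

section \<open>The truncated exponential and its Gronwall estimates\<close>

definition exp_trace :: "nat \<Rightarrow> (nat \<Rightarrow> nat \<Rightarrow> complex) \<Rightarrow> nat \<Rightarrow> real" where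
  "exp_trace d A N = (\<Sum>k\<le>N. power_trace d A k / fact k)"

text \<open>The range ends one term earlier than in \<open>exp_trace\<close> because differentiating
  a power trace lowers the exponent by one.\<close>

definition exp_moment :: "nat \<Rightarrow> (nat \<Rightarrow> nat \<Rightarrow> complex) \<Rightarrow> (nat \<Rightarrow> complex) \<Rightarrow> nat \<Rightarrow> real" where
  "exp_moment d A v N = (\<Sum>k<N. moment d A v k / fact k)"

lemma exp_moment_nonneg: "psd_mat d A \<Longrightarrow> 0 \<le> exp_moment d A v N"
  by (simp add: exp_moment_def sum_nonneg moment_nonneg)

lemma exp_trace_rank1_derivative:
  assumes "hermitian_mat d (rank1_update A v s)"
  shows "((\<lambda>s. exp_trace d (rank1_update A v s) N) has_real_derivative
    exp_moment d (rank1_update A v s) v N) (at s)"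
proof -
  let ?A = "rank1_update A v s"
  have "((\<lambda>s. exp_trace d (rank1_update A v s) N) has_real_derivative
    (\<Sum>k\<le>N. real k * moment d ?A v (k - 1) / fact k)) (at s)"
    unfolding exp_trace_def by (intro DERIV_sum DERIV_cdivide power_trace_rank1_derivative assms)
  moreover have "(\<Sum>k\<le>N. real k * moment d ?A v (k - 1) / fact k) = exp_moment d ?A v N"
    unfolding exp_moment_def by (subst sum.atMost_shift) (simp add: divide_simps)
  ultimately show ?thesis by simp
qed

text \<open>The derivative of the \<open>k\<close>-th moment is a sum of \<open>k\<close> products
  of moments with orders adding up to k - 1. Supermultiplicativity bounds each by the 0-th times the
  (k-1)-st moment, the factor \<open>k\<close> cancels in \<open>fact k\<close>, and the 0-th moment
  is the squared norm of \<open>v\<close>. The cancellation costs the top term of the truncation,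
  which is nonnegative.\<close>

lemma exp_moment_rank1_derivative:
  assumes "psd_mat d (rank1_update A v s)" "(\<Sum>i<d. (cmod (v i))\<^sup>2) \<le> u"
  obtains D where "((\<lambda>s. exp_moment d (rank1_update A v s) v N) has_real_derivative D) (at s)"
    "D \<le> u * exp_moment d (rank1_update A v s) v N"
proof
  let ?A = "rank1_update A v s"
  have h: "hermitian_mat d ?A" using assms(1) by (simp add: psd_mat_def)
  let ?D = "\<Sum>k<N. (\<Sum>a<k. moment d ?A v a * moment d ?A v (k - 1 - a)) / fact k"
  show "((\<lambda>s. exp_moment d (rank1_update A v s) v N) has_real_derivative ?D) (at s)"
    unfolding exp_moment_def by (intro DERIV_sum DERIV_cdivide moment_rank1_derivative_self h)
  have "?D \<le> (\<Sum>k<N. (\<Sum>a<k. moment d ?A v 0 * moment d ?A v (k - 1)) / fact k)"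
  proof (intro sum_mono divide_right_mono)
    fix k a :: nat assume "a \<in> {..<k}"
    then show "moment d ?A v a * moment d ?A v (k - 1 - a) \<le> moment d ?A v 0 * moment d ?A v (k - 1)"
      using moment_supermult[OF assms(1) assms(1), of v a "k - 1 - a"] by simp
  qed simp
  also have "\<dots> = moment d ?A v 0 * (\<Sum>k<N. real k * moment d ?A v (k - 1) / fact k)"
    by (simp add: sum_distrib_left algebra_simps)
  also have "(\<Sum>k<N. real k * moment d ?A v (k - 1) / fact k) = (\<Sum>k<N - 1. moment d ?A v k / fact k)"
  proof (cases N)
    case (Suc n)
    show ?thesis unfolding Suc by (subst sum.lessThan_Suc_shift) (simp add: divide_simps)
  qed simp
  also have "moment d ?A v 0 * \<dots> \<le> moment d ?A v 0 * exp_moment d ?A v N"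
    unfolding exp_moment_def
    by (intro mult_left_mono sum_mono2) (auto intro!: divide_nonneg_nonneg moment_nonneg[OF assms(1)])
  also have "\<dots> \<le> u * exp_moment d ?A v N"
    using assms exp_moment_nonneg by (intro mult_right_mono) (auto simp: moment_0)
  finally show "?D \<le> u * exp_moment d ?A v N" .
qed

text \<open>\<open>g s * exp (- u * s)\<close> decreases, and the resulting bound on
  \<open>g\<close> is integrated over [0, 1]. The estimate is expressed by \<open>g 0\<close>
  because at \<open>s = 0\<close> the matrix does not yet contain the new sample, which is what lets
  the expectation factorise.\<close>

lemma gronwall_upper:
  fixes f g :: "real \<Rightarrow> real"
  assumes f': "\<And>s. 0 \<le> s \<Longrightarrow> s \<le> 1 \<Longrightarrow> (f has_real_derivative g s) (at s)"
    and g': "\<And>s. 0 \<le> s \<Longrightarrow> s \<le> 1 \<Longrightarrow> \<exists>D. (g has_real_derivative D) (at s) \<and> D \<le> u * g s"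
    and "0 < u"
  shows "f 1 \<le> f 0 + (exp u - 1) / u * g 0"
proof -
  have gs: "g s \<le> exp (u * s) * g 0" if s: "0 \<le> s" "s \<le> 1" for s
  proof -
    have "exp (- u * s) * g s \<le> exp (- u * 0) * g 0"
    proof (rule DERIV_nonpos_imp_nonincreasing[OF s(1)])
      fix x assume "0 \<le> x" "x \<le> s"
      with s g'[of x] obtain D where D: "(g has_real_derivative D) (at x)" "D \<le> u * g x" by auto
      have "((\<lambda>s. exp (- u * s) * g s) has_real_derivative exp (- u * x) * (D - u * g x)) (at x)"
        by (auto intro!: derivative_eq_intros D(1) simp: algebra_simps)
      moreover have "exp (- u * x) * (D - u * g x) \<le> 0" using D(2) by (simp add: mult_le_0_iff)
      ultimately show "\<exists>y. ((\<lambda>s. exp (- u * s) * g s) has_real_derivative y) (at x) \<and> y \<le> 0" by blast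
    qed
    then show ?thesis by (simp add: exp_minus field_simps)
  qed
  have "f 1 - exp (u * 1) / u * g 0 \<le> f 0 - exp (u * 0) / u * g 0"
  proof (rule DERIV_nonpos_imp_nonincreasing[where f = "\<lambda>s. f s - exp (u * s) / u * g 0"])
    fix x :: real assume x: "0 \<le> x" "x \<le> 1"
    have "((\<lambda>s. f s - exp (u * s) / u * g 0) has_real_derivative g x - exp (u * x) * g 0) (at x)"
      using \<open>0 < u\<close> by (auto intro!: derivative_eq_intros f' x)
    then show "\<exists>y. ((\<lambda>s. f s - exp (u * s) / u * g 0) has_real_derivative y) (at x) \<and> y \<le> 0"
      using gs[OF x] by force
  qed simp
  then show ?thesis by (simp add: diff_divide_distrib algebra_simps)
qed

text \<open>Going backwards from 0 the same differential inequality bounds \<open>g\<close> from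
  below by \<open>exp (u * s) * g 0\<close>. Again the value at the base point 0 appears, and the
  integral over [-1, 0] gives the factor \<open>(1 - exp (- u)) / u\<close>.\<close>

lemma gronwall_lower:
  fixes f g :: "real \<Rightarrow> real"
  assumes f': "\<And>s. -1 \<le> s \<Longrightarrow> s \<le> 0 \<Longrightarrow> (f has_real_derivative g s) (at s)"
    and g': "\<And>s. -1 \<le> s \<Longrightarrow> s \<le> 0 \<Longrightarrow> \<exists>D. (g has_real_derivative D) (at s) \<and> D \<le> u * g s"
    and "0 < u"
  shows "f (-1) \<le> f 0 - (1 - exp (- u)) / u * g 0"
proof -
  have gs: "exp (u * s) * g 0 \<le> g s" if s: "-1 \<le> s" "s \<le> 0" for s
  proof -
    have "exp (- u * 0) * g 0 \<le> exp (- u * s) * g s"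
    proof (rule DERIV_nonpos_imp_nonincreasing[OF s(2)])
      fix x assume "s \<le> x" "x \<le> 0"
      with s g'[of x] obtain D where D: "(g has_real_derivative D) (at x)" "D \<le> u * g x" by auto
      have "((\<lambda>s. exp (- u * s) * g s) has_real_derivative exp (- u * x) * (D - u * g x)) (at x)"
        by (auto intro!: derivative_eq_intros D(1) simp: algebra_simps)
      moreover have "exp (- u * x) * (D - u * g x) \<le> 0" using D(2) by (simp add: mult_le_0_iff)
      ultimately show "\<exists>y. ((\<lambda>s. exp (- u * s) * g s) has_real_derivative y) (at x) \<and> y \<le> 0" by blast
    qed
    then show ?thesis by (simp add: exp_minus field_simps)
  qed
  have "f (-1) - exp (u * -1) / u * g 0 \<le> f 0 - exp (u * 0) / u * g 0"
  proof (rule DERIV_nonneg_imp_nondecreasing[where f = "\<lambda>s. f s - exp (u * s) / u * g 0"])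
    fix x :: real assume x: "-1 \<le> x" "x \<le> 0"
    have "((\<lambda>s. f s - exp (u * s) / u * g 0) has_real_derivative g x - exp (u * x) * g 0) (at x)"
      using \<open>0 < u\<close> by (auto intro!: derivative_eq_intros f' x)
    then show "\<exists>y. ((\<lambda>s. f s - exp (u * s) / u * g 0) has_real_derivative y) (at x) \<and> 0 \<le> y"
      using gs[OF x] by force
  qed simp
  then show ?thesis by (simp add: diff_divide_distrib algebra_simps)
qed

lemma rank1_update_0: "rank1_update A v 0 = A"
  by (simp add: rank1_update_def fun_eq_iff)

lemma exp_trace_rank1_upper:
  assumes "psd_mat d A" "(\<Sum>i<d. (cmod (v i))\<^sup>2) \<le> u" "0 < u"
  shows "exp_trace d (rank1_update A v 1) N \<le> exp_trace d A N + (exp u - 1) / u * exp_moment d A v N"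
proof -
  have psd: "psd_mat d (rank1_update A v s)" if "0 \<le> s" for s
    using psd_rank1_update[of d A v 0 s] assms(1) that by (simp add: rank1_update_0)
  show ?thesis
    using gronwall_upper[of "\<lambda>s. exp_trace d (rank1_update A v s) N"
        "\<lambda>s. exp_moment d (rank1_update A v s) v N" u]
      exp_trace_rank1_derivative exp_moment_rank1_derivative[OF psd assms(2)] psd assms(3)
    unfolding psd_mat_def rank1_update_0 by metis
qed

text \<open>The rank-one matrix is subtracted, so the hypothesis concerns the far end
  \<open>s = -1\<close>, where positivity is hardest.\<close>

lemma exp_trace_rank1_lower:
  assumes "psd_mat d (rank1_update A v (-1))" "(\<Sum>i<d. (cmod (v i))\<^sup>2) \<le> u" "0 < u"
  shows "exp_trace d (rank1_update A v (-1)) N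
    \<le> exp_trace d A N - (1 - exp (- u)) / u * exp_moment d A v N"
proof -
  have psd: "psd_mat d (rank1_update A v s)" if "-1 \<le> s" for s
    using psd_rank1_update[of d A v "-1" s] assms(1) that by simp
  show ?thesis
    using gronwall_lower[of "\<lambda>s. exp_trace d (rank1_update A v s) N"
        "\<lambda>s. exp_moment d (rank1_update A v s) v N" u]
      exp_trace_rank1_derivative exp_moment_rank1_derivative[OF psd assms(2)] psd assms(3)
    unfolding psd_mat_def rank1_update_0 by metis
qed

lemma power_trace_ge_power:
  assumes "psd_mat d A" "(\<Sum>i<d. (cmod (w i))\<^sup>2) = 1"
    "0 \<le> c" "c \<le> Re (dotc d (matvec d A w) w)"
  shows "c ^ k \<le> power_trace d A k"
proof -
  have "c ^ k \<le> moment d A w 1 ^ k" using assms(3,4) by (intro power_mono) (simp_all add: moment_def)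
  also have "\<dots> \<le> power_trace d A k"
    using moment_ge_power[OF assms(1,2)] moment_le_power_trace[OF assms(1,2)] order_trans by blast
  finally show ?thesis .
qed

section \<open>Tail bounds for sums of independent rank-one matrices\<close>

text \<open>In contrast to integrability this class is closed under products, so every polynomial in
  the entries of a sample matrix is integrable over a probability space.\<close>

definition bdd_measurable :: "'a measure \<Rightarrow> ('a \<Rightarrow> 'b :: {real_normed_field, second_countable_topology, banach}) \<Rightarrow> bool" where
  "bdd_measurable N f \<longleftrightarrow> f \<in> borel_measurable N \<and> (\<exists>B. \<forall>x\<in>space N. norm (f x) \<le> B)"

lemma bdd_measurable_const: "bdd_measurable N (\<lambda>x. c)"
  by (auto simp: bdd_measurable_def)

lemma bdd_measurable_add:
  assumes "bdd_measurable N f" "bdd_measurable N g"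
  shows "bdd_measurable N (\<lambda>x. f x + g x)"
proof -
  from assms obtain B C where "\<forall>x\<in>space N. norm (f x) \<le> B" "\<forall>x\<in>space N. norm (g x) \<le> C"
    by (auto simp: bdd_measurable_def)
  then have "\<forall>x\<in>space N. norm (f x + g x) \<le> B + C"
    by (meson add_mono norm_triangle_ineq order_trans)
  then show ?thesis using assms by (auto simp: bdd_measurable_def)
qed

lemma bdd_measurable_mult:
  assumes "bdd_measurable N f" "bdd_measurable N g"
  shows "bdd_measurable N (\<lambda>x. f x * g x)"
proof -
  from assms obtain B C where B: "\<forall>x\<in>space N. norm (f x) \<le> B" and C: "\<forall>x\<in>space N. norm (g x) \<le> C"
    by (auto simp: bdd_measurable_def)
  have "\<forall>x\<in>space N. norm (f x * g x) \<le> B * C"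
    using B C by (metis mult_mono' norm_ge_zero norm_mult)
  then show ?thesis using assms by (auto simp: bdd_measurable_def)
qed

lemma bdd_measurable_sum:
  assumes "\<And>i. i \<in> I \<Longrightarrow> bdd_measurable N (f i)"
  shows "bdd_measurable N (\<lambda>x. \<Sum>i\<in>I. f i x)"
  using assms
  by (induction I rule: infinite_finite_induct) (simp_all add: bdd_measurable_const bdd_measurable_add)

lemma bdd_measurable_cnj:
  assumes "bdd_measurable N f"
  shows "bdd_measurable N (\<lambda>x. cnj (f x))"
proof -
  have "cnj \<in> borel_measurable borel"
    by (intro borel_measurable_continuous_onI continuous_intros)
  then show ?thesis using assms unfolding bdd_measurable_def
    by (auto intro: measurable_compose[where g = cnj])
qed

lemma bdd_measurable_Re:
  assumes "bdd_measurable N f"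
  shows "bdd_measurable N (\<lambda>x. Re (f x))"
  using assms abs_Re_le_cmod unfolding bdd_measurable_def
  by (auto intro: order_trans)

lemma bdd_measurable_matpow:
  assumes "\<And>i j. i < d \<Longrightarrow> j < d \<Longrightarrow> bdd_measurable N (\<lambda>x. A x i j)"
    and "\<And>i. i < d \<Longrightarrow> bdd_measurable N (\<lambda>x. v x i)" and "i < d"
  shows "bdd_measurable N (\<lambda>x. matpow d (A x) k (v x) i)"
  using assms(3)
proof (induction k arbitrary: i)
  case 0
  then show ?case using assms(2) by simp
next
  case (Suc k)
  have "bdd_measurable N (\<lambda>x. \<Sum>j<d. A x i j * matpow d (A x) k (v x) j)"
    using Suc assms(1) by (auto intro!: bdd_measurable_sum bdd_measurable_mult)
  moreover have "matpow d (A x) (Suc k) (v x) i = (\<Sum>j<d. A x i j * matpow d (A x) k (v x) j)" for x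
    by (simp add: matvec_def[of d _ "matpow d _ k _"])
  ultimately show ?case by (simp only:)
qed

lemma bdd_measurable_moment:
  assumes "\<And>i j. i < d \<Longrightarrow> j < d \<Longrightarrow> bdd_measurable N (\<lambda>x. A x i j)"
    and "\<And>i. i < d \<Longrightarrow> bdd_measurable N (\<lambda>x. v x i)"
  shows "bdd_measurable N (\<lambda>x. moment d (A x) (v x) k)"
  unfolding moment_def dotc_def
  by (intro bdd_measurable_Re bdd_measurable_sum bdd_measurable_mult bdd_measurable_cnj
      bdd_measurable_matpow) (use assms in auto)

lemma bdd_measurable_power_trace:
  assumes "\<And>i j. i < d \<Longrightarrow> j < d \<Longrightarrow> bdd_measurable N (\<lambda>x. A x i j)"
  shows "bdd_measurable N (\<lambda>x. power_trace d (A x) k)"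
  unfolding power_trace_def using assms
  by (auto intro!: bdd_measurable_sum bdd_measurable_moment bdd_measurable_const)

lemma bdd_measurable_exp_trace:
  assumes "\<And>i j. i < d \<Longrightarrow> j < d \<Longrightarrow> bdd_measurable N (\<lambda>x. A x i j)"
  shows "bdd_measurable N (\<lambda>x. exp_trace d (A x) k)"
  unfolding exp_trace_def divide_inverse using assms
  by (auto intro!: bdd_measurable_sum bdd_measurable_mult bdd_measurable_power_trace bdd_measurable_const)

lemma bdd_measurable_exp_moment:
  assumes "\<And>i j. i < d \<Longrightarrow> j < d \<Longrightarrow> bdd_measurable N (\<lambda>x. A x i j)"
    and "\<And>i. i < d \<Longrightarrow> bdd_measurable N (\<lambda>x. v x i)"
  shows "bdd_measurable N (\<lambda>x. exp_moment d (A x) (v x) k)"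
  unfolding exp_moment_def divide_inverse using assms
  by (auto intro!: bdd_measurable_sum bdd_measurable_mult bdd_measurable_moment bdd_measurable_const)

lemma (in prob_space) bdd_measurable_integrable:
  fixes f :: "'a \<Rightarrow> 'b :: {real_normed_field, second_countable_topology, banach}"
  shows "bdd_measurable M f \<Longrightarrow> integrable M f"
  unfolding bdd_measurable_def by (auto intro!: integrable_const_bound)

section \<open>Sample matrices and what their traces detect\<close>

definition sample_mat :: "real \<Rightarrow> real \<Rightarrow> ('x \<Rightarrow> nat \<Rightarrow> complex) \<Rightarrow> (nat \<Rightarrow> 'x) \<Rightarrow> nat \<Rightarrow> nat \<Rightarrow> nat \<Rightarrow> complex" where
  "sample_mat C t w x k i j =
     (if i = j then of_real C else 0) + of_real t * (\<Sum>l=1..k. w (x l) i * cnj (w (x l) j))"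

text \<open>\<open>s\<close> is the sign 1 or -1, so that a new sample is one end of a Gronwall
  interval; the step width is absorbed into the vector through its square root. One matrix family
  thus serves both tails: \<open>C = 0\<close> with positive sign, and a positive shift
  \<open>C\<close> with negative sign.\<close>

lemma sample_mat_Suc:
  assumes "0 \<le> t" "s\<^sup>2 = 1"
  shows "sample_mat C (s * t) w x (Suc k)
    = rank1_update (sample_mat C (s * t) w x k) (\<lambda>i. of_real (sqrt t) * w (x (Suc k)) i) s"
proof (intro ext)
  fix i j
  have "of_real t = complex_of_real (sqrt t) * of_real (sqrt t)"
    using assms(1) by (simp flip: of_real_mult)
  then show "sample_mat C (s * t) w x (Suc k) i j
    = rank1_update (sample_mat C (s * t) w x k) (\<lambda>i. of_real (sqrt t) * w (x (Suc k)) i) s i j"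
    by (simp add: sample_mat_def rank1_update_def algebra_simps)
qed

lemma dotc_sample_mat:
  "dotc d (matvec d (sample_mat C t w x k) z) z
    = of_real (C * (\<Sum>i<d. (cmod (z i))\<^sup>2) + t * (\<Sum>l=1..k. (cmod (dotc d z (w (x l))))\<^sup>2))"
proof -
  have "matvec d (sample_mat C t w x k) z i
      = of_real C * z i + of_real t * (\<Sum>l=1..k. w (x l) i * dotc d z (w (x l)))" if "i < d" for i
  proof -
    have "(\<Sum>j<d. (\<Sum>l=1..k. w (x l) i * cnj (w (x l) j)) * z j)
        = (\<Sum>l=1..k. w (x l) i * dotc d z (w (x l)))"
      unfolding sum_distrib_right dotc_def sum_distrib_left by (subst sum.swap) (simp add: ac_simps)
    moreover have "(\<Sum>j<d. (if i = j then of_real C else 0) * z j) = of_real C * z i"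
      using that by (simp add: if_distrib[of "\<lambda>a. a * _"] cong: if_cong)
    ultimately show ?thesis
      by (simp add: matvec_def sample_mat_def algebra_simps sum.distrib flip: sum_distrib_left)
  qed
  then have "dotc d (matvec d (sample_mat C t w x k) z) z
      = (\<Sum>i<d. (of_real C * z i + of_real t * (\<Sum>l=1..k. w (x l) i * dotc d z (w (x l)))) * cnj (z i))"
    by (simp add: dotc_def)
  also have "\<dots> = of_real C * dotc d z z + of_real t * (\<Sum>l=1..k. dotc d z (w (x l)) * dotc d (w (x l)) z)"
  proof -
    have "(\<Sum>i<d. (\<Sum>l=1..k. w (x l) i * dotc d z (w (x l))) * cnj (z i))
        = (\<Sum>l=1..k. dotc d z (w (x l)) * dotc d (w (x l)) z)"
      unfolding sum_distrib_right by (subst sum.swap) (simp add: dotc_def[of d "w _"] sum_distrib_left ac_simps)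
    then show ?thesis
      by (simp add: dotc_def[of d z z] algebra_simps sum.distrib flip: sum_distrib_left)
  qed
  also have "(\<Sum>l=1..k. dotc d z (w (x l)) * dotc d (w (x l)) z)
      = of_real (\<Sum>l=1..k. (cmod (dotc d z (w (x l))))\<^sup>2)"
    unfolding of_real_sum
  proof (intro sum.cong refl)
    fix l
    show "dotc d z (w (x l)) * dotc d (w (x l)) z = of_real ((cmod (dotc d z (w (x l))))\<^sup>2)"
      using dotc_cnj[of d "w (x l)" z] by (simp add: complex_norm_square[symmetric])
  qed
  finally show ?thesis by (simp add: dotc_self)
qed

lemma hermitian_sample_mat: "hermitian_mat d (sample_mat C t w x k)"
  by (simp add: hermitian_mat_def sample_mat_def ac_simps)

lemma dotc_cauchy_schwarz:
  "(cmod (dotc d z v))\<^sup>2 \<le> (\<Sum>i<d. (cmod (z i))\<^sup>2) * (\<Sum>i<d. (cmod (v i))\<^sup>2)"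
proof -
  have "cmod (dotc d z v) \<le> (\<Sum>i<d. cmod (z i) * cmod (v i))"
    unfolding dotc_def by (rule sum_norm_le) (simp add: norm_mult)
  then have "(cmod (dotc d z v))\<^sup>2 \<le> (\<Sum>i<d. cmod (z i) * cmod (v i))\<^sup>2"
    by (rule power_mono) simp
  also have "\<dots> \<le> (\<Sum>i<d. (cmod (z i))\<^sup>2) * (\<Sum>i<d. (cmod (v i))\<^sup>2)"
    by (rule Cauchy_Schwarz_ineq_sum)
  finally show ?thesis .
qed

lemma unit_rescale:
  assumes "(\<Sum>i<d. (cmod (z i))\<^sup>2) \<noteq> 0"
  shows "\<exists>y. (\<Sum>i<d. (cmod (y i))\<^sup>2) = 1 \<and>
    (\<forall>v. (cmod (dotc d y v))\<^sup>2 = (cmod (dotc d z v))\<^sup>2 / (\<Sum>i<d. (cmod (z i))\<^sup>2))"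
proof -
  define s where "s = sqrt (\<Sum>i<d. (cmod (z i))\<^sup>2)"
  have s2: "s\<^sup>2 = (\<Sum>i<d. (cmod (z i))\<^sup>2)" by (simp add: s_def sum_nonneg)
  have s: "s \<noteq> 0" using assms by (simp add: s_def)
  show ?thesis
  proof (intro exI[of _ "\<lambda>i. of_real (1 / s) * z i"] conjI allI)
    show "(\<Sum>i<d. (cmod (of_real (1 / s) * z i))\<^sup>2) = 1"
      using s by (simp add: norm_mult norm_divide power_divide s2[symmetric] flip: sum_divide_distrib)
    show "(cmod (dotc d (\<lambda>i. of_real (1 / s) * z i) v))\<^sup>2 = (cmod (dotc d z v))\<^sup>2 / (\<Sum>i<d. (cmod (z i))\<^sup>2)" for v
      unfolding dotc_scale_left s2[symmetric] by (simp add: norm_mult norm_divide power_divide)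
  qed
qed

lemma psd_sample_mat_pos:
  assumes "0 \<le> C" "0 \<le> t"
  shows "psd_mat d (sample_mat C t w x k)"
  using assms by (simp add: psd_mat_def hermitian_sample_mat dotc_sample_mat sum_nonneg)

text \<open>By Cauchy-Schwarz each rank-one summand has norm at most \<open>R\<close>, so
  \<open>k\<close> of them with weight \<open>t\<close> cannot outweigh the shift
  \<open>C\<close>.\<close>

lemma psd_sample_mat_neg:
  assumes "\<And>l. l \<in> {1..k} \<Longrightarrow> (\<Sum>i<d. (cmod (w (x l) i))\<^sup>2) \<le> R" "0 \<le> t" "t * real k * R \<le> C"
  shows "psd_mat d (sample_mat C (-t) w x k)"
  unfolding psd_mat_def
proof (intro conjI allI hermitian_sample_mat)
  fix z
  let ?z = "\<Sum>i<d. (cmod (z i))\<^sup>2"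
  have "(\<Sum>l=1..k. (cmod (dotc d z (w (x l))))\<^sup>2) \<le> (\<Sum>l=1..k. ?z * R)"
  proof (rule sum_mono)
    fix l assume l: "l \<in> {1..k}"
    have "(cmod (dotc d z (w (x l))))\<^sup>2 \<le> ?z * (\<Sum>i<d. (cmod (w (x l) i))\<^sup>2)" by (rule dotc_cauchy_schwarz)
    also have "\<dots> \<le> ?z * R" using assms(1)[OF l] by (intro mult_left_mono) (simp_all add: sum_nonneg)
    finally show "(cmod (dotc d z (w (x l))))\<^sup>2 \<le> ?z * R" .
  qed
  then have "t * (\<Sum>l=1..k. (cmod (dotc d z (w (x l))))\<^sup>2) \<le> t * (real k * (?z * R))"
    using assms(2) by (intro mult_left_mono) simp_all
  also have "\<dots> = (t * real k * R) * ?z" by simp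
  also have "\<dots> \<le> C * ?z" using assms(3) by (intro mult_right_mono) (simp_all add: sum_nonneg)
  finally show "0 \<le> Re (dotc d (matvec d (sample_mat C (-t) w x k) z) z)"
    by (simp add: dotc_sample_mat)
qed

lemma moment_scale: "moment d A (\<lambda>i. of_real c * v i) k = c\<^sup>2 * moment d A v k"
proof -
  have "dotc d (matpow d A k (\<lambda>i. of_real c * v i)) (\<lambda>i. of_real c * v i)
      = of_real (c\<^sup>2) * dotc d (matpow d A k v) v"
    unfolding matpow_scale by (simp add: dotc_def sum_distrib_left power2_eq_square ac_simps)
  then show ?thesis by (simp add: moment_def)
qed

lemma exp_moment_scale: "exp_moment d A (\<lambda>i. of_real c * v i) N = c\<^sup>2 * exp_moment d A v N"
  by (simp add: exp_moment_def moment_scale sum_distrib_left)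

lemma sum_exp_le:
  assumes "0 \<le> (c::real)"
  shows "(\<Sum>k\<le>N. c ^ k / fact k) \<le> exp c"
proof -
  have "(\<lambda>k. c ^ k / fact k) sums exp c"
    using exp_converges[of c] by (simp add: scaleR_conv_of_real divide_inverse mult.commute)
  then show ?thesis
    using sum_le_suminf[of "\<lambda>k. c ^ k / fact k" "{..N}"] assms by (auto simp: sums_iff)
qed

lemma sum_exp_tendsto: "(\<lambda>N. \<Sum>k\<le>N. (c::real) ^ k / fact k) \<longlonglongrightarrow> exp c"
  using exp_converges[of c] by (simp add: sums_def_le scaleR_conv_of_real divide_inverse mult.commute)

lemma exp_trace_ge:
  assumes "psd_mat d A" "(\<Sum>i<d. (cmod (z i))\<^sup>2) = 1" "0 \<le> c" "c \<le> Re (dotc d (matvec d A z) z)"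
  shows "(\<Sum>k\<le>N. c ^ k / fact k) \<le> exp_trace d A N"
  unfolding exp_trace_def
  by (intro sum_mono divide_right_mono power_trace_ge_power[OF assms]) simp

text \<open>The constant term of the exponential contributes \<open>d\<close> to the trace but 1 to
  the scalar series. Comparing the remaining terms alone removes the dimension.\<close>

lemma exp_trace_minus_dim_ge:
  assumes "psd_mat d A" "(\<Sum>i<d. (cmod (z i))\<^sup>2) = 1" "0 \<le> c" "c \<le> Re (dotc d (matvec d A z) z)"
  shows "(\<Sum>k\<le>N. c ^ k / fact k) - 1 \<le> exp_trace d A N - real d"
proof -
  have "(\<Sum>k\<in>{..N} - {0}. c ^ k / fact k) \<le> (\<Sum>k\<in>{..N} - {0}. power_trace d A k / fact k)"
    by (intro sum_mono divide_right_mono power_trace_ge_power[OF assms]) simp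
  moreover have "(\<Sum>k\<le>N. c ^ k / fact k) = 1 + (\<Sum>k\<in>{..N} - {0}. c ^ k / fact k)"
    by (subst sum.remove[of _ 0]) simp_all
  moreover have "exp_trace d A N = real d + (\<Sum>k\<in>{..N} - {0}. power_trace d A k / fact k)"
    unfolding exp_trace_def by (subst sum.remove[of _ 0]) (simp_all add: power_trace_0)
  ultimately show ?thesis by linarith
qed

lemma exp_trace_mono:
  assumes "psd_mat d A" "N \<le> N'"
  shows "exp_trace d A N \<le> exp_trace d A N'"
  unfolding exp_trace_def using assms
  by (intro sum_mono2) (auto intro!: divide_nonneg_nonneg power_trace_nonneg)

lemma power_trace_scalar:
  "power_trace d (sample_mat C t w x 0) k = real d * C ^ k"
proof -
  have "matpow d (sample_mat C t w x 0) k (unitv i) j = of_real (C ^ k) * unitv i j" if "j < d" for i j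
    using that
  proof (induction k arbitrary: j)
    case (Suc k)
    have "matpow d (sample_mat C t w x 0) (Suc k) (unitv i) j
        = (\<Sum>l<d. (if j = l then of_real C else 0) * (of_real (C ^ k) * unitv i l))"
      by (simp add: matvec_def[of d _ "matpow d _ k _"] Suc.IH sample_mat_def)
    also have "\<dots> = of_real C * (of_real (C ^ k) * unitv i j)"
      using Suc.prems by (simp add: if_distrib[of "\<lambda>a. a * _"] cong: if_cong)
    finally show ?case by simp
  qed simp
  then have "moment d (sample_mat C t w x 0) (unitv i) k = C ^ k" if "i < d" for i
    using that by (simp add: moment_def dotc_unitv_right) (simp add: unitv_def)
  then show ?thesis by (simp add: power_trace_def)
qed

section \<open>Expectations over the next node\<close>

locale iid_sample = prob_space P for P :: "'w measure" +
  fixes M :: "'x measure" and X :: "nat \<Rightarrow> 'w \<Rightarrow> 'x" and n :: nat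
    and w :: "'x \<Rightarrow> nat \<Rightarrow> complex" and d :: nat and R :: real and l :: "nat \<Rightarrow> real"
  assumes indep: "indep_vars (\<lambda>_. M) X {1..n}"
    and w_meas: "i < d \<Longrightarrow> (\<lambda>x. w x i) \<in> borel_measurable M"
    and w_bound: "x \<in> space M \<Longrightarrow> (\<Sum>i<d. (cmod (w x i))\<^sup>2) \<le> R"
    and R_pos: "0 < R"
    and w_cov: "k \<in> {1..n} \<Longrightarrow> i < d \<Longrightarrow> j < d \<Longrightarrow>
      expectation (\<lambda>\<omega>. w (X k \<omega>) i * cnj (w (X k \<omega>) j)) = (if i = j then of_real (l i) else 0)"
begin

lemma X_meas: "k \<in> {1..n} \<Longrightarrow> X k \<in> measurable P M"
  using indep unfolding indep_vars_def2 by blast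

lemma X_space: "k \<in> {1..n} \<Longrightarrow> \<omega> \<in> space P \<Longrightarrow> X k \<omega> \<in> space M"
  using measurable_space[OF X_meas] .

lemma w_entry_bound: "x \<in> space M \<Longrightarrow> i < d \<Longrightarrow> cmod (w x i) \<le> sqrt R"
proof -
  assume "x \<in> space M" "i < d"
  have "(cmod (w x i))\<^sup>2 \<le> (\<Sum>i<d. (cmod (w x i))\<^sup>2)"
    by (rule member_le_sum) (use \<open>i < d\<close> in auto)
  then show ?thesis using w_bound[OF \<open>x \<in> space M\<close>] real_le_rsqrt by force
qed

lemma bdd_measurable_w:
  assumes "f \<in> measurable N M" "i < d"
  shows "bdd_measurable N (\<lambda>y. w (f y) i)"
  unfolding bdd_measurable_def
proof
  show "(\<lambda>y. w (f y) i) \<in> borel_measurable N"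
    using measurable_compose[OF assms(1) w_meas[OF assms(2)]] .
  show "\<exists>B. \<forall>x\<in>space N. cmod (w (f x) i) \<le> B"
    using w_entry_bound[OF measurable_space[OF assms(1)] assms(2)] by (intro exI[of _ "sqrt R"]) simp
qed

lemma bdd_measurable_sample_mat:
  assumes "\<And>a. a \<in> {1..k} \<Longrightarrow> (\<lambda>y. f y a) \<in> measurable N M" "i < d" "j < d"
  shows "bdd_measurable N (\<lambda>y. sample_mat C t w (f y) k i j)"
  unfolding sample_mat_def using assms
  by (auto intro!: bdd_measurable_add bdd_measurable_mult bdd_measurable_const bdd_measurable_sum
      bdd_measurable_cnj bdd_measurable_w)

abbreviation "A C t k \<omega> \<equiv> sample_mat C t w (\<lambda>a. X a \<omega>) k"

lemma bdd_measurable_A: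
  assumes "k \<le> n" "i < d" "j < d"
  shows "bdd_measurable P (\<lambda>\<omega>. A C t k \<omega> i j)"
  using assms X_meas by (intro bdd_measurable_sample_mat) auto

lemma integrable_moment_unitv:
  "k \<le> n \<Longrightarrow> integrable P (\<lambda>\<omega>. moment d (A C t k \<omega>) (unitv i) p)"
  by (intro bdd_measurable_integrable bdd_measurable_moment bdd_measurable_A bdd_measurable_const)

lemma integrable_power_trace:
  "k \<le> n \<Longrightarrow> integrable P (\<lambda>\<omega>. power_trace d (A C t k \<omega>) p)"
  by (intro bdd_measurable_integrable bdd_measurable_power_trace bdd_measurable_A)

lemma integrable_exp_trace:
  "k \<le> n \<Longrightarrow> integrable P (\<lambda>\<omega>. exp_trace d (A C t k \<omega>) p)"
  by (intro bdd_measurable_integrable bdd_measurable_exp_trace bdd_measurable_A)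

lemma integrable_exp_moment:
  "Suc k \<le> n \<Longrightarrow> integrable P (\<lambda>\<omega>. exp_moment d (A C t k \<omega>) (w (X (Suc k) \<omega>)) p)"
  using X_meas[of "Suc k"]
  by (intro bdd_measurable_integrable bdd_measurable_exp_moment bdd_measurable_A bdd_measurable_w) auto

lemma integrable_moment:
  "Suc k \<le> n \<Longrightarrow> integrable P (\<lambda>\<omega>. moment d (A C t k \<omega>) (w (X (Suc k) \<omega>)) p)"
  using X_meas[of "Suc k"]
  by (intro bdd_measurable_integrable bdd_measurable_moment bdd_measurable_A bdd_measurable_w) auto

text \<open>Independence enters here. The entry of the power depends on the nodes 1, ..., k, the
  other factor on node \<open>Suc k\<close>, so the expectation splits and the second part is an
  entry of the diagonal covariance.\<close>

lemma expectation_entry: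
  assumes k: "Suc k \<le> n" and ij: "i < d" "j < d"
  shows "integrable P (\<lambda>\<omega>. matpow d (A C t k \<omega>) p (unitv j) i * (w (X (Suc k) \<omega>) j * cnj (w (X (Suc k) \<omega>) i)))"
    and "expectation (\<lambda>\<omega>. matpow d (A C t k \<omega>) p (unitv j) i * (w (X (Suc k) \<omega>) j * cnj (w (X (Suc k) \<omega>) i)))
    = expectation (\<lambda>\<omega>. matpow d (A C t k \<omega>) p (unitv j) i) * (if i = j then of_real (l i) else 0)"
proof -
  let ?N = "\<lambda>I. PiM I (\<lambda>_::nat. M)"
  define F where "F x = matpow d (sample_mat C t w x k) p (unitv j) i" for x
  define G where "G x = w (x (Suc k)) j * cnj (w (x (Suc k)) i)" for x
  have "bdd_measurable (?N {1..k}) F"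
    unfolding F_def using ij
    by (intro bdd_measurable_matpow bdd_measurable_sample_mat bdd_measurable_const) auto
  then have F: "F \<in> borel_measurable (?N {1..k})" by (simp add: bdd_measurable_def)
  have "bdd_measurable (?N {Suc k}) G"
    unfolding G_def using ij by (intro bdd_measurable_mult bdd_measurable_cnj bdd_measurable_w) auto
  then have G: "G \<in> borel_measurable (?N {Suc k})" by (simp add: bdd_measurable_def)
  have "indep_var (?N {1..k}) (\<lambda>\<omega>. restrict (\<lambda>i. X i \<omega>) {1..k})
     (?N {Suc k}) (\<lambda>\<omega>. restrict (\<lambda>i. X i \<omega>) {Suc k})"
    by (rule indep_var_restrict[OF indep]) (use k in auto)
  from indep_var_compose[OF this F G]
  have "indep_var borel (\<lambda>\<omega>. F (restrict (\<lambda>i. X i \<omega>) {1..k})) borel (\<lambda>\<omega>. G (restrict (\<lambda>i. X i \<omega>) {Suc k}))"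
    by (simp add: o_def)
  moreover have "F (restrict (\<lambda>i. X i \<omega>) {1..k}) = F (\<lambda>i. X i \<omega>)" for \<omega>
  proof -
    have "sample_mat C t w (restrict (\<lambda>i. X i \<omega>) {1..k}) k = sample_mat C t w (\<lambda>i. X i \<omega>) k"
      by (simp add: sample_mat_def fun_eq_iff)
    then show ?thesis by (simp add: F_def)
  qed
  ultimately have ind: "indep_var borel (\<lambda>\<omega>. F (\<lambda>i. X i \<omega>)) borel (\<lambda>\<omega>. G (\<lambda>i. X i \<omega>))"
    by (simp add: G_def)
  have iF: "integrable P (\<lambda>\<omega>. F (\<lambda>i. X i \<omega>))"
    unfolding F_def using k ij
    by (intro bdd_measurable_integrable bdd_measurable_matpow bdd_measurable_A bdd_measurable_const) auto
  have iG: "integrable P (\<lambda>\<omega>. G (\<lambda>i. X i \<omega>))"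
    unfolding G_def using k ij
    by (intro bdd_measurable_integrable bdd_measurable_mult bdd_measurable_cnj bdd_measurable_w X_meas) auto
  show "integrable P (\<lambda>\<omega>. matpow d (A C t k \<omega>) p (unitv j) i * (w (X (Suc k) \<omega>) j * cnj (w (X (Suc k) \<omega>) i)))"
    using indep_var_integrable[OF ind iF iG] by (simp add: F_def G_def)
  have "expectation (\<lambda>\<omega>. F (\<lambda>i. X i \<omega>) * G (\<lambda>i. X i \<omega>))
     = expectation (\<lambda>\<omega>. F (\<lambda>i. X i \<omega>)) * expectation (\<lambda>\<omega>. G (\<lambda>i. X i \<omega>))"
    by (rule indep_var_lebesgue_integral[OF ind iF iG])
  then show "expectation (\<lambda>\<omega>. matpow d (A C t k \<omega>) p (unitv j) i * (w (X (Suc k) \<omega>) j * cnj (w (X (Suc k) \<omega>) i)))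
    = expectation (\<lambda>\<omega>. matpow d (A C t k \<omega>) p (unitv j) i) * (if i = j then of_real (l i) else 0)"
    using w_cov[of "Suc k" j i] k ij by (auto simp: F_def G_def)
qed

text \<open>Averaging over the new node replaces \<open>w w\<^sup>*\<close> by the diagonal matrix
  of the \<open>l i\<close>, so the moment becomes the trace of that matrix times a power of the old
  one.\<close>

lemma expectation_moment:
  assumes k: "Suc k \<le> n"
  shows "expectation (\<lambda>\<omega>. moment d (A C t k \<omega>) (w (X (Suc k) \<omega>)) p)
    = (\<Sum>i<d. l i * expectation (\<lambda>\<omega>. moment d (A C t k \<omega>) (unitv i) p))"
proof -
  let ?f = "\<lambda>i j \<omega>. matpow d (A C t k \<omega>) p (unitv j) i * (w (X (Suc k) \<omega>) j * cnj (w (X (Suc k) \<omega>) i))"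
  have eq: "dotc d (matpow d (A C t k \<omega>) p (w (X (Suc k) \<omega>))) (w (X (Suc k) \<omega>)) = (\<Sum>i<d. \<Sum>j<d. ?f i j \<omega>)" for \<omega>
    unfolding dotc_def
  proof (intro sum.cong refl)
    fix i assume "i \<in> {..<d}"
    then have i: "i < d" by simp
    show "matpow d (A C t k \<omega>) p (w (X (Suc k) \<omega>)) i * cnj (w (X (Suc k) \<omega>) i) = (\<Sum>j<d. ?f i j \<omega>)"
      by (subst matpow_expand[OF i]) (simp add: sum_distrib_left ac_simps)
  qed
  have int: "integrable P (\<lambda>\<omega>. \<Sum>i<d. \<Sum>j<d. ?f i j \<omega>)"
    by (intro Bochner_Integration.integrable_sum expectation_entry(1)[OF k]) auto
  have "expectation (\<lambda>\<omega>. moment d (A C t k \<omega>) (w (X (Suc k) \<omega>)) p)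
      = Re (expectation (\<lambda>\<omega>. \<Sum>i<d. \<Sum>j<d. ?f i j \<omega>))"
    unfolding moment_def eq by (rule integral_Re[OF int])
  also have "expectation (\<lambda>\<omega>. \<Sum>i<d. \<Sum>j<d. ?f i j \<omega>) = (\<Sum>i<d. \<Sum>j<d. expectation (?f i j))"
    using expectation_entry(1)[OF k]
    by (subst Bochner_Integration.integral_sum)
       (auto intro!: sum.cong Bochner_Integration.integral_sum Bochner_Integration.integrable_sum)
  also have "\<dots> = (\<Sum>i<d. expectation (\<lambda>\<omega>. matpow d (A C t k \<omega>) p (unitv i) i) * of_real (l i))"
    by (intro sum.cong refl)
       (simp add: expectation_entry(2)[OF k] if_distrib[of "\<lambda>a. _ * a"] sum.delta' cong: if_cong)
  also have "Re \<dots> = (\<Sum>i<d. l i * Re (expectation (\<lambda>\<omega>. matpow d (A C t k \<omega>) p (unitv i) i)))"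
    by (simp add: mult.commute)
  also have "\<dots> = (\<Sum>i<d. l i * expectation (\<lambda>\<omega>. moment d (A C t k \<omega>) (unitv i) p))"
  proof (intro sum.cong refl arg_cong2[of _ _ _ _ "(*)"])
    fix i assume i: "i \<in> {..<d}"
    have "integrable P (\<lambda>\<omega>. matpow d (A C t k \<omega>) p (unitv i) i)"
      using k i by (intro bdd_measurable_integrable bdd_measurable_matpow bdd_measurable_A bdd_measurable_const) auto
    then show "Re (expectation (\<lambda>\<omega>. matpow d (A C t k \<omega>) p (unitv i) i)) = expectation (\<lambda>\<omega>. moment d (A C t k \<omega>) (unitv i) p)"
      using i by (simp add: moment_def dotc_unitv_right)
  qed
  finally show ?thesis .
qed


text \<open>The step width \<open>ln 2 / R\<close> makes the exponential factors equal to \<open>2\<close> and \<open>1/2\<close>.\<close>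

abbreviation "\<theta> \<equiv> ln 2 / R"

lemma \<theta>_pos: "0 < \<theta>"
  using R_pos by simp

lemma expectation_exp_moment:
  assumes "Suc k \<le> n"
  shows "expectation (\<lambda>\<omega>. exp_moment d (A C t k \<omega>) (w (X (Suc k) \<omega>)) N)
    = (\<Sum>p<N. (\<Sum>i<d. l i * expectation (\<lambda>\<omega>. moment d (A C t k \<omega>) (unitv i) p)) / fact p)"
  unfolding exp_moment_def using assms
  by (simp add: integrable_moment expectation_moment)

lemma expectation_power_trace:
  assumes "k \<le> n"
  shows "expectation (\<lambda>\<omega>. power_trace d (A C t k \<omega>) p) = (\<Sum>i<d. expectation (\<lambda>\<omega>. moment d (A C t k \<omega>) (unitv i) p))"
  unfolding power_trace_def using assms by (simp add: integrable_moment_unitv)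

lemma expectation_exp_trace:
  assumes "k \<le> n"
  shows "expectation (\<lambda>\<omega>. exp_trace d (A C t k \<omega>) N)
     = (\<Sum>p\<le>N. expectation (\<lambda>\<omega>. power_trace d (A C t k \<omega>) p) / fact p)"
  unfolding exp_trace_def using assms by (simp add: integrable_power_trace)

lemma scaled_w_bound:
  assumes "x \<in> space M"
  shows "(\<Sum>i<d. (cmod (of_real (sqrt \<theta>) * w x i))\<^sup>2) \<le> ln 2"
proof -
  have "(\<Sum>i<d. (cmod (of_real (sqrt \<theta>) * w x i))\<^sup>2) = \<theta> * (\<Sum>i<d. (cmod (w x i))\<^sup>2)"
    using \<theta>_pos R_pos by (simp add: norm_mult power_mult_distrib sum_distrib_left)
  also have "\<dots> \<le> \<theta> * R" using w_bound[OF assms] \<theta>_pos by (intro mult_left_mono) auto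
  finally show ?thesis using R_pos by simp
qed

text \<open>The event for all degrees lies in the event for each single degree. Markov's inequality
  there has the threshold \<open>c N\<close>, and the bound \<open>b\<close>, being the same for all
  degrees, survives the limit \<open>c'\<close>.\<close>

lemma markov_event:
  assumes g: "\<And>N. integrable P (g N)" and nn: "\<And>N \<omega>. \<omega> \<in> space P \<Longrightarrow> 0 \<le> g N \<omega>"
    and c: "c \<longlonglongrightarrow> c'" "0 < c'" and b: "\<And>N. expectation (g N) \<le> b"
  shows "{\<omega> \<in> space P. \<forall>N. c N \<le> g N \<omega>} \<in> events"
    and "prob {\<omega> \<in> space P. \<forall>N. c N \<le> g N \<omega>} \<le> b / c'"
proof -
  have [measurable]: "g N \<in> borel_measurable P" for N using g by blast
  show E: "{\<omega> \<in> space P. \<forall>N. c N \<le> g N \<omega>} \<in> events" by measurable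
  have "c N * prob {\<omega> \<in> space P. \<forall>N. c N \<le> g N \<omega>} \<le> b" if "0 < c N" for N
  proof -
    have "prob {\<omega> \<in> space P. \<forall>N. c N \<le> g N \<omega>} \<le> prob {\<omega> \<in> space P. c N \<le> g N \<omega>}"
      by (intro finite_measure_mono) auto
    also have "\<dots> \<le> expectation (g N) / c N"
      using that nn by (intro integral_Markov_inequality_measure[where A = "{}"] g) auto
    also have "\<dots> \<le> b / c N" using b that by (simp add: divide_right_mono)
    finally show ?thesis using that by (simp add: field_simps)
  qed
  moreover have "eventually (\<lambda>N. 0 < c N) sequentially"
    using c by (simp add: order_tendstoD(1))
  ultimately have "eventually (\<lambda>N. c N * prob {\<omega> \<in> space P. \<forall>N. c N \<le> g N \<omega>} \<le> b) sequentially"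
    by (auto elim: eventually_mono)
  then have "c' * prob {\<omega> \<in> space P. \<forall>N. c N \<le> g N \<omega>} \<le> b"
    by (intro tendsto_upperbound[OF tendsto_mult_right[OF c(1)]]) auto
  then show "prob {\<omega> \<in> space P. \<forall>N. c N \<le> g N \<omega>} \<le> b / c'"
    using c(2) by (simp add: field_simps)
qed

text \<open>The constant term of the exponential moment has as expectation the trace of the
  covariance, at most \<open>T\<close> whatever \<open>d\<close> is. The higher terms are at most
  \<mu> times power traces that already occur in \<open>a k\<close>. The result is an affine
  recursion free of the dimension.\<close>

lemma upper_step:
  fixes N :: nat
  assumes k: "Suc k \<le> n" and l: "\<And>i. i < d \<Longrightarrow> 0 \<le> l i \<and> l i \<le> \<mu>" "(\<Sum>i<d. l i) \<le> T" and \<mu>: "0 < \<mu>"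
  defines "a \<equiv> \<lambda>k. expectation (\<lambda>\<omega>. exp_trace d (A 0 \<theta> k \<omega>) N) - real d"
  shows "a (Suc k) \<le> (1 + \<mu> / R) * a k + T / R"
proof -
  have psd: "psd_mat d (A 0 \<theta> k \<omega>)" for k \<omega> using \<theta>_pos by (intro psd_sample_mat_pos) auto
  have mn: "0 \<le> expectation (\<lambda>\<omega>. moment d (A 0 \<theta> k \<omega>) v p)" for v p
    using moment_nonneg[OF psd] by (intro integral_nonneg_AE) auto
  have step: "exp_trace d (A 0 \<theta> (Suc k) \<omega>) N
      \<le> exp_trace d (A 0 \<theta> k \<omega>) N + (1 / R) * exp_moment d (A 0 \<theta> k \<omega>) (w (X (Suc k) \<omega>)) N"
    if "\<omega> \<in> space P" for \<omega>
  proof -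
    have "exp_trace d (A 0 \<theta> (Suc k) \<omega>) N \<le> exp_trace d (A 0 \<theta> k \<omega>) N
       + (exp (ln 2) - 1) / ln 2 * exp_moment d (A 0 \<theta> k \<omega>) (\<lambda>i. of_real (sqrt \<theta>) * w (X (Suc k) \<omega>) i) N"
      using exp_trace_rank1_upper[OF psd scaled_w_bound] X_space[of "Suc k" \<omega>] that k
        sample_mat_Suc[of \<theta> 1 0 w "\<lambda>a. X a \<omega>" k] \<theta>_pos by simp
    \<comment> \<open>The factor is (2 - 1) / ln 2 from the Gronwall estimate times \<theta> from
      the rescaled vector, that is 1 / R.\<close>
    then show ?thesis using \<theta>_pos by (simp add: exp_moment_scale)
  qed
  have "expectation (\<lambda>\<omega>. exp_trace d (A 0 \<theta> (Suc k) \<omega>) N)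
     \<le> expectation (\<lambda>\<omega>. exp_trace d (A 0 \<theta> k \<omega>) N + (1 / R) * exp_moment d (A 0 \<theta> k \<omega>) (w (X (Suc k) \<omega>)) N)"
    using k step integrable_exp_trace integrable_exp_moment
    by (intro integral_mono) auto
  also have "\<dots> = expectation (\<lambda>\<omega>. exp_trace d (A 0 \<theta> k \<omega>) N)
      + (1 / R) * expectation (\<lambda>\<omega>. exp_moment d (A 0 \<theta> k \<omega>) (w (X (Suc k) \<omega>)) N)"
    using k integrable_exp_trace integrable_exp_moment by simp
  finally have 1: "a (Suc k) \<le> a k + (1 / R) * expectation (\<lambda>\<omega>. exp_moment d (A 0 \<theta> k \<omega>) (w (X (Suc k) \<omega>)) N)"
    by (simp add: a_def)
  have ak: "a k = (\<Sum>p\<in>{1..N}. expectation (\<lambda>\<omega>. power_trace d (A 0 \<theta> k \<omega>) p) / fact p)"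
  proof -
    have "{..N} - {0} = {1..N}" by auto
    then show ?thesis unfolding a_def using k
      by (simp add: expectation_exp_trace sum.remove[of "{..N}" 0] power_trace_0 prob_space)
  qed
  have pn: "0 \<le> expectation (\<lambda>\<omega>. power_trace d (A 0 \<theta> k \<omega>) p)" for p
    using power_trace_nonneg[OF psd] by (intro integral_nonneg_AE) auto
  have T0: "0 \<le> T" using l sum_nonneg[of "{..<d}" l] by force
  have "expectation (\<lambda>\<omega>. exp_moment d (A 0 \<theta> k \<omega>) (w (X (Suc k) \<omega>)) N)
     \<le> T + \<mu> * (\<Sum>p\<in>{1..<N}. expectation (\<lambda>\<omega>. power_trace d (A 0 \<theta> k \<omega>) p) / fact p)"
  proof (cases "N = 0")
    case True
    then show ?thesis using T0 by (simp add: exp_moment_def)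
  next
    case False
    have "(\<Sum>i<d. l i * expectation (\<lambda>\<omega>. moment d (A 0 \<theta> k \<omega>) (unitv i) p)) \<le>
        \<mu> * expectation (\<lambda>\<omega>. power_trace d (A 0 \<theta> k \<omega>) p)" for p
      unfolding expectation_power_trace[OF Suc_leD[OF k]] sum_distrib_left
      using l mn by (intro sum_mono mult_right_mono) auto
    then have "(\<Sum>p\<in>{1..<N}. (\<Sum>i<d. l i * expectation (\<lambda>\<omega>. moment d (A 0 \<theta> k \<omega>) (unitv i) p)) / fact p)
       \<le> (\<Sum>p\<in>{1..<N}. \<mu> * expectation (\<lambda>\<omega>. power_trace d (A 0 \<theta> k \<omega>) p) / fact p)"
      by (intro sum_mono divide_right_mono) auto
    moreover have "(\<Sum>i<d. l i * expectation (\<lambda>\<omega>. moment d (A 0 \<theta> k \<omega>) (unitv i) 0)) = (\<Sum>i<d. l i)"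
    proof (intro sum.cong refl)
      fix i assume "i \<in> {..<d}"
      then have "moment d B (unitv i) 0 = 1" for B
        by (simp add: moment_def dotc_unitv_right) (simp add: unitv_def)
      then show "l i * expectation (\<lambda>\<omega>. moment d (A 0 \<theta> k \<omega>) (unitv i) 0) = l i"
        by (simp add: prob_space)
    qed
    moreover have "{..<N} - {0} = {1..<N}" by auto
    ultimately show ?thesis
      unfolding expectation_exp_moment[OF k] using l(2) False
      by (simp add: sum.remove[of "{..<N}" 0] sum_distrib_left)
  qed
  \<comment> \<open>The exponential moment stops below degree \<open>N\<close>; the missing trace
    term of degree \<open>N\<close> is nonnegative.\<close>
  also have "\<dots> \<le> T + \<mu> * a k"
    unfolding ak using pn \<mu> by (intro add_left_mono mult_left_mono sum_mono2) auto
  finally have "(1 / R) * expectation (\<lambda>\<omega>. exp_moment d (A 0 \<theta> k \<omega>) (w (X (Suc k) \<omega>)) N) \<le> (1 / R) * (T + \<mu> * a k)"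
    using R_pos by (intro mult_left_mono) auto
  with 1 show ?thesis by (simp add: field_simps add_divide_distrib)
qed

text \<open>The prefactor \<open>T / \<mu>\<close> stands where a matrix Chernoff bound usually has
  the dimension, which later allows \<open>d\<close> to grow without loss.\<close>

lemma upper_tail:
  assumes l: "\<And>i. i < d \<Longrightarrow> 0 \<le> l i \<and> l i \<le> \<mu>" "(\<Sum>i<d. l i) \<le> T" and \<mu>: "0 < \<mu>" and n: "0 < n"
  shows "\<exists>E\<in>events. prob E \<le> T / \<mu> * exp (- (real n * \<mu> / R) * (2 * ln 2 - 1)) \<and>
     (\<forall>\<omega>\<in>space P - E. \<forall>z. (\<Sum>k=1..n. (cmod (dotc d z (w (X k \<omega>))))\<^sup>2) \<le> 2 * real n * \<mu> * (\<Sum>i<d. (cmod (z i))\<^sup>2))"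
proof -
  define q where "q = \<mu> / R"
  have q: "0 < q" using \<mu> R_pos by (simp add: q_def)
  have T0: "0 \<le> T" using l sum_nonneg[of "{..<d}" l] by force
  define a where "a N k = expectation (\<lambda>\<omega>. exp_trace d (A 0 \<theta> k \<omega>) N) - real d" for N k
  \<comment> \<open>Solution of the affine recursion with start 0: the sample matrix without samples
    is zero, and its truncated trace exponential is \<open>d\<close>.\<close>
  have rec: "a N k \<le> T / \<mu> * ((1 + q) ^ k - 1)" if "k \<le> n" for N k
    using that
  proof (induction k)
    case 0
    have "exp_trace d (A 0 \<theta> 0 \<omega>) N = real d" for \<omega>
    proof -
      have "{..N} = insert 0 {1..N}" by auto
      then show ?thesis unfolding exp_trace_def power_trace_scalar by simp
    qed
    then show ?case by (simp add: a_def prob_space)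
  next
    case (Suc k)
    have "a N (Suc k) \<le> (1 + q) * a N k + T / R"
      using upper_step[OF Suc.prems l \<mu>] by (simp add: a_def q_def)
    also have "\<dots> \<le> (1 + q) * (T / \<mu> * ((1 + q) ^ k - 1)) + T / R"
      using Suc q by (intro add_right_mono mult_left_mono) auto
    also have "T / R = T / \<mu> * q" using \<mu> by (simp add: q_def)
    also have "(1 + q) * (B * ((1 + q) ^ k - 1)) + B * q = B * ((1 + q) ^ Suc k - 1)" for B
      by (simp add: algebra_simps)
    finally show ?case .
  qed
  have an: "a N n \<le> T / \<mu> * (exp (real n * q) - 1)" for N
  proof -
    have "(1 + q) ^ n \<le> exp q ^ n" using q by (intro power_mono exp_ge_add_one_self) auto
    also have "\<dots> = exp (real n * q)" by (simp add: exp_of_nat_mult)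
    finally have "T / \<mu> * ((1 + q) ^ n - 1) \<le> T / \<mu> * (exp (real n * q) - 1)"
      using T0 \<mu> by (intro mult_left_mono) auto
    with rec[of n N] show ?thesis by simp
  qed
  \<comment> \<open>This is \<theta> times the threshold 2 n \<mu> for the sum over the
    nodes.\<close>
  define c where "c = 2 * ln 2 * (real n * q)"
  have c: "0 < c" using q n by (simp add: c_def)
  have psd: "psd_mat d (A 0 \<theta> k \<omega>)" for k \<omega> using \<theta>_pos by (intro psd_sample_mat_pos) auto
  define g where "g N \<omega> = exp_trace d (A 0 \<theta> n \<omega>) N - real d" for N \<omega>
  define E where "E = {\<omega> \<in> space P. \<forall>N. (\<Sum>k\<le>N. c ^ k / fact k) - 1 \<le> g N \<omega>}"
  have g_int: "integrable P (g N)" for N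
    unfolding g_def using integrable_exp_trace by auto
  have g_nn: "0 \<le> g N \<omega>" for N \<omega>
  proof -
    have "{..N} - {0} = {1..N}" by auto
    then show ?thesis unfolding g_def exp_trace_def
      by (simp add: sum.remove[of "{..N}" 0] power_trace_0 sum_nonneg power_trace_nonneg[OF psd])
  qed
  have lim: "(\<lambda>N. (\<Sum>k\<le>N. c ^ k / fact k) - 1) \<longlonglongrightarrow> exp c - 1"
    by (intro tendsto_diff sum_exp_tendsto tendsto_const)
  have Eg: "expectation (g N) \<le> T / \<mu> * (exp (real n * q) - 1)" for N
    using an[of N] integrable_exp_trace[OF order_refl] by (simp add: g_def[abs_def] a_def prob_space)
  have E: "E \<in> events" "prob E \<le> T / \<mu> * (exp (real n * q) - 1) / (exp c - 1)"
    unfolding E_def using markov_event[OF g_int g_nn lim _ Eg] c by auto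
  \<comment> \<open>(x - 1) / (y - 1) <= x / y holds for 1 < y and x <= y; the latter is 1 <= 2 ln 2
    in the exponents.\<close>
  have "(exp (real n * q) - 1) / (exp c - 1) \<le> exp (real n * q) / exp c"
  proof -
    have "ln 2 \<ge> (1/2::real)" using ln2_ge_two_thirds by simp
    then have "real n * q * 1 \<le> real n * q * (2 * ln 2)" using q by (intro mult_left_mono) auto
    then have "exp (real n * q) \<le> exp c" by (simp add: c_def mult.commute)
    then show ?thesis using c by (simp add: field_simps)
  qed
  also have "\<dots> = exp (- (real n * \<mu> / R) * (2 * ln 2 - 1))"
    by (simp add: c_def q_def exp_diff[symmetric] algebra_simps)
  finally have "T / \<mu> * ((exp (real n * q) - 1) / (exp c - 1)) \<le> T / \<mu> * exp (- (real n * \<mu> / R) * (2 * ln 2 - 1))"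
    using T0 \<mu> by (intro mult_left_mono) auto
  with E(2) have PE: "prob E \<le> T / \<mu> * exp (- (real n * \<mu> / R) * (2 * ln 2 - 1))" by simp
  have "(\<Sum>k=1..n. (cmod (dotc d z (w (X k \<omega>))))\<^sup>2) \<le> 2 * real n * \<mu> * (\<Sum>i<d. (cmod (z i))\<^sup>2)"
    if \<omega>: "\<omega> \<in> space P - E" for \<omega> z
  proof (rule ccontr)
    assume *: "\<not> ?thesis"
    let ?s = "\<Sum>i<d. (cmod (z i))\<^sup>2"
    have "?s \<noteq> 0"
    proof
      assume "?s = 0"
      then have "(cmod (dotc d z v))\<^sup>2 \<le> 0" for v using dotc_cauchy_schwarz[of d z v] by simp
      then show False using * \<open>?s = 0\<close> by simp
    qed
    moreover have "0 \<le> ?s" by (simp add: sum_nonneg)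
    ultimately have s: "0 < ?s" by simp
    obtain y where y1: "(\<Sum>i<d. (cmod (y i))\<^sup>2) = 1" and dy: "\<And>v. (cmod (dotc d y v))\<^sup>2 = (cmod (dotc d z v))\<^sup>2 / ?s"
      using unit_rescale[OF \<open>?s \<noteq> 0\<close>] by auto
    have "2 * real n * \<mu> \<le> (\<Sum>k=1..n. (cmod (dotc d y (w (X k \<omega>))))\<^sup>2)"
      using * s unfolding dy by (simp add: field_simps flip: sum_divide_distrib)
    then have "\<theta> * (2 * real n * \<mu>) \<le> \<theta> * (\<Sum>k=1..n. (cmod (dotc d y (w (X k \<omega>))))\<^sup>2)"
      using \<theta>_pos by (intro mult_left_mono) auto
    moreover have "c = \<theta> * (2 * real n * \<mu>)" by (simp add: c_def q_def)
    ultimately have "c \<le> Re (dotc d (matvec d (A 0 \<theta> n \<omega>) y) y)"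
      by (simp add: dotc_sample_mat)
    then have "\<forall>N. (\<Sum>k\<le>N. c ^ k / fact k) - 1 \<le> g N \<omega>"
      using exp_trace_minus_dim_ge[OF psd y1, of c] c unfolding g_def by auto
    with \<omega> show False by (auto simp: E_def)
  qed
  with E(1) PE show ?thesis by blast
qed

text \<open>With identity covariance each new sample lowers the expected trace exponential by the
  factor 1 - 1/(2 R) once the degree is infinite. The dimension remains as prefactor, which is
  affordable because the matrix to be inverted has the fixed size m - 1.\<close>

lemma lower_tail:
  assumes l: "\<And>i. i < d \<Longrightarrow> l i = 1" and R: "1 \<le> R" and n: "0 < n"
  shows "\<exists>E\<in>events. prob E \<le> real d * exp (- (real n / R) * (1 - ln 2) / 2) \<and>
     (\<forall>\<omega>\<in>space P - E. \<forall>z. real n / 2 * (\<Sum>i<d. (cmod (z i))\<^sup>2) \<le> (\<Sum>k=1..n. (cmod (dotc d z (w (X k \<omega>))))\<^sup>2))"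
proof -
  \<comment> \<open>Each of the \<open>n\<close> updates subtracts a matrix of norm at most \<theta>
    R = ln 2, so this shift keeps all sample matrices positive semidefinite.\<close>
  define C where "C = real n * ln 2"
  have C0: "0 \<le> C" by (simp add: C_def)
  define a where "a k N = expectation (\<lambda>\<omega>. exp_trace d (A C (-\<theta>) k \<omega>) N)" for k N
  have psd: "psd_mat d (A C (-\<theta>) k \<omega>)" if "k \<le> n" "\<omega> \<in> space P" for k \<omega>
  proof (rule psd_sample_mat_neg[where R = R])
    show "\<theta> * real k * R \<le> C" using that(1) R_pos by (simp add: C_def)
  qed (use that X_space w_bound \<theta>_pos in auto)
  have step: "a (Suc k) (Suc N) \<le> a k (Suc N) - 1 / (2 * R) * a k N" if k: "Suc k \<le> n" for k N
  proof -
    have pw: "exp_trace d (A C (-\<theta>) (Suc k) \<omega>) (Suc N) \<le> exp_trace d (A C (-\<theta>) k \<omega>) (Suc N)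
       - 1 / (2 * R) * exp_moment d (A C (-\<theta>) k \<omega>) (w (X (Suc k) \<omega>)) (Suc N)" if \<omega>: "\<omega> \<in> space P" for \<omega>
    proof -
      have eq: "A C (-\<theta>) (Suc k) \<omega> = rank1_update (A C (-\<theta>) k \<omega>) (\<lambda>i. of_real (sqrt \<theta>) * w (X (Suc k) \<omega>) i) (-1)"
        using sample_mat_Suc[of \<theta> "-1" C w "\<lambda>a. X a \<omega>" k] \<theta>_pos by simp
      have "exp_trace d (A C (-\<theta>) (Suc k) \<omega>) (Suc N) \<le> exp_trace d (A C (-\<theta>) k \<omega>) (Suc N)
         - (1 - exp (- ln 2)) / ln 2 * exp_moment d (A C (-\<theta>) k \<omega>) (\<lambda>i. of_real (sqrt \<theta>) * w (X (Suc k) \<omega>) i) (Suc N)"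
        unfolding eq
        by (rule exp_trace_rank1_lower[OF psd[OF k \<omega>, unfolded eq] scaled_w_bound])
           (use X_space[OF _ \<omega>, of "Suc k"] k in auto)
      then show ?thesis using \<theta>_pos by (simp add: exp_moment_scale exp_minus)
    qed
    have "a (Suc k) (Suc N) \<le> expectation (\<lambda>\<omega>. exp_trace d (A C (-\<theta>) k \<omega>) (Suc N)
       - 1 / (2 * R) * exp_moment d (A C (-\<theta>) k \<omega>) (w (X (Suc k) \<omega>)) (Suc N))"
      unfolding a_def using k pw integrable_exp_trace integrable_exp_moment
      by (intro integral_mono) auto
    also have "\<dots> = a k (Suc N) - 1 / (2 * R) * expectation (\<lambda>\<omega>. exp_moment d (A C (-\<theta>) k \<omega>) (w (X (Suc k) \<omega>)) (Suc N))"
      unfolding a_def using k integrable_exp_trace integrable_exp_moment by simp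
    \<comment> \<open>With all \<open>l i = 1\<close> the expected moments are full traces, and the
      range below \<open>Suc N\<close> is that of \<open>exp_trace\<close> of degree
      \<open>N\<close>.\<close>
    also have "expectation (\<lambda>\<omega>. exp_moment d (A C (-\<theta>) k \<omega>) (w (X (Suc k) \<omega>)) (Suc N)) = a k N"
      unfolding a_def using k l
      by (simp add: expectation_exp_moment expectation_exp_trace expectation_power_trace lessThan_Suc_atMost)
    finally show ?thesis .
  qed
  have mono: "a k N \<le> a k N'" if "k \<le> n" "N \<le> N'" for k N N'
    unfolding a_def using that exp_trace_mono[OF psd] integrable_exp_trace by (intro integral_mono) auto
  have nonneg: "0 \<le> a k N" if "k \<le> n" for k N
    unfolding a_def exp_trace_def using that power_trace_nonneg[OF psd]
    by (intro integral_nonneg_AE AE_I2 sum_nonneg divide_nonneg_nonneg) auto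
  have a0: "a 0 N \<le> real d * exp C" for N
  proof -
    have "a 0 N = real d * (\<Sum>p\<le>N. C ^ p / fact p)"
      unfolding a_def exp_trace_def power_trace_scalar by (simp add: prob_space sum_distrib_left)
    also have "\<dots> \<le> real d * exp C" using sum_exp_le[OF C0] by (intro mult_left_mono) auto
    finally show ?thesis .
  qed
  have bd: "a k N \<le> real d * exp C" if "k \<le> n" for k N
    using that
  proof (induction k arbitrary: N)
    case (Suc k)
    have "a (Suc k) N \<le> a (Suc k) (Suc N)" using mono Suc.prems by simp
    also have "\<dots> \<le> a k (Suc N)"
    proof -
      have "0 \<le> 1 / (2 * R) * a k N" using nonneg[of k N] R_pos Suc.prems by simp
      then show ?thesis using step[OF Suc.prems, of N] by linarith
    qed
    also have "\<dots> \<le> real d * exp C" using Suc by simp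
    finally show ?case .
  qed (use a0 in simp)
  \<comment> \<open>Each step relates degree \<open>Suc N\<close> to degree \<open>N\<close>, so the
    recursion does not close for a fixed degree. In the limit over the degrees both sides become the
    same quantity.\<close>
  define L where "L k = (SUP N. a k N)" for k
  have L: "a k \<longlonglongrightarrow> L k" if "k \<le> n" for k
    unfolding L_def using that bd mono
    by (intro LIMSEQ_incseq_SUP) (auto simp: incseq_def intro!: bdd_aboveI)
  have L0: "0 \<le> L k" if "k \<le> n" for k
    using LIMSEQ_le_const[OF L[OF that], of 0] nonneg[OF that] by blast
  have Lstep: "L (Suc k) \<le> exp (- 1 / (2 * R)) * L k" if k: "Suc k \<le> n" for k
  proof -
    have kn: "k \<le> n" using k by simp
    have "(\<lambda>N. a k (Suc N) - 1 / (2 * R) * a k N) \<longlonglongrightarrow> L k - 1 / (2 * R) * L k"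
      by (intro tendsto_diff tendsto_mult_left LIMSEQ_Suc L kn)
    then have "L (Suc k) \<le> L k - 1 / (2 * R) * L k"
      using LIMSEQ_le[OF LIMSEQ_Suc[OF L[OF k]]] step[OF k] by blast
    also have "\<dots> = (1 + (- 1 / (2 * R))) * L k" by (simp add: algebra_simps)
    also have "\<dots> \<le> exp (- 1 / (2 * R)) * L k"
      by (intro mult_right_mono exp_ge_add_one_self L0 kn)
    finally show ?thesis .
  qed
  have Ln: "L k \<le> exp (- 1 / (2 * R)) ^ k * (real d * exp C)" if "k \<le> n" for k
    using that
  proof (induction k)
    case 0
    then show ?case using LIMSEQ_le_const2[OF L[of 0]] a0 by auto
  next
    case (Suc k)
    have "L (Suc k) \<le> exp (- 1 / (2 * R)) * L k" using Lstep Suc.prems by simp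
    also have "\<dots> \<le> exp (- 1 / (2 * R)) * (exp (- 1 / (2 * R)) ^ k * (real d * exp C))"
      using Suc by (intro mult_left_mono) auto
    finally show ?case by (simp add: mult.assoc)
  qed
  have an: "a n N \<le> real d * exp (C - real n / (2 * R))" for N
  proof -
    have "a n N \<le> L n" using incseq_le[OF _ L] mono by (auto simp: incseq_def)
    also have "\<dots> \<le> exp (- 1 / (2 * R)) ^ n * (real d * exp C)" using Ln by simp
    also have "\<dots> = real d * exp (C - real n / (2 * R))"
      by (simp add: exp_of_nat_mult[symmetric] exp_add[symmetric])
    finally show ?thesis .
  qed
  \<comment> \<open>A lower bound for the shifted form at a unit vector where the sum over the nodes
    is at most n/2. It is nonnegative because of \<open>1 \<le> R\<close>.\<close>
  define c where "c = C - \<theta> * (real n / 2)"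
  have "\<theta> * (real n / 2) \<le> C"
  proof -
    have "\<theta> \<le> ln 2" using R by (simp add: divide_le_eq)
    then have "\<theta> * (real n / 2) \<le> ln 2 * real n" by (intro mult_mono) auto
    then show ?thesis by (simp add: C_def mult.commute)
  qed
  then have c0: "0 \<le> c" by (simp add: c_def)
  define E where "E = {\<omega> \<in> space P. \<forall>N. (\<Sum>k\<le>N. c ^ k / fact k) \<le> exp_trace d (A C (-\<theta>) n \<omega>) N}"
  have nn: "0 \<le> exp_trace d (A C (-\<theta>) n \<omega>) N" if "\<omega> \<in> space P" for \<omega> N
    unfolding exp_trace_def using power_trace_nonneg[OF psd[OF order_refl that]]
    by (intro sum_nonneg divide_nonneg_nonneg) auto
  have E: "E \<in> events" "prob E \<le> real d * exp (C - real n / (2 * R)) / exp c"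
    unfolding E_def
    using markov_event[of "\<lambda>N \<omega>. exp_trace d (A C (-\<theta>) n \<omega>) N", OF integrable_exp_trace nn sum_exp_tendsto[of c]] an
    by (auto simp: a_def)
  have "real d * exp (C - real n / (2 * R)) / exp c = real d * exp (- (real n / R) * (1 - ln 2) / 2)"
  proof -
    have "C - real n / (2 * R) - c = - (real n / R) * (1 - ln 2) / 2"
      by (simp add: c_def divide_simps algebra_simps)
    then show ?thesis by (metis exp_diff times_divide_eq_right)
  qed
  with E(2) have PE: "prob E \<le> real d * exp (- (real n / R) * (1 - ln 2) / 2)" by simp
  have "real n / 2 * (\<Sum>i<d. (cmod (z i))\<^sup>2) \<le> (\<Sum>k=1..n. (cmod (dotc d z (w (X k \<omega>))))\<^sup>2)"
    if \<omega>: "\<omega> \<in> space P - E" for \<omega> z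
  proof (rule ccontr)
    assume *: "\<not> ?thesis"
    let ?s = "\<Sum>i<d. (cmod (z i))\<^sup>2"
    have "?s \<noteq> 0"
    proof
      assume "?s = 0"
      then show False using * by (simp add: sum_nonneg)
    qed
    moreover have "0 \<le> ?s" by (simp add: sum_nonneg)
    ultimately have s: "0 < ?s" by simp
    obtain y where y1: "(\<Sum>i<d. (cmod (y i))\<^sup>2) = 1" and dy: "\<And>v. (cmod (dotc d y v))\<^sup>2 = (cmod (dotc d z v))\<^sup>2 / ?s"
      using unit_rescale[OF \<open>?s \<noteq> 0\<close>] by auto
    have "(\<Sum>k=1..n. (cmod (dotc d y (w (X k \<omega>))))\<^sup>2) \<le> real n / 2"
      using * s unfolding dy by (simp add: field_simps flip: sum_divide_distrib)
    then have "\<theta> * (\<Sum>k=1..n. (cmod (dotc d y (w (X k \<omega>))))\<^sup>2) \<le> \<theta> * (real n / 2)"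
      using \<theta>_pos by (intro mult_left_mono) auto
    then have "c \<le> Re (dotc d (matvec d (A C (-\<theta>) n \<omega>) y) y)"
      by (simp add: dotc_sample_mat c_def y1)
    then have "\<forall>N. (\<Sum>k\<le>N. c ^ k / fact k) \<le> exp_trace d (A C (-\<theta>) n \<omega>) N"
      using exp_trace_ge[OF psd[OF order_refl] y1 c0] \<omega> by auto
    with \<omega> show False by (auto simp: E_def)
  qed
  with E(1) PE show ?thesis by blast
qed

end

section \<open>Hilbert spaces of functions with finite trace\<close>

locale hilbert_fun =
  fixes H :: "('x \<Rightarrow> complex) set" and ip :: "('x \<Rightarrow> complex) \<Rightarrow> ('x \<Rightarrow> complex) \<Rightarrow> complex"
  assumes hilbert: "hilbert_on H ip"
begin

lemma inner_product: "inner_product_on H ip"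
  using hilbert by (simp add: hilbert_on_def)

lemma zero_mem: "(\<lambda>x. 0) \<in> H"
  using inner_product unfolding inner_product_on_def by blast

lemma ip_pos: "f \<in> H \<Longrightarrow> f \<noteq> (\<lambda>x. 0) \<Longrightarrow> 0 < Re (ip f f)"
  using inner_product unfolding inner_product_on_def by blast

sublocale psd_form H ip
proof
  show "0 \<le> Re (ip f f)" if "f \<in> H" for f
  proof (cases "f = (\<lambda>x. 0)")
    case True
    have "\<forall>f\<in>H. \<forall>h\<in>H. \<forall>c. ip (\<lambda>x. c * f x) h = c * ip f h"
      using inner_product unfolding inner_product_on_def by blast
    from this[rule_format, OF zero_mem zero_mem, of 0] show ?thesis using True by simp
  qed (use ip_pos that less_imp_le in blast)
qed (use inner_product in \<open>unfold inner_product_on_def, blast+\<close>)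

lemma hnorm_eq: "hnorm ip f = sn f"
  by (simp add: hnorm_def sn_def)

lemma eq_zero_iff: "f \<in> H \<Longrightarrow> Re (ip f f) = 0 \<longleftrightarrow> f = (\<lambda>x. 0)"
  by (metis ip_pos less_irrefl zero_left zero_mem zero_complex.simps(1))

lemma sn_eq_zero_iff: "f \<in> H \<Longrightarrow> sn f = 0 \<longleftrightarrow> f = (\<lambda>x. 0)"
  using eq_zero_iff[of f] by (simp add: sn_def)

sublocale Metric: Metric_space H "hdist H ip"
proof
  show "0 \<le> hdist H ip f g" for f g by (simp add: hdist_def hnorm_eq sn_nonneg diff_closed)
  show "hdist H ip f g = hdist H ip g f" for f g using sn_minus_commute[of f g] by (auto simp: hdist_def hnorm_eq)
  show "hdist H ip f g = 0 \<longleftrightarrow> f = g" if "f \<in> H" "g \<in> H" for f g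
    using that sn_eq_zero_iff[OF diff_closed[OF that]] by (auto simp: hdist_def hnorm_eq fun_eq_iff)
  show "hdist H ip f h \<le> hdist H ip f g + hdist H ip g h" if "f \<in> H" "g \<in> H" "h \<in> H" for f g h
    using that by (simp add: hdist_def hnorm_eq sn_diff_triangle)
qed

lemma complete_seq:
  assumes "\<And>k. f k \<in> H"
    and "\<And>\<epsilon>. 0 < \<epsilon> \<Longrightarrow> \<exists>N. \<forall>k\<ge>N. \<forall>l\<ge>N. sn (\<lambda>x. f k x - f l x) < \<epsilon>"
  shows "\<exists>g\<in>H. (\<lambda>k. sn (\<lambda>x. f k x - g x)) \<longlonglongrightarrow> 0"
proof -
  have "Metric.MCauchy f"
    using assms unfolding Metric.MCauchy_def by (auto simp: hdist_def hnorm_eq)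
  then obtain g where "limitin Metric.mtopology f g sequentially"
    using hilbert by (auto simp: hilbert_on_def Metric.mcomplete_def)
  then have g: "g \<in> H" "\<And>\<epsilon>. 0 < \<epsilon> \<Longrightarrow> \<exists>N. \<forall>k\<ge>N. sn (\<lambda>x. f k x - g x) < \<epsilon>"
    unfolding Metric.limit_metric_sequentially by (auto simp: hdist_def hnorm_eq assms(1))
  then have "(\<lambda>k. sn (\<lambda>x. f k x - g x)) \<longlonglongrightarrow> 0"
    using assms(1) by (auto simp: LIMSEQ_iff sn_nonneg diff_closed)
  with g(1) show ?thesis by blast
qed

lemma tendsto_functional:
  assumes "\<And>k. f k \<in> H" "g \<in> H" "(\<lambda>k. sn (\<lambda>x. f k x - g x)) \<longlonglongrightarrow> 0"
    and "\<And>h. h \<in> H \<Longrightarrow> cmod (\<phi> h) \<le> B * sn h"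
    and "\<And>h h'. h \<in> H \<Longrightarrow> h' \<in> H \<Longrightarrow> \<phi> (\<lambda>x. h x - h' x) = \<phi> h - \<phi> h'"
  shows "(\<lambda>k. \<phi> (f k)) \<longlonglongrightarrow> \<phi> g"
proof (rule Lim_transform_bound[of _ "\<lambda>k. B * sn (\<lambda>x. f k x - g x)", THEN LIM_zero_cancel])
  show "\<forall>\<^sub>F k in sequentially. norm (\<phi> (f k) - \<phi> g) \<le> norm (B * sn (\<lambda>x. f k x - g x))"
  proof (intro always_eventually allI)
    fix k
    have "norm (\<phi> (f k) - \<phi> g) \<le> B * sn (\<lambda>x. f k x - g x)"
      using assms(4)[OF diff_closed[OF assms(1,2)]] assms(5)[OF assms(1,2)] by simp
    then show "norm (\<phi> (f k) - \<phi> g) \<le> norm (B * sn (\<lambda>x. f k x - g x))" by simp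
  qed
  show "(\<lambda>k. B * sn (\<lambda>x. f k x - g x)) \<longlonglongrightarrow> 0"
    using tendsto_mult_right_zero[OF assms(3)] .
qed

lemma tendsto_ip:
  assumes "\<And>k. f k \<in> H" "g \<in> H" "(\<lambda>k. sn (\<lambda>x. f k x - g x)) \<longlonglongrightarrow> 0" "h \<in> H"
  shows "(\<lambda>k. ip (f k) h) \<longlonglongrightarrow> ip g h"
  using cauchy_schwarz_sn[OF _ assms(4)] assms(4)
  by (intro tendsto_functional[OF assms(1-3), of "\<lambda>f. ip f h" "sn h"]) (simp_all add: mult.commute diff_left)

lemma tendsto_sn:
  assumes "\<And>k. f k \<in> H" "g \<in> H" "(\<lambda>k. sn (\<lambda>x. f k x - g x)) \<longlonglongrightarrow> 0"
  shows "(\<lambda>k. sn (f k)) \<longlonglongrightarrow> sn g"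
proof (rule Lim_transform_bound[OF _ assms(3), THEN LIM_zero_cancel])
  show "\<forall>\<^sub>F k in sequentially. norm (sn (f k) - sn g) \<le> norm (sn (\<lambda>x. f k x - g x))"
    using sn_abs_diff[OF assms(1,2)] by (intro always_eventually allI) (smt (verit) real_norm_def)
qed

text \<open>The representer minimises \<open>\<parallel>f\<parallel>\<^sup>2 - 2 Re (\<phi> f)\<close>; by the parallelogram law every minimising
  sequence is Cauchy.\<close>

lemma riesz:
  assumes add: "\<And>f g. f \<in> H \<Longrightarrow> g \<in> H \<Longrightarrow> \<phi> (\<lambda>x. f x + g x) = \<phi> f + \<phi> g"
    and scale: "\<And>f c. f \<in> H \<Longrightarrow> \<phi> (\<lambda>x. c * f x) = c * \<phi> f"
    and bound: "\<And>f. f \<in> H \<Longrightarrow> cmod (\<phi> f) \<le> B * sn f"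
  shows "\<exists>h\<in>H. \<forall>f\<in>H. \<phi> f = ip f h"
proof -
  define J where "J f = Re (ip f f) - 2 * Re (\<phi> f)" for f
  have Jb: "- (B\<^sup>2) \<le> J f" if "f \<in> H" for f
  proof -
    have "0 \<le> (sn f - B)\<^sup>2" by simp
    then have "2 * (B * sn f) \<le> (sn f)\<^sup>2 + B\<^sup>2" by (simp add: power2_diff algebra_simps)
    moreover have "Re (\<phi> f) \<le> B * sn f" using bound[OF that] complex_Re_le_cmod[of "\<phi> f"] by linarith
    ultimately show ?thesis using that by (simp add: J_def sn_sq)
  qed
  define j where "j = Inf (J ` H)"
  have bb: "bdd_below (J ` H)" using Jb by (auto intro!: bdd_belowI)
  have jl: "j \<le> J f" if "f \<in> H" for f unfolding j_def using bb that by (simp add: cInf_lower)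
  have "\<exists>f\<in>H. J f < j + 1 / (real k + 1)" for k
  proof -
    have "Inf (J ` H) < j + 1 / (real k + 1)" by (simp add: j_def)
    then show ?thesis using cInf_lessD[of "J ` H"] zero_mem by auto
  qed
  then obtain f where f: "\<And>k. f k \<in> H" "\<And>k. J (f k) < j + 1 / (real k + 1)" by metis
  have par: "(sn (\<lambda>x. f x - g x))\<^sup>2 \<le> 2 * (J f - j) + 2 * (J g - j)" if "f \<in> H" "g \<in> H" for f g
  proof -
    let ?m = "\<lambda>x. (1/2) * (f x + g x)"
    have s: "(\<lambda>x. f x + g x) \<in> H" using that add_closed by blast
    have mm: "ip ?m ?m = 1/4 * ip (\<lambda>x. f x + g x) (\<lambda>x. f x + g x)"
      unfolding scale_left[OF s scale_closed[OF s]] scale_right[OF s s] by simp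
    have "j \<le> J ?m" using s scale_closed jl by blast
    also have "J ?m = 1/4 * (Re (ip f f) + 2 * Re (ip g f) + Re (ip g g)) - (Re (\<phi> f) + Re (\<phi> g))"
      using add_sq[OF that] unfolding J_def scale[OF s] add[OF that] mm by (simp add: add_divide_distrib)
    finally have "j \<le> (Re (ip f f) + 2 * Re (ip g f) + Re (ip g g)) / 4 - (Re (\<phi> f) + Re (\<phi> g))" by simp
    moreover have "(sn (\<lambda>x. f x - g x))\<^sup>2 = Re (ip f f) - 2 * Re (ip g f) + Re (ip g g)"
      using that by (simp add: sn_sq diff_closed diff_sq)
    ultimately show ?thesis unfolding J_def by argo
  qed
  have "\<exists>N. \<forall>k\<ge>N. \<forall>l\<ge>N. sn (\<lambda>x. f k x - f l x) < \<epsilon>" if \<epsilon>: "0 < \<epsilon>" for \<epsilon>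
  proof -
    obtain N where N: "4 / \<epsilon>\<^sup>2 < real N" using reals_Archimedean2 by blast
    have Np: "0 < real N" using N \<epsilon> by (smt (verit) divide_nonneg_nonneg zero_le_power2)
    have "sn (\<lambda>x. f k x - f l x) < \<epsilon>" if kl: "k \<ge> N" "l \<ge> N" for k l
    proof -
      have le: "1 / (real a + 1) \<le> 1 / real N" if "a \<ge> N" for a
        using that Np by (intro divide_left_mono) auto
      have "J (f a) - j \<le> 1 / real N" if "a \<ge> N" for a
        using order.trans[OF less_imp_le[OF f(2)[of a]] add_left_mono[OF le[OF that], of j]] by simp
      note Jk = this
      have "(sn (\<lambda>x. f k x - f l x))\<^sup>2 \<le> 4 * (1 / real N)"
        using par[OF f(1) f(1), of k l] Jk[OF kl(1)] Jk[OF kl(2)] by argo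
      also have "\<dots> < \<epsilon>\<^sup>2" using N Np \<epsilon> by (simp add: field_simps)
      finally show ?thesis using power2_less_imp_less[OF _ less_imp_le[OF \<epsilon>]] by blast
    qed
    then show ?thesis by blast
  qed
  from complete_seq[OF f(1) this] obtain h where h: "h \<in> H" "(\<lambda>k. sn (\<lambda>x. f k x - h x)) \<longlonglongrightarrow> 0" by blast
  have \<phi>diff: "\<phi> (\<lambda>x. f x - g x) = \<phi> f - \<phi> g" if "f \<in> H" "g \<in> H" for f g
    using add[OF that(1) scale_closed[OF that(2), of "-1"]] scale[OF that(2), of "-1"] by simp
  have "(\<lambda>k. J (f k)) \<longlonglongrightarrow> J h"
  proof -
    have "(\<lambda>k. (sn (f k))\<^sup>2 - 2 * Re (\<phi> (f k))) \<longlonglongrightarrow> (sn h)\<^sup>2 - 2 * Re (\<phi> h)"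
      by (intro tendsto_intros tendsto_sn[OF f(1) h] tendsto_functional[OF f(1) h, where B = B] bound \<phi>diff) auto
    then show ?thesis using f(1) h(1) by (simp add: J_def sn_sq)
  qed
  moreover have "(\<lambda>k. j + 1 / (real k + 1)) \<longlonglongrightarrow> j" by real_asymp
  ultimately have Jh: "J h \<le> j" using f(2) by (intro LIMSEQ_le) (auto intro: less_imp_le)
  have re: "Re (\<phi> g) = Re (ip g h)" if g: "g \<in> H" for g
  proof -
    have q: "0 \<le> 2 * t * (Re (ip g h) - Re (\<phi> g)) + t\<^sup>2 * Re (ip g g)" for t :: real
    proof -
      let ?u = "\<lambda>x. h x + of_real t * g x"
      have tg: "(\<lambda>x. of_real t * g x) \<in> H" using g scale_closed by blast
      have "J h \<le> J ?u" using Jh jl[OF add_closed[OF h(1) tg]] by linarith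
      also have "J ?u = J h + 2 * t * (Re (ip g h) - Re (\<phi> g)) + t\<^sup>2 * Re (ip g g)"
        unfolding J_def add_scale_sq[OF h(1) g] add[OF h(1) tg] scale[OF g] by (simp add: algebra_simps)
      finally show ?thesis by simp
    qed
    define \<delta> where "\<delta> = Re (ip g h) - Re (\<phi> g)"
    \<comment> \<open>The quadratic in \<open>t\<close> would be minimised at - \<delta> / G if its
      leading coefficient were \<open>G\<close>; the added 1 keeps this defined for
      \<open>g = 0\<close>.\<close>
    define G where "G = Re (ip g g) + 1"
    have G: "0 < G" using nonneg[OF g] by (simp add: G_def)
    have "0 \<le> 2 * (-\<delta> / G) * \<delta> + (-\<delta> / G)\<^sup>2 * Re (ip g g)" using q[of "-\<delta> / G"] by (simp add: \<delta>_def)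
    also have "\<dots> \<le> 2 * (-\<delta> / G) * \<delta> + (-\<delta> / G)\<^sup>2 * G"
      by (intro add_left_mono mult_left_mono) (simp_all add: G_def)
    also have "\<dots> = - (\<delta>\<^sup>2 / G)" using G by (simp add: power2_eq_square field_simps)
    finally have "\<delta>\<^sup>2 \<le> 0" using G by (simp add: divide_le_0_iff)
    then show ?thesis by (simp add: \<delta>_def)
  qed
  have "\<phi> g = ip g h" if g: "g \<in> H" for g
  proof -
    have "Re (\<i> * \<phi> g) = Re (\<i> * ip g h)"
      using re[OF scale_closed[OF g, of \<i>]] scale[OF g, of \<i>] scale_left[OF g h(1), of \<i>] by simp
    then show ?thesis using re[OF g] by (simp add: complex_eq_iff)
  qed
  then show ?thesis using h(1) by blast
qed

end

section \<open>The embedding into L2, its adjoint and its compactness\<close>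

locale rkhs_l2 =
  fixes D :: "'x set" and M :: "'x measure" and K :: "'x \<Rightarrow> 'x \<Rightarrow> complex"
    and H :: "('x \<Rightarrow> complex) set" and ip :: "('x \<Rightarrow> complex) \<Rightarrow> ('x \<Rightarrow> complex) \<Rightarrow> complex"
  assumes space_M: "space M = D"
    and rkhs: "rkhs D K H ip"
    and separable: "separable_on H ip"
    and H_meas: "H \<subseteq> borel_measurable M"
    and K_int: "integrable M (\<lambda>x. Re (K x x))"
begin

sublocale hilbert_fun H ip
  using rkhs by unfold_locales (simp add: rkhs_def)

abbreviation "ks \<equiv> kernel_section D K"
abbreviation "kk x \<equiv> Re (K x x)"
abbreviation "tr \<equiv> \<integral>x. kk x \<partial>M"

lemma ks_mem: "x \<in> D \<Longrightarrow> ks x \<in> H"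
  using rkhs by (simp add: rkhs_def)

lemma repr: "f \<in> H \<Longrightarrow> x \<in> D \<Longrightarrow> f x = ip f (ks x)"
  using rkhs by (simp add: rkhs_def)

lemma ip_ks: "x \<in> D \<Longrightarrow> Re (ip (ks x) (ks x)) = kk x"
  using repr[OF ks_mem, of x x] by (simp add: kernel_section_def)

lemma kk_nonneg: "x \<in> D \<Longrightarrow> 0 \<le> kk x"
  using ip_ks nonneg ks_mem by metis

lemma eval_bound_sq: "f \<in> H \<Longrightarrow> x \<in> D \<Longrightarrow> (cmod (f x))\<^sup>2 \<le> Re (ip f f) * kk x"
  using cauchy_schwarz[of f "ks x"] repr ks_mem ip_ks by metis

lemma countable_dense:
  obtains S where "countable S" "S \<subseteq> H" "\<And>f \<epsilon>. f \<in> H \<Longrightarrow> 0 < \<epsilon> \<Longrightarrow> \<exists>s\<in>S. sn (\<lambda>x. f x - s x) < \<epsilon>"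
proof -
  obtain S where S: "countable S" "S \<subseteq> H" "Metric.mtopology closure_of S = H"
    using separable by (auto simp: separable_on_def separable_space_def)
  have "\<exists>s\<in>S. sn (\<lambda>x. f x - s x) < \<epsilon>" if f: "f \<in> H" "0 < \<epsilon>" for f \<epsilon>
  proof -
    have "f \<in> Metric.mtopology closure_of S" using S f by simp
    then obtain s where "s \<in> S" "s \<in> Metric.mball f \<epsilon>"
      using f(2) unfolding Metric.metric_closure_of by blast
    then show ?thesis by (auto simp: Metric.mball_def hdist_def hnorm_eq)
  qed
  then show ?thesis using S that by blast
qed

lemma integrable_sq: "f \<in> H \<Longrightarrow> integrable M (\<lambda>x. (cmod (f x))\<^sup>2)"
proof (rule Bochner_Integration.integrable_bound)
  show "integrable M (\<lambda>x. Re (ip f f) * kk x)" using K_int by simp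
  assume f: "f \<in> H"
  then have [measurable]: "f \<in> borel_measurable M" using H_meas by blast
  show "(\<lambda>x. (cmod (f x))\<^sup>2) \<in> borel_measurable M" by measurable
  show "AE x in M. norm ((cmod (f x))\<^sup>2) \<le> norm (Re (ip f f) * kk x)"
    using eval_bound_sq[OF f] space_M by (intro AE_I2) (smt (verit) real_norm_def zero_le_power2)
qed

lemma integrable_mult_cnj:
  assumes f: "f \<in> H" and g: "g \<in> H"
  shows "integrable M (\<lambda>x. f x * cnj (g x))"
proof (rule Bochner_Integration.integrable_bound)
  show "integrable M (\<lambda>x. (cmod (f x))\<^sup>2 + (cmod (g x))\<^sup>2)"
    by (intro Bochner_Integration.integrable_add integrable_sq f g)
  have [measurable]: "f \<in> borel_measurable M" "g \<in> borel_measurable M" using assms H_meas by auto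
  have [measurable]: "cnj \<in> borel_measurable borel"
    by (intro borel_measurable_continuous_onI continuous_intros)
  show "(\<lambda>x. f x * cnj (g x)) \<in> borel_measurable M" by measurable
  show "AE x in M. norm (f x * cnj (g x)) \<le> norm ((cmod (f x))\<^sup>2 + (cmod (g x))\<^sup>2)"
  proof (intro AE_I2)
    fix x
    have "0 \<le> (cmod (f x) - cmod (g x))\<^sup>2" by simp
    then have "2 * (cmod (f x) * cmod (g x)) \<le> (cmod (f x))\<^sup>2 + (cmod (g x))\<^sup>2"
      by (simp add: power2_diff algebra_simps)
    moreover have "0 \<le> cmod (f x) * cmod (g x)" by simp
    ultimately show "norm (f x * cnj (g x)) \<le> norm ((cmod (f x))\<^sup>2 + (cmod (g x))\<^sup>2)"
      unfolding real_norm_def norm_mult complex_mod_cnj by linarith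
  qed
qed

lemma l2_self: "f \<in> H \<Longrightarrow> l2_inner M f f = of_real (\<integral>x. (cmod (f x))\<^sup>2 \<partial>M)"
  unfolding l2_inner_def by (simp only: complex_norm_square[symmetric] integral_complex_of_real)

sublocale L2: psd_form H "l2_inner M"
proof
  show "l2_inner M (\<lambda>x. f x + g x) h = l2_inner M f h + l2_inner M g h"
    if "f \<in> H" "g \<in> H" "h \<in> H" for f g h
    using that by (simp add: l2_inner_def distrib_right integrable_mult_cnj)
  show "l2_inner M (\<lambda>x. c * f x) h = c * l2_inner M f h" if "f \<in> H" "h \<in> H" for f h c
    using that by (simp add: l2_inner_def mult.assoc)
  show "l2_inner M f g = cnj (l2_inner M g f)" if "f \<in> H" "g \<in> H" for f g
    unfolding l2_inner_def by (subst Bochner_Integration.integral_cnj[symmetric]) (simp add: mult.commute)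
  show "0 \<le> Re (l2_inner M f f)" if "f \<in> H" for f
    using that by (simp add: l2_self)
qed (simp_all add: add_closed scale_closed)

abbreviation q :: "('x \<Rightarrow> complex) \<Rightarrow> real" where "q f \<equiv> Re (l2_inner M f f)"

lemma q_eq: "f \<in> H \<Longrightarrow> q f = (\<integral>x. (cmod (f x))\<^sup>2 \<partial>M)"
  by (simp add: l2_self)

lemma l2_norm_sq_eq: "f \<in> H \<Longrightarrow> l2_norm_sq M f = ennreal (q f)"
  unfolding l2_norm_sq_def q_eq by (intro nn_integral_eq_integral integrable_sq) auto

lemma q_le_trace: "f \<in> H \<Longrightarrow> q f \<le> tr * Re (ip f f)"
proof -
  assume f: "f \<in> H"
  have "q f \<le> (\<integral>x. Re (ip f f) * kk x \<partial>M)"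
    unfolding q_eq[OF f] using eval_bound_sq[OF f] space_M K_int integrable_sq[OF f]
    by (intro integral_mono) auto
  then show ?thesis by (simp add: mult.commute)
qed

lemma trace_nonneg: "0 \<le> tr"
  using kk_nonneg space_M by (intro integral_nonneg_AE AE_I2) auto

lemma L2_sn_le: "f \<in> H \<Longrightarrow> L2.sn f \<le> sqrt tr * sn f"
  using q_le_trace by (simp add: L2.sn_def sn_def flip: real_sqrt_mult)

lemma tendsto_q:
  assumes "\<And>k. f k \<in> H" "g \<in> H" "(\<lambda>k. sn (\<lambda>x. f k x - g x)) \<longlonglongrightarrow> 0"
  shows "(\<lambda>k. q (f k)) \<longlonglongrightarrow> q g"
proof -
  have "(\<lambda>k. L2.sn (f k)) \<longlonglongrightarrow> L2.sn g"
  proof (rule Lim_transform_bound[THEN LIM_zero_cancel])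
    show "(\<lambda>k. sqrt tr * sn (\<lambda>x. f k x - g x)) \<longlonglongrightarrow> 0"
      using tendsto_mult_right_zero[OF assms(3)] .
    have "\<bar>L2.sn (f k) - L2.sn g\<bar> \<le> sqrt tr * sn (\<lambda>x. f k x - g x)" for k
      using L2.sn_abs_diff[OF assms(1,2)] L2_sn_le[OF diff_closed[OF assms(1,2)]] order_trans by blast
    then show "\<forall>\<^sub>F k in sequentially. norm (L2.sn (f k) - L2.sn g) \<le> norm (sqrt tr * sn (\<lambda>x. f k x - g x))"
      by (intro always_eventually allI) (metis abs_ge_self order_trans real_norm_def)
  qed
  then have "(\<lambda>k. (L2.sn (f k))\<^sup>2) \<longlonglongrightarrow> (L2.sn g)\<^sup>2" by (intro tendsto_power)
  then show ?thesis by (simp only: L2.sn_sq[OF assms(1)] L2.sn_sq[OF assms(2)])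
qed

text \<open>Riesz representation applies because the finite trace makes the embedding bounded.
  Together with uniqueness in \<open>adjoint_eq\<close> this gives the definite description in
  \<open>Id_adjoint\<close> its meaning.\<close>

lemma adjoint_ex: "g \<in> H \<Longrightarrow> \<exists>h\<in>H. \<forall>f\<in>H. l2_inner M f g = ip f h"
proof (rule riesz)
  fix f assume fg: "g \<in> H" "f \<in> H"
  have "cmod (l2_inner M f g) \<le> L2.sn f * L2.sn g" using fg L2.cauchy_schwarz_sn by blast
  also have "\<dots> \<le> (sqrt tr * sn f) * L2.sn g"
    using fg by (intro mult_right_mono L2_sn_le L2.sn_nonneg)
  finally show "cmod (l2_inner M f g) \<le> (sqrt tr * L2.sn g) * sn f"
    by (simp add: ac_simps)
qed (simp_all add: L2.add_left L2.scale_left)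

lemma adjoint_eq:
  assumes "g \<in> H" "h \<in> H" "\<And>f. f \<in> H \<Longrightarrow> l2_inner M f g = ip f h"
  shows "Id_adjoint_Id M H ip g = h"
  unfolding Id_adjoint_Id_def Id_adjoint_def
proof (rule the_equality)
  fix h' assume h': "h' \<in> H \<and> (\<forall>f\<in>H. l2_inner M f g = ip f h')"
  have d: "(\<lambda>x. h' x - h x) \<in> H" using h' assms(2) diff_closed by blast
  have "ip (\<lambda>x. h' x - h x) (\<lambda>x. h' x - h x) = 0"
    using diff_right[of h' h "\<lambda>x. h' x - h x"] h' assms d by simp
  then show "h' = h" using eq_zero_iff[OF d] by (simp add: fun_eq_iff)
qed (use assms in auto)

lemma adjoint_mem_ip:
  assumes "g \<in> H"
  shows "Id_adjoint_Id M H ip g \<in> H"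
    and "f \<in> H \<Longrightarrow> l2_inner M f g = ip f (Id_adjoint_Id M H ip g)"
  using adjoint_ex[OF assms] adjoint_eq[OF assms] by metis+

text \<open>A diagonal argument makes the inner products with a countable dense set converge. Point
  evaluation is the inner product with a kernel section, and approximating the section within
  \<open>\<epsilon> / 3\<close> transfers the Cauchy property to it.\<close>

lemma bounded_pointwise_subseq:
  assumes f: "\<And>k. f k \<in> H" and b: "\<And>k. sn (f k) \<le> 1"
  shows "\<exists>r. strict_mono (r :: nat \<Rightarrow> nat) \<and> (\<forall>x\<in>D. convergent (\<lambda>k. f (r k) x))"
proof -
  obtain S where S: "countable S" "S \<subseteq> H" "\<And>f \<epsilon>. f \<in> H \<Longrightarrow> 0 < \<epsilon> \<Longrightarrow> \<exists>s\<in>S. sn (\<lambda>x. f x - s x) < \<epsilon>"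
    using countable_dense by blast
  have bd: "cmod (ip (f k) h) \<le> sn h" if "h \<in> H" for k h
  proof -
    have "cmod (ip (f k) h) \<le> sn (f k) * sn h" using cauchy_schwarz_sn f that by blast
    also have "\<dots> \<le> 1 * sn h" using b sn_nonneg[OF that] by (intro mult_right_mono) auto
    finally show ?thesis by simp
  qed
  \<comment> \<open>The subsequence theorem wants one bound for all \<open>s\<close>; the division
    by \<open>1 + sn s\<close> provides it and is undone below.\<close>
  have "norm (ip (f k) s / of_real (1 + sn s)) \<le> 1" if "s \<in> S" for k s
  proof -
    have "0 \<le> sn s" "cmod (ip (f k) s) \<le> sn s" using bd that S(2) sn_nonneg by auto
    then show ?thesis by (simp add: norm_divide divide_le_eq del: of_real_add)
  qed
  then obtain r where r: "strict_mono (r :: nat \<Rightarrow> nat)"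
      "\<And>s. s \<in> S \<Longrightarrow> \<exists>l. (\<lambda>k. ip (f (r k)) s / of_real (1 + sn s)) \<longlonglongrightarrow> l"
    using function_convergent_subsequence[OF S(1), of "\<lambda>k s. ip (f k) s / of_real (1 + sn s)" 1] by blast
  have convS: "Cauchy (\<lambda>k. ip (f (r k)) s)" if s: "s \<in> S" for s
  proof -
    from r(2)[OF s] obtain l where "(\<lambda>k. ip (f (r k)) s / of_real (1 + sn s)) \<longlonglongrightarrow> l" ..
    then have "(\<lambda>k. ip (f (r k)) s / of_real (1 + sn s) * of_real (1 + sn s)) \<longlonglongrightarrow> l * of_real (1 + sn s)"
      by (intro tendsto_intros)
    moreover have "complex_of_real (1 + sn s) \<noteq> 0"
      using sn_nonneg[of s] s S(2) by (smt (verit) of_real_eq_0_iff subsetD)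
    ultimately show ?thesis by (simp add: LIMSEQ_imp_Cauchy)
  qed
  have "convergent (\<lambda>k. f (r k) x)" if x: "x \<in> D" for x
  proof -
    have "Cauchy (\<lambda>k. ip (f (r k)) (ks x))"
    proof (rule metric_CauchyI)
      fix \<epsilon> :: real assume \<epsilon>: "0 < \<epsilon>"
      obtain s where s: "s \<in> S" "sn (\<lambda>y. ks x y - s y) < \<epsilon> / 3"
        using S(3)[OF ks_mem[OF x], of "\<epsilon> / 3"] \<epsilon> by auto
      have sH: "s \<in> H" using s S by blast
      obtain N where N: "\<forall>k\<ge>N. \<forall>l\<ge>N. dist (ip (f (r k)) s) (ip (f (r l)) s) < \<epsilon> / 3"
        using metric_CauchyD[OF convS[OF s(1)], of "\<epsilon> / 3"] \<epsilon> by auto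
      have near: "dist (ip (f k) (ks x)) (ip (f k) s) < \<epsilon> / 3" for k
      proof -
        have "ip (f k) (ks x) - ip (f k) s = ip (f k) (\<lambda>y. ks x y - s y)"
          using diff_right[OF ks_mem[OF x] sH f] by simp
        then show ?thesis using bd[OF diff_closed[OF ks_mem[OF x] sH], of k] s(2) by (simp add: dist_norm)
      qed
      have "dist (ip (f (r k)) (ks x)) (ip (f (r l)) (ks x)) < \<epsilon>" if "k \<ge> N" "l \<ge> N" for k l
      proof -
        have "dist (ip (f (r k)) s) (ip (f (r l)) s) < \<epsilon> / 3" using N that by blast
        then show ?thesis using near[of "r k"] near[of "r l"]
          dist_triangle[of "ip (f (r k)) (ks x)" "ip (f (r l)) (ks x)" "ip (f (r k)) s"]
          dist_triangle[of "ip (f (r k)) s" "ip (f (r l)) (ks x)" "ip (f (r l)) s"]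
          by (simp add: dist_commute)
      qed
      then show "\<exists>N. \<forall>k\<ge>N. \<forall>l\<ge>N. dist (ip (f (r k)) (ks x)) (ip (f (r l)) (ks x)) < \<epsilon>" by blast
    qed
    then show ?thesis using repr[OF f x] by (simp add: Cauchy_convergent_iff)
  qed
  with r(1) show ?thesis by auto
qed

text \<open>Bounded sequences have weakly, hence pointwise, convergent subsequences; the trace condition
  supplies the integrable majorant. This is the compactness of the embedding.\<close>

lemma bounded_l2_cauchy_subseq:
  assumes f: "\<And>k. f k \<in> H" and b: "\<And>k. sn (f k) \<le> 1"
  shows "\<exists>r. strict_mono (r :: nat \<Rightarrow> nat) \<and>
    (\<forall>\<epsilon>>0. \<exists>N. \<forall>k\<ge>N. \<forall>l\<ge>N. q (\<lambda>x. f (r k) x - f (r l) x) < \<epsilon>)"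
proof -
  obtain r where r: "strict_mono (r :: nat \<Rightarrow> nat)" "\<And>x. x \<in> D \<Longrightarrow> convergent (\<lambda>k. f (r k) x)"
    using bounded_pointwise_subseq[of f, OF f b] by auto
  \<comment> \<open>The limit serves as a measurable function to compare with in L2; its membership
    in \<open>H\<close> is left open. Both \<open>f k\<close> and \<open>F\<close> have squared
    modulus at most \<open>kk\<close>, hence the majorant \<open>4 * kk x\<close> for the
    difference.\<close>
  define F where "F x = lim (\<lambda>k. f (r k) x)" for x
  have F: "(\<lambda>k. f (r k) x) \<longlonglongrightarrow> F x" if "x \<in> D" for x
    using r(2)[OF that] by (simp add: F_def convergent_LIMSEQ_iff)
  have fm[measurable]: "f k \<in> borel_measurable M" for k using f H_meas by blast
  have [measurable]: "F \<in> borel_measurable M"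
    by (rule borel_measurable_LIMSEQ_metric[where f = "\<lambda>k. f (r k)"]) (use F space_M in auto)
  have fb: "(cmod (f k x))\<^sup>2 \<le> kk x" if "x \<in> D" for k x
  proof -
    have "Re (ip (f k) (f k)) \<le> 1" using b[of k] nonneg[OF f] by (simp add: sn_def real_sqrt_le_1_iff)
    then have "Re (ip (f k) (f k)) * kk x \<le> 1 * kk x" using kk_nonneg[OF that] by (intro mult_right_mono)
    then show ?thesis using eval_bound_sq[OF f[of k] that] by linarith
  qed
  have Fb: "(cmod (F x))\<^sup>2 \<le> kk x" if "x \<in> D" for x
    by (rule LIMSEQ_le_const2[OF tendsto_power[OF tendsto_norm[OF F[OF that]]]]) (use fb that in auto)
  have sq: "(cmod (a - c))\<^sup>2 \<le> 2 * (cmod a)\<^sup>2 + 2 * (cmod c)\<^sup>2" for a c :: complex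
  proof -
    have "(cmod (a - c))\<^sup>2 \<le> (cmod a + cmod c)\<^sup>2" by (intro power_mono norm_triangle_ineq4) simp
    also have "\<dots> \<le> 2 * (cmod a)\<^sup>2 + 2 * (cmod c)\<^sup>2" using sum_squares_bound[of "cmod a" "cmod c"] by (simp add: power2_sum)
    finally show ?thesis .
  qed
  have db: "(cmod (f k x - F x))\<^sup>2 \<le> 4 * kk x" if "x \<in> D" for k x
    using sq[of "f k x" "F x"] fb[OF that, of k] Fb[OF that] by linarith
  have int: "integrable M (\<lambda>x. (cmod (f k x - F x))\<^sup>2)" for k
    by (rule Bochner_Integration.integrable_bound[of M "\<lambda>x. 4 * kk x"])
       (use K_int db space_M in \<open>auto intro!: AE_I2 intro: order_trans[OF _ abs_ge_self]\<close>)
  have lim: "(\<lambda>k. \<integral>x. (cmod (f (r k) x - F x))\<^sup>2 \<partial>M) \<longlonglongrightarrow> (\<integral>x. 0 \<partial>M)"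
  proof (rule integral_dominated_convergence[where w = "\<lambda>x. 4 * kk x"])
    show "AE x in M. (\<lambda>k. (cmod (f (r k) x - F x))\<^sup>2) \<longlonglongrightarrow> 0"
    proof (intro AE_I2)
      fix x assume "x \<in> space M"
      then have "(\<lambda>k. (cmod (f (r k) x - F x))\<^sup>2) \<longlonglongrightarrow> (cmod (F x - F x))\<^sup>2"
        using F space_M by (intro tendsto_intros) auto
      then show "(\<lambda>k. (cmod (f (r k) x - F x))\<^sup>2) \<longlonglongrightarrow> 0" by simp
    qed
  qed (use K_int db space_M in auto)
  have qle: "q (\<lambda>x. f k x - f l x) \<le> 2 * (\<integral>x. (cmod (f k x - F x))\<^sup>2 \<partial>M) + 2 * (\<integral>x. (cmod (f l x - F x))\<^sup>2 \<partial>M)" for k l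
  proof -
    have d: "(\<lambda>x. f k x - f l x) \<in> H" using f diff_closed by blast
    have "q (\<lambda>x. f k x - f l x) \<le> (\<integral>x. 2 * (cmod (f k x - F x))\<^sup>2 + 2 * (cmod (f l x - F x))\<^sup>2 \<partial>M)"
      unfolding q_eq[OF d]
    proof (rule integral_mono[OF integrable_sq[OF d]])
      show "integrable M (\<lambda>x. 2 * (cmod (f k x - F x))\<^sup>2 + 2 * (cmod (f l x - F x))\<^sup>2)"
        using int by simp
      show "(cmod (f k x - f l x))\<^sup>2 \<le> 2 * (cmod (f k x - F x))\<^sup>2 + 2 * (cmod (f l x - F x))\<^sup>2" for x
        using sq[of "f k x - F x" "f l x - F x"] by simp
    qed
    also have "\<dots> = 2 * (\<integral>x. (cmod (f k x - F x))\<^sup>2 \<partial>M) + 2 * (\<integral>x. (cmod (f l x - F x))\<^sup>2 \<partial>M)"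
      using int by simp
    finally show ?thesis .
  qed
  have "\<exists>N. \<forall>k\<ge>N. \<forall>l\<ge>N. q (\<lambda>x. f (r k) x - f (r l) x) < \<epsilon>" if \<epsilon>: "0 < \<epsilon>" for \<epsilon>
  proof -
    have "eventually (\<lambda>k. (\<integral>x. (cmod (f (r k) x - F x))\<^sup>2 \<partial>M) < \<epsilon> / 4) sequentially"
      using order_tendstoD(2)[OF lim, of "\<epsilon> / 4"] \<epsilon> by simp
    then obtain N where N: "\<forall>k\<ge>N. (\<integral>x. (cmod (f (r k) x - F x))\<^sup>2 \<partial>M) < \<epsilon> / 4"
      by (auto simp: eventually_sequentially)
    have "q (\<lambda>x. f (r k) x - f (r l) x) < \<epsilon>" if "k \<ge> N" "l \<ge> N" for k l
      using qle[of "r k" "r l"] N[rule_format, OF that(1)] N[rule_format, OF that(2)] by linarith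
    then show ?thesis by blast
  qed
  with r(1) show ?thesis by auto
qed

end

section \<open>The singular system of the embedding\<close>

lemma sum_shift_tail:
  fixes g :: "nat \<Rightarrow> 'a :: comm_monoid_add"
  assumes "1 \<le> m"
  shows "(\<Sum>j\<in>{1..<N + m}. g j) = (\<Sum>j\<in>{1..<m}. g j) + (\<Sum>i<N. g (m + i))"
proof -
  have "(\<Sum>j\<in>{m..<N + m}. g j) = (\<Sum>i<N. g (m + i))"
    using sum.shift_bounds_nat_ivl[of g 0 m N] by (simp add: lessThan_atLeast0 add.commute)
  then show ?thesis using assms sum.atLeastLessThan_concat[of 1 m "N + m" g] by simp
qed

locale rkhs_eigen = rkhs_l2 D M K H ip
  for D :: "'x set" and M K H ip +
  fixes lam :: "nat \<Rightarrow> real" and e :: "nat \<Rightarrow> 'x \<Rightarrow> complex"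
  assumes eigen: "eigensystem M H ip lam e"
begin

lemma lam_pos: "1 \<le> j \<Longrightarrow> 0 < lam j"
  using eigen by (simp add: eigensystem_def)

lemma lam_antimono: "1 \<le> i \<Longrightarrow> i \<le> j \<Longrightarrow> lam j \<le> lam i"
  using eigen by (simp add: eigensystem_def)

lemma e_mem: "1 \<le> j \<Longrightarrow> e j \<in> H"
  using eigen by (simp add: eigensystem_def)

lemma ip_e: "1 \<le> i \<Longrightarrow> 1 \<le> j \<Longrightarrow> ip (e i) (e j) = (if i = j then 1 else 0)"
  using eigen by (simp add: eigensystem_def)

lemma l2_e: "1 \<le> j \<Longrightarrow> f \<in> H \<Longrightarrow> l2_inner M f (e j) = of_real (lam j) * ip f (e j)"
proof -
  assume j: "1 \<le> j" and f: "f \<in> H"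
  have "Id_adjoint_Id M H ip (e j) = (\<lambda>x. of_real (lam j) * e j x)"
    using eigen j by (simp add: eigensystem_def)
  then show ?thesis using adjoint_mem_ip(2)[OF e_mem[OF j] f] scale_right[OF e_mem[OF j] f] by simp
qed

lemma q_e: "1 \<le> j \<Longrightarrow> q (e j) = lam j"
  using l2_e[OF _ e_mem] ip_e by simp

text \<open>If the supremum \<open>\<mu>\<close> of the Rayleigh quotient over the complement exceeded \<open>b\<close>, then
  \<open>\<mu> \<parallel>f\<parallel>\<^sup>2 - q f\<close> would be a positive semidefinite form there, which together with the compactness
  makes a maximising sequence converge to an eigenvector for \<open>\<mu>\<close>, and those are excluded.\<close>

lemma complement_l2_bound:
  assumes J: "J \<subseteq> {1..}" "\<And>j. 1 \<le> j \<Longrightarrow> b < lam j \<Longrightarrow> j \<in> J" and b: "0 \<le> b"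
    and f: "f \<in> H" "\<And>j. j \<in> J \<Longrightarrow> ip f (e j) = 0"
  shows "q f \<le> b * Re (ip f f)"
proof (rule ccontr)
  assume contra: "\<not> ?thesis"
  define U where "U = {f \<in> H. \<forall>j\<in>J. ip f (e j) = 0}"
  have UH: "U \<subseteq> H" by (auto simp: U_def)
  have eH: "e j \<in> H" if "j \<in> J" for j using that J(1) e_mem by auto
  have Uadd: "(\<lambda>x. f x + g x) \<in> U" if "f \<in> U" "g \<in> U" for f g
    using that eH by (auto simp: U_def add_closed add_left)
  have Uscale: "(\<lambda>x. c * f x) \<in> U" if "f \<in> U" for f c
    using that eH by (auto simp: U_def scale_closed scale_left)
  have fU: "f \<in> U" using f by (simp add: U_def)
  define B where "B = {g \<in> U. sn g \<le> 1}"
  have qB: "q g \<le> tr" if "g \<in> B" for g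
  proof -
    have g: "g \<in> H" "Re (ip g g) \<le> 1"
      using that UH by (auto simp: B_def sn_def real_sqrt_le_1_iff)
    then have "tr * Re (ip g g) \<le> tr * 1" using trace_nonneg by (intro mult_left_mono)
    then show ?thesis using q_le_trace[OF g(1)] by simp
  qed
  define \<mu> where "\<mu> = Sup (q ` B)"
  have bdd: "bdd_above (q ` B)" using qB by (auto intro!: bdd_aboveI)
  have q\<mu>: "q g \<le> \<mu> * Re (ip g g)" if g: "g \<in> U" for g
  proof (cases "sn g = 0")
    case True
    then have "g = (\<lambda>x. 0)" using sn_eq_zero_iff g UH by blast
    then show ?thesis using L2.zero_left[OF zero_mem] zero_left[OF zero_mem] by simp
  next
    case False
    have gH: "g \<in> H" using g UH by blast
    have s: "0 < sn g" using False sn_nonneg[OF gH] by simp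
    let ?g = "\<lambda>x. of_real (1 / sn g) * g x"
    have "sn ?g = 1" unfolding sn_scale[OF gH] norm_of_real using s by simp
    then have "?g \<in> B" using Uscale[OF g, of "of_real (1 / sn g)"] by (simp add: B_def)
    then have "q ?g \<le> \<mu>" unfolding \<mu>_def using bdd by (simp add: cSup_upper)
    moreover have "q ?g = (1 / sn g)\<^sup>2 * q g"
    proof -
      have "L2.sn ?g = 1 / sn g * L2.sn g" unfolding L2.sn_scale[OF gH] norm_of_real using s by simp
      then have "(L2.sn ?g)\<^sup>2 = (1 / sn g)\<^sup>2 * (L2.sn g)\<^sup>2" by (simp only: power_mult_distrib)
      then show ?thesis by (simp only: L2.sn_sq[OF gH] L2.sn_sq[OF scale_closed[OF gH]])
    qed
    ultimately have "(1 / sn g)\<^sup>2 * q g \<le> \<mu>" by simp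
    then have "q g \<le> \<mu> * (sn g)\<^sup>2" using s by (simp add: field_simps)
    then show ?thesis using sn_sq[OF gH] by simp
  qed
  have "b * Re (ip f f) < \<mu> * Re (ip f f)" using contra q\<mu>[OF fU] by linarith
  then have b\<mu>: "b < \<mu>" using nonneg[OF f(1)] by (simp add: mult_less_cancel_right)
  then have \<mu>: "0 < \<mu>" using b by simp
  have "\<exists>g\<in>B. \<mu> - 1 / (real k + 1) < q g" for k
  proof -
    have "\<mu> - 1 / (real k + 1) < Sup (q ` B)" by (simp add: \<mu>_def)
    moreover have "(\<lambda>x. 0) \<in> B"
      using Uscale[OF fU, of 0] sn_eq_zero_iff[OF zero_mem] by (simp add: B_def)
    ultimately show ?thesis using less_cSupD[of "q ` B"] by auto
  qed
  then obtain g where g: "\<And>k. g k \<in> B" "\<And>k. \<mu> - 1 / (real k + 1) < q (g k)" by metis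
  have gU: "g k \<in> U" and gH: "g k \<in> H" and g1: "sn (g k) \<le> 1" for k
    using g(1)[of k] UH by (auto simp: B_def)
  obtain r where r: "strict_mono (r :: nat \<Rightarrow> nat)"
      "\<And>\<epsilon>. 0 < \<epsilon> \<Longrightarrow> \<exists>N. \<forall>k\<ge>N. \<forall>l\<ge>N. q (\<lambda>x. g (r k) x - g (r l) x) < \<epsilon>"
    using bounded_l2_cauchy_subseq[of g, OF gH g1] by auto
  define p where "p u v = of_real \<mu> * ip u v - l2_inner M u v" for u v
  interpret p: psd_form U p
  proof
    show "p u v = cnj (p v u)" if "u \<in> U" "v \<in> U" for u v
    proof -
      have uv: "u \<in> H" "v \<in> H" using that UH by auto
      show ?thesis unfolding p_def using herm[OF uv] L2.herm[OF uv] by simp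
    qed
    show "p (\<lambda>x. u x + v x) h = p u h + p v h" if "u \<in> U" "v \<in> U" "h \<in> U" for u v h
      using that UH unfolding p_def by (simp add: subset_iff add_left L2.add_left algebra_simps)
    show "p (\<lambda>x. c * u x) h = c * p u h" if "u \<in> U" "h \<in> U" for u h c
      using that UH unfolding p_def by (simp add: subset_iff scale_left L2.scale_left algebra_simps)
    show "0 \<le> Re (p u u)" if "u \<in> U" for u
      using q\<mu>[OF that] by (simp add: p_def)
  qed (use Uadd Uscale in auto)
  have pg: "Re (p (g k) (g k)) \<le> 1 / (real k + 1)" for k
  proof -
    have "\<mu> * Re (ip (g k) (g k)) \<le> \<mu> * 1"
      using \<mu> g1[of k] by (intro mult_left_mono) (simp_all add: sn_def real_sqrt_le_1_iff)
    then show ?thesis using g(2)[of k] by (simp add: p_def)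
  qed
  have "\<exists>N. \<forall>k\<ge>N. \<forall>l\<ge>N. sn (\<lambda>x. g (r k) x - g (r l) x) < \<epsilon>" if \<epsilon>: "0 < \<epsilon>" for \<epsilon>
  proof -
    \<comment> \<open>For a difference \<open>d\<close> of two members, \<mu> |d|^2 is the value of
      \<open>p\<close> plus the value of \<open>q\<close>. The first is at most 4 \<delta> as both
      members are nearly maximal, the second is below \<delta> by compactness, and 5 \<delta> is at
      most \<mu> \<epsilon>^2.\<close>
    define \<delta> where "\<delta> = \<mu> * \<epsilon>\<^sup>2 / 8"
    have \<delta>: "0 < \<delta>" using \<mu> \<epsilon> by (simp add: \<delta>_def)
    obtain N1 where N1: "\<forall>k\<ge>N1. \<forall>l\<ge>N1. q (\<lambda>x. g (r k) x - g (r l) x) < \<delta>" using r(2)[OF \<delta>] by blast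
    obtain N2 where N2: "1 / \<delta> < real N2" using reals_Archimedean2 by blast
    have le: "1 / (real (r k) + 1) \<le> \<delta>" if "k \<ge> N2" for k
    proof -
      have "real N2 \<le> real (r k)" using that seq_suble[OF r(1), of k] by simp
      then have "1 / \<delta> \<le> real (r k) + 1" using N2 by linarith
      then show ?thesis using \<delta> by (simp add: field_simps)
    qed
    have "sn (\<lambda>x. g (r k) x - g (r l) x) < \<epsilon>" if "k \<ge> max N1 N2" "l \<ge> max N1 N2" for k l
    proof -
      let ?d = "\<lambda>x. g (r k) x - g (r l) x"
      have dH: "?d \<in> H" using gH diff_closed by blast
      have "Re (p ?d ?d) \<le> 2 * Re (p (g (r k)) (g (r k))) + 2 * Re (p (g (r l)) (g (r l)))"
        by (rule p.diff_sq_le[OF gU gU])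
      also have "\<dots> \<le> 4 * \<delta>"
        using order.trans[OF pg le, of k] order.trans[OF pg le, of l] that by simp
      finally have "\<mu> * Re (ip ?d ?d) \<le> 4 * \<delta> + q ?d" by (simp add: p_def)
      also have "\<dots> < 5 * \<delta>" using N1 that by simp
      also have "\<dots> \<le> \<mu> * \<epsilon>\<^sup>2" using \<mu> by (simp add: \<delta>_def)
      finally have "(sn ?d)\<^sup>2 < \<epsilon>\<^sup>2" using \<mu> sn_sq[OF dH] by simp
      then show ?thesis using power2_less_imp_less[OF _ less_imp_le[OF \<epsilon>]] by blast
    qed
    then show ?thesis by blast
  qed
  from complete_seq[OF gH this] obtain h where h: "h \<in> H" "(\<lambda>k. sn (\<lambda>x. g (r k) x - h x)) \<longlonglongrightarrow> 0" by blast
  have hU: "h \<in> U"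
  proof -
    have "ip h (e j) = 0" if "j \<in> J" for j
      using tendsto_ip[OF gH h eH[OF that]] gU that by (simp add: U_def tendsto_const_iff)
    then show ?thesis using h(1) by (simp add: U_def)
  qed
  have lim_q: "(\<lambda>k. q (g (r k))) \<longlonglongrightarrow> q h" by (rule tendsto_q[OF gH h])
  have lim0: "(\<lambda>k. 1 / (real (r k) + 1)) \<longlonglongrightarrow> 0"
  proof -
    have "(\<lambda>k. 1 / (real k + 1)) \<longlonglongrightarrow> 0" by real_asymp
    from LIMSEQ_subseq_LIMSEQ[OF this r(1)] show ?thesis by (simp add: o_def)
  qed
  have qh: "\<mu> \<le> q h"
  proof (rule LIMSEQ_le[OF _ lim_q])
    show "(\<lambda>k. \<mu> - 1 / (real (r k) + 1)) \<longlonglongrightarrow> \<mu>" using tendsto_diff[OF tendsto_const lim0, of \<mu>] by simp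
  qed (use g(2) in \<open>auto intro: less_imp_le\<close>)
  have "sn h \<le> 1" using LIMSEQ_le_const2[OF tendsto_sn[OF gH h]] g1 by blast
  then have "\<mu> * Re (ip h h) \<le> \<mu> * 1" using \<mu> by (intro mult_left_mono) (simp_all add: sn_def real_sqrt_le_1_iff)
  then have ph: "Re (p h h) \<le> 0" using qh by (simp add: p_def)
  \<comment> \<open>A null vector of a semidefinite form is orthogonal, with respect to the form, to
    everything; for \<open>p\<close> this is the eigenvalue equation for \<open>h\<close> tested
    against \<open>U\<close>.\<close>
  have ph0: "p v h = 0" if "v \<in> U" for v
  proof -
    have "(cmod (p v h))\<^sup>2 \<le> Re (p v v) * Re (p h h)" by (rule p.cauchy_schwarz[OF that hU])
    also have "\<dots> \<le> 0" using p.nonneg[OF that] ph by (simp add: mult_le_0_iff)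
    finally show ?thesis by simp
  qed
  define a where "a = Id_adjoint_Id M H ip h"
  have a: "a \<in> H" "\<And>v. v \<in> H \<Longrightarrow> l2_inner M v h = ip v a"
    using adjoint_mem_ip[OF h(1)] by (simp_all add: a_def)
  have \<mu>h: "(\<lambda>x. of_real \<mu> * h x) \<in> H" using h(1) scale_closed by blast
  let ?d = "\<lambda>x. a x - of_real \<mu> * h x"
  have dH: "?d \<in> H" using diff_closed[OF a(1) \<mu>h] .
  \<comment> \<open>\<open>U\<close> is invariant under the operator because the removed
    \<open>e j\<close> are eigenvectors. Hence the defect of the eigenvalue equation lies in
    \<open>U\<close> and can be tested against itself.\<close>
  have dU: "?d \<in> U"
  proof -
    have "ip ?d (e j) = 0" if j: "j \<in> J" for j
    proof -
      have j1: "1 \<le> j" using j J(1) by auto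
      have "ip a (e j) = cnj (l2_inner M (e j) h)" using herm[OF a(1) eH[OF j]] a(2)[OF eH[OF j]] by simp
      also have "\<dots> = l2_inner M h (e j)" using L2.herm[OF h(1) eH[OF j]] by simp
      also have "\<dots> = 0" using l2_e[OF j1 h(1)] hU j by (simp add: U_def)
      finally show ?thesis
        using diff_left[OF a(1) \<mu>h eH[OF j]] scale_left[OF h(1) eH[OF j]] hU j by (simp add: U_def)
    qed
    then show ?thesis using dH by (simp add: U_def)
  qed
  have "ip ?d ?d = 0"
    using diff_right[OF a(1) \<mu>h dH] scale_right[OF h(1) dH, of "of_real \<mu>"] ph0[OF dU] a(2)[OF dH]
    by (simp add: p_def)
  then have "a = (\<lambda>x. of_real \<mu> * h x)" using eq_zero_iff[OF dH] by (simp add: fun_eq_iff)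
  then obtain c where c: "h = (\<lambda>x. \<Sum>j | 1 \<le> j \<and> lam j = \<mu>. c j * e j x)"
    using eigen h(1) \<mu> unfolding eigensystem_def a_def by blast
  \<comment> \<open>As \<mu> exceeds \<open>b\<close>, every \<open>e j\<close> with eigenvalue
    \<mu> is among those to which \<open>h\<close> is orthogonal, while \<open>h\<close> lies in
    their span.\<close>
  have "ip h h = (\<Sum>j | 1 \<le> j \<and> lam j = \<mu>. c j * ip (e j) h)"
    by (subst c) (rule sum_left, use e_mem h(1) in auto)
  also have "\<dots> = 0"
  proof (rule sum.neutral, intro ballI)
    fix j assume "j \<in> {j. 1 \<le> j \<and> lam j = \<mu>}"
    then have j: "j \<in> J" using J(2) b\<mu> by auto
    have "ip (e j) h = cnj (ip h (e j))" using herm[OF eH[OF j] h(1)] .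
    then show "c j * ip (e j) h = 0" using hU j by (simp add: U_def)
  qed
  finally have "h = (\<lambda>x. 0)" using eq_zero_iff[OF h(1)] by simp
  then have "q h = 0" using L2.zero_left[OF zero_mem] by simp
  then show False using qh \<mu> by simp
qed

section \<open>Projection residuals and the residual kernel\<close>

definition res :: "nat \<Rightarrow> ('x \<Rightarrow> complex) \<Rightarrow> 'x \<Rightarrow> complex" where
  "res N f = (\<lambda>x. f x - (\<Sum>j\<in>{1..<N}. ip f (e j) * e j x))"

lemma proj_mem: "(\<lambda>x. \<Sum>j\<in>{1..<N}. c j * e j x) \<in> H"
  using e_mem by (intro sum_closed zero_mem) auto

lemma res_mem: "f \<in> H \<Longrightarrow> res N f \<in> H"
  unfolding res_def by (rule diff_closed[OF _ proj_mem])

lemma ip_proj: "1 \<le> i \<Longrightarrow> ip (\<lambda>x. \<Sum>j\<in>{1..<N}. c j * e j x) (e i) = (if i < N then c i else 0)"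
proof -
  assume i: "1 \<le> i"
  have "ip (\<lambda>x. \<Sum>j\<in>{1..<N}. c j * e j x) (e i) = (\<Sum>j\<in>{1..<N}. c j * ip (e j) (e i))"
    using e_mem i by (intro sum_left) auto
  also have "\<dots> = (\<Sum>j\<in>{1..<N}. if j = i then c j else 0)"
    using i by (intro sum.cong) (auto simp: ip_e)
  also have "\<dots> = (if i < N then c i else 0)" using i by simp
  finally show ?thesis .
qed

lemma ip_res: "f \<in> H \<Longrightarrow> 1 \<le> j \<Longrightarrow> ip (res N f) (e j) = (if j < N then 0 else ip f (e j))"
  unfolding res_def using diff_left[OF _ proj_mem e_mem] ip_proj by auto

text \<open>The residual of \<open>g\<close> is orthogonal to \<open>e 1, ..., e (N - 1)\<close>, so
  removing their span from \<open>f\<close> does not change the inner product.\<close>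

lemma ip_res_res:
  assumes "f \<in> H" "g \<in> H"
  shows "ip f (res N g) = ip (res N f) (res N g)"
proof -
  have "ip (\<lambda>x. \<Sum>j\<in>{1..<N}. ip f (e j) * e j x) (res N g)
      = (\<Sum>j\<in>{1..<N}. ip f (e j) * ip (e j) (res N g))"
    using e_mem res_mem[OF assms(2)] by (intro sum_left) auto
  also have "\<dots> = 0"
  proof (rule sum.neutral, intro ballI)
    fix j assume "j \<in> {1..<N}"
    then have "ip (e j) (res N g) = cnj (ip (res N g) (e j))" "ip (res N g) (e j) = 0"
      using herm[OF e_mem res_mem[OF assms(2)]] ip_res[OF assms(2)] by auto
    then show "ip f (e j) * ip (e j) (res N g) = 0" by simp
  qed
  finally show ?thesis
    using diff_left[OF assms(1) proj_mem[of "\<lambda>j. ip f (e j)" N] res_mem[OF assms(2), of N]] by (simp add: res_def[of N f])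
qed

lemma ip_res_sym:
  assumes "f \<in> H" "g \<in> H"
  shows "ip (res N f) g = ip f (res N g)"
  using ip_res_res[OF assms, of N] ip_res_res[OF assms(2,1), of N]
    herm[OF res_mem[OF assms(1)] assms(2)] herm[OF res_mem[OF assms(1)] res_mem[OF assms(2)]] by simp

lemma bessel_eq: "f \<in> H \<Longrightarrow> Re (ip (res N f) (res N f)) = Re (ip f f) - (\<Sum>j\<in>{1..<N}. (cmod (ip f (e j)))\<^sup>2)"
proof -
  assume f: "f \<in> H"
  have "ip (res N f) (res N f) = cnj (ip (res N f) f)"
    using ip_res_res[OF f f] herm[OF f res_mem[OF f]] by metis
  also have "ip (res N f) f = ip f f - (\<Sum>j\<in>{1..<N}. ip f (e j) * ip (e j) f)"
  proof -
    have "ip (\<lambda>x. \<Sum>j\<in>{1..<N}. ip f (e j) * e j x) f = (\<Sum>j\<in>{1..<N}. ip f (e j) * ip (e j) f)"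
      using e_mem f by (intro sum_left) auto
    then show ?thesis using diff_left[OF f proj_mem[of "\<lambda>j. ip f (e j)" N] f] by (simp add: res_def)
  qed
  also have "(\<Sum>j\<in>{1..<N}. ip f (e j) * ip (e j) f) = of_real (\<Sum>j\<in>{1..<N}. (cmod (ip f (e j)))\<^sup>2)"
    unfolding of_real_sum
  proof (intro sum.cong refl)
    fix j assume "j \<in> {1..<N}"
    then have "ip (e j) f = cnj (ip f (e j))" using herm[OF e_mem f] by auto
    then show "ip f (e j) * ip (e j) f = of_real ((cmod (ip f (e j)))\<^sup>2)" by (simp only: complex_norm_square)
  qed
  finally show ?thesis by simp
qed

text \<open>\<open>res N\<close> removes the indices below \<open>N\<close>. Every eigenvalue
  strictly above \<open>lam N\<close> has such an index, also when \<open>lam N\<close> is a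
  multiple eigenvalue, so \<open>complement_l2_bound\<close> applies with
  \<open>b = lam N\<close>.\<close>

lemma q_res_le: "f \<in> H \<Longrightarrow> 1 \<le> N \<Longrightarrow> q (res N f) \<le> lam N * Re (ip f f)"
proof -
  assume f: "f \<in> H" and N: "1 \<le> N"
  have "q (res N f) \<le> lam N * Re (ip (res N f) (res N f))"
  proof (rule complement_l2_bound[where J = "{1..<N}"])
    show "j \<in> {1..<N}" if "1 \<le> j" "lam N < lam j" for j
      using lam_antimono[OF N, of j] that by (cases "N \<le> j") auto
  qed (use f N res_mem ip_res lam_pos[OF N] in auto)
  also have "\<dots> \<le> lam N * Re (ip f f)"
    using bessel_eq[OF f, of N] lam_pos[OF N] by (intro mult_left_mono) (simp_all add: sum_nonneg)
  finally show ?thesis .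
qed

text \<open>The diagonal of the reproducing kernel of the orthogonal complement of
  \<open>e 1, ..., e (N - 1)\<close>, that is, the squared norm of the point evaluation at
  \<open>x\<close> after \<open>res N\<close>.\<close>

definition rk :: "nat \<Rightarrow> 'x \<Rightarrow> real" where
  "rk N x = kk x - (\<Sum>j\<in>{1..<N}. (cmod (e j x))\<^sup>2)"

lemma ip_ks_e: "x \<in> D \<Longrightarrow> 1 \<le> j \<Longrightarrow> ip (ks x) (e j) = cnj (e j x)"
  using herm[OF ks_mem e_mem] repr[OF e_mem] by simp

lemma rk_eq: "x \<in> D \<Longrightarrow> rk N x = Re (ip (res N (ks x)) (res N (ks x)))"
  unfolding rk_def by (subst bessel_eq[OF ks_mem]) (auto simp: ip_ks ip_ks_e intro!: sum.cong)

lemma rk_nonneg: "x \<in> D \<Longrightarrow> 0 \<le> rk N x"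
  by (simp add: rk_eq nonneg res_mem ks_mem)

lemma rk_antimono: "N \<le> N' \<Longrightarrow> rk N' x \<le> rk N x"
  unfolding rk_def by (intro diff_left_mono sum_mono2) auto

lemma res_eval: "f \<in> H \<Longrightarrow> x \<in> D \<Longrightarrow> res N f x = ip f (res N (ks x))"
  using repr[OF res_mem] ip_res_sym[OF _ ks_mem] by simp

lemma res_eval_bound: "f \<in> H \<Longrightarrow> x \<in> D \<Longrightarrow> (cmod (res N f x))\<^sup>2 \<le> Re (ip f f) * rk N x"
  using cauchy_schwarz[of f "res N (ks x)"] by (simp add: res_eval rk_eq res_mem ks_mem)

lemma rk_integrable: "integrable M (rk N)"
  unfolding rk_def[abs_def] using K_int e_mem
  by (intro Bochner_Integration.integrable_diff Bochner_Integration.integrable_sum integrable_sq) auto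

lemma rk_integral: "(\<integral>x. rk N x \<partial>M) = tr - (\<Sum>j\<in>{1..<N}. lam j)"
proof -
  have "(\<integral>x. rk N x \<partial>M) = tr - (\<integral>x. (\<Sum>j\<in>{1..<N}. (cmod (e j x))\<^sup>2) \<partial>M)"
    unfolding rk_def using K_int integrable_sq[OF e_mem]
    by (intro Bochner_Integration.integral_diff Bochner_Integration.integrable_sum) auto
  also have "(\<integral>x. (\<Sum>j\<in>{1..<N}. (cmod (e j x))\<^sup>2) \<partial>M) = (\<Sum>j\<in>{1..<N}. \<integral>x. (cmod (e j x))\<^sup>2 \<partial>M)"
    using integrable_sq[OF e_mem] by (intro Bochner_Integration.integral_sum) auto
  also have "\<dots> = (\<Sum>j\<in>{1..<N}. lam j)"
    by (intro sum.cong refl) (metis atLeastLessThan_iff e_mem q_e q_eq)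
  finally show ?thesis .
qed

lemma sum_lam_le: "(\<Sum>j\<in>{1..<N}. lam j) \<le> tr"
proof -
  have "0 \<le> (\<integral>x. rk N x \<partial>M)" using rk_nonneg space_M by (intro integral_nonneg_AE AE_I2) auto
  then show ?thesis by (simp add: rk_integral)
qed

lemma summable_lam: "summable (\<lambda>j. lam (Suc j))"
proof (rule summableI_nonneg_bounded)
  fix N
  have "(\<Sum>j<N. lam (Suc j)) = (\<Sum>j\<in>{1..<Suc N}. lam j)"
    by (simp only: lessThan_atLeast0 One_nat_def sum.shift_bounds_Suc_ivl)
  then show "(\<Sum>j<N. lam (Suc j)) \<le> tr" using sum_lam_le[of "Suc N"] by (simp only:)
qed (use lam_pos in \<open>auto intro: less_imp_le\<close>)

lemma lam_tendsto_0: "lam \<longlonglongrightarrow> 0"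
  using summable_LIMSEQ_zero[OF summable_lam] by (rule LIMSEQ_imp_Suc)

text \<open>The residuals of a countable dense set tend to 0 in \<open>L\<^sub>2\<close>, hence almost everywhere along
  subsequences, and they control the residuals of all kernel sections.\<close>

lemma rk_tendsto_0: "AE x in M. (\<lambda>N. rk N x) \<longlonglongrightarrow> 0"
proof -
  obtain S where S: "countable S" "S \<subseteq> H" "\<And>f \<epsilon>. f \<in> H \<Longrightarrow> 0 < \<epsilon> \<Longrightarrow> \<exists>s\<in>S. sn (\<lambda>x. f x - s x) < \<epsilon>"
    using countable_dense by blast
  have sub: "\<exists>r :: nat \<Rightarrow> nat. strict_mono r \<and> (AE x in M. (\<lambda>n. (cmod (res (r n) s x))\<^sup>2) \<longlonglongrightarrow> 0)" if "s \<in> S" for s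
  proof (rule tendsto_L1_AE_subseq)
    have s: "s \<in> H" using that S by blast
    show "integrable M (\<lambda>x. (cmod (res n s x))\<^sup>2)" for n using integrable_sq[OF res_mem[OF s]] .
    have "(\<lambda>n. lam n * Re (ip s s)) \<longlonglongrightarrow> 0" using tendsto_mult_left_zero[OF lam_tendsto_0] .
    moreover have "\<forall>\<^sub>F n in sequentially. norm (\<integral>x. norm ((cmod (res n s x))\<^sup>2) \<partial>M) \<le> norm (lam n * Re (ip s s))"
      using eventually_ge_at_top[of 1]
    proof eventually_elim
      case (elim n)
      have "0 \<le> q (res n s)" using L2.nonneg res_mem s by blast
      then show ?case using q_res_le[OF s elim] q_eq[OF res_mem[OF s], of n] by simp
    qed
    ultimately show "(\<lambda>n. \<integral>x. norm ((cmod (res n s x))\<^sup>2) \<partial>M) \<longlonglongrightarrow> 0" by (rule Lim_transform_bound[rotated])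
  qed
  have "AE x in M. \<forall>s\<in>S. \<exists>r :: nat \<Rightarrow> nat. (\<lambda>n. (cmod (res (r n) s x))\<^sup>2) \<longlonglongrightarrow> 0"
    unfolding AE_ball_countable[OF S(1)]
  proof
    fix s assume "s \<in> S"
    from sub[OF this] obtain r :: "nat \<Rightarrow> nat" where "AE x in M. (\<lambda>n. (cmod (res (r n) s x))\<^sup>2) \<longlonglongrightarrow> 0" by blast
    then show "AE x in M. \<exists>r :: nat \<Rightarrow> nat. (\<lambda>n. (cmod (res (r n) s x))\<^sup>2) \<longlonglongrightarrow> 0" by (rule AE_mp) auto
  qed
  then show ?thesis
  proof (rule AE_mp, intro AE_I2 impI)
    fix x assume "x \<in> space M" and *: "\<forall>s\<in>S. \<exists>r :: nat \<Rightarrow> nat. (\<lambda>n. (cmod (res (r n) s x))\<^sup>2) \<longlonglongrightarrow> 0"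
    then have x: "x \<in> D" by (simp add: space_M)
    have dec: "decseq (\<lambda>N. rk N x)" using rk_antimono by (simp add: decseq_def)
    \<comment> \<open>By monotonicity the limit lies below all members, so it may be estimated along
      a subsequence that depends on the approximating \<open>s\<close>.\<close>
    obtain L where L: "(\<lambda>N. rk N x) \<longlonglongrightarrow> L" "\<And>N. L \<le> rk N x"
      using decseq_convergent[OF dec, of 0] rk_nonneg[OF x] by blast
    have "L \<le> \<epsilon> * sqrt (kk x)" if \<epsilon>: "0 < \<epsilon>" for \<epsilon>
    proof -
      obtain s where s: "s \<in> S" "sn (\<lambda>y. ks x y - s y) < \<epsilon>" using S(3)[OF ks_mem[OF x] \<epsilon>] by blast
      have sH: "s \<in> H" using s S by blast
      obtain r :: "nat \<Rightarrow> nat" where r: "(\<lambda>n. (cmod (res (r n) s x))\<^sup>2) \<longlonglongrightarrow> 0" using * s(1) by blast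
      have le: "L \<le> cmod (res (r n) s x) + \<epsilon> * sqrt (kk x)" for n
      proof -
        let ?R = "res (r n) (ks x)"
        have R: "?R \<in> H" using res_mem ks_mem[OF x] by blast
        have "L \<le> Re (ip ?R ?R)" using L(2)[of "r n"] rk_eq[OF x] by simp
        also have "ip ?R ?R = ip (ks x) ?R" using ip_res_res[OF ks_mem[OF x] ks_mem[OF x]] by simp
        also have "\<dots> = ip s ?R + ip (\<lambda>y. ks x y - s y) ?R"
          using diff_left[OF ks_mem[OF x] sH R] by simp
        also have "Re \<dots> \<le> cmod (ip s ?R) + cmod (ip (\<lambda>y. ks x y - s y) ?R)"
          using complex_Re_le_cmod[of "ip s ?R"] complex_Re_le_cmod[of "ip (\<lambda>y. ks x y - s y) ?R"] by simp
        also have "ip s ?R = res (r n) s x" using res_eval[OF sH x] by simp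
        also have "cmod (ip (\<lambda>y. ks x y - s y) ?R) \<le> sn (\<lambda>y. ks x y - s y) * sn ?R"
          using cauchy_schwarz_sn[OF diff_closed[OF ks_mem[OF x] sH] R] .
        also have "\<dots> \<le> \<epsilon> * sqrt (kk x)"
        proof (intro mult_mono)
          have "sn ?R = sqrt (rk (r n) x)" using rk_eq[OF x] by (simp add: sn_def)
          also have "\<dots> \<le> sqrt (kk x)" by (simp add: rk_def sum_nonneg)
          finally show "sn ?R \<le> sqrt (kk x)" .
        qed (use s(2) \<epsilon> sn_nonneg[OF R] in auto)
        finally show ?thesis by simp
      qed
      have "(\<lambda>n. cmod (res (r n) s x)) \<longlonglongrightarrow> 0" using tendsto_real_sqrt[OF r] by simp
      then have "(\<lambda>n. cmod (res (r n) s x) + \<epsilon> * sqrt (kk x)) \<longlonglongrightarrow> 0 + \<epsilon> * sqrt (kk x)"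
        by (intro tendsto_intros)
      then show ?thesis using LIMSEQ_le_const[of _ _ L] le by auto
    qed
    note L\<epsilon> = this
    have "L \<le> 0"
    proof (rule ccontr)
      assume "\<not> L \<le> 0"
      define y where "y = sqrt (kk x)"
      have y: "0 \<le> y" using kk_nonneg[OF x] by (simp add: y_def)
      \<comment> \<open>A value of \<epsilon> with \<epsilon> y < L; the added 1 covers
        \<open>y = 0\<close>.\<close>
      have "0 < L / (2 * (y + 1))" using \<open>\<not> L \<le> 0\<close> y by (intro divide_pos_pos) auto
      from L\<epsilon>[OF this] have "L \<le> L / (2 * (y + 1)) * y" by (simp only: y_def)
      then have "L * 2 + L * y \<le> 0" using y by (simp add: field_simps)
      moreover have "0 < L * 2" "0 \<le> L * y" using \<open>\<not> L \<le> 0\<close> y by auto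
      ultimately show False by linarith
    qed
    moreover have "0 \<le> L" using LIMSEQ_le_const[OF L(1)] rk_nonneg[OF x] by blast
    ultimately show "(\<lambda>N. rk N x) \<longlonglongrightarrow> 0" using L(1) by simp
  qed
qed

text \<open>The residual kernels tend to 0 with the diagonal of \<open>K\<close> as integrable
  majorant, so their integrals do too. This identifies a denominator of the sampling density with
  the tail sum of eigenvalues in the error bound.\<close>

lemma trace_tail: "1 \<le> m \<Longrightarrow> tr - (\<Sum>j\<in>{1..<m}. lam j) = (\<Sum>j. lam (m + j))"
  and summable_lam_shift: "1 \<le> m \<Longrightarrow> summable (\<lambda>j. lam (m + j))"
proof -
  assume m: "1 \<le> m"
  have "(\<lambda>N. \<integral>x. rk N x \<partial>M) \<longlonglongrightarrow> (\<integral>x. 0 \<partial>M)"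
  proof (rule integral_dominated_convergence[where w = kk])
    show "AE x in M. norm (rk N x) \<le> kk x" for N
    proof (intro AE_I2)
      fix x assume "x \<in> space M"
      then have "0 \<le> rk N x" "rk N x \<le> kk x" using rk_nonneg space_M by (auto simp: rk_def sum_nonneg)
      then show "norm (rk N x) \<le> kk x" by simp
    qed
  qed (use rk_integrable K_int rk_tendsto_0 in auto)
  then have "(\<lambda>N. tr - (\<Sum>j\<in>{1..<N + m}. lam j)) \<longlonglongrightarrow> 0"
    unfolding rk_integral by (intro LIMSEQ_ignore_initial_segment[where k = m]) simp
  then have "(\<lambda>N. tr - (\<Sum>j\<in>{1..<m}. lam j) - (tr - (\<Sum>j\<in>{1..<N + m}. lam j)))
      \<longlonglongrightarrow> tr - (\<Sum>j\<in>{1..<m}. lam j) - 0"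
    by (intro tendsto_diff tendsto_const)
  moreover have "tr - (\<Sum>j\<in>{1..<m}. lam j) - (tr - (\<Sum>j\<in>{1..<N + m}. lam j))
      = (\<Sum>j<N. lam (m + j))" for N
    using sum_shift_tail[OF m, of lam N] by simp
  ultimately have "(\<lambda>j. lam (m + j)) sums (tr - (\<Sum>j\<in>{1..<m}. lam j))"
    by (simp add: sums_def)
  then show "tr - (\<Sum>j\<in>{1..<m}. lam j) = (\<Sum>j. lam (m + j))" "summable (\<lambda>j. lam (m + j))"
    by (simp_all add: sums_iff)
qed

end

section \<open>Least squares matrices\<close>

lemma mat_adjoint_carrier: "A \<in> carrier_mat n d \<Longrightarrow> mat_adjoint A \<in> carrier_mat d n"
  unfolding mat_adjoint_def by (intro carrier_matI) auto

lemma mat_adjoint_index: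
  fixes A :: "complex mat"
  assumes "A \<in> carrier_mat n d" "k < d" "j < n"
  shows "mat_adjoint A $$ (k, j) = cnj (A $$ (j, k))"
  using assms unfolding mat_adjoint_def by (simp add: mat_of_rows_index)

lemma mult_mat_vec_index_sum:
  fixes A :: "complex mat"
  assumes "A \<in> carrier_mat n d" "v \<in> carrier_vec d" "j < n"
  shows "vec_index (A *\<^sub>v v) j = (\<Sum>k<d. A $$ (j, k) * vec_index v k)"
  using assms by (simp add: scalar_prod_def atLeast0LessThan)

lemma adjoint_mult_vec_index:
  fixes A :: "complex mat"
  assumes "A \<in> carrier_mat n d" "v \<in> carrier_vec n" "k < d"
  shows "vec_index (mat_adjoint A *\<^sub>v v) k = (\<Sum>j<n. cnj (A $$ (j, k)) * vec_index v j)"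
  using mult_mat_vec_index_sum[OF mat_adjoint_carrier[OF assms(1)] assms(2,3)] assms
  by (simp add: mat_adjoint_index)

text \<open>Pairing the equation with \<open>v\<close> gives the squared norm of
  \<open>A *\<^sub>v v\<close>.\<close>

lemma gram_kernel:
  fixes A :: "complex mat"
  assumes A: "A \<in> carrier_mat n d" and v: "v \<in> carrier_vec d"
    and 0: "(mat_adjoint A * A) *\<^sub>v v = 0\<^sub>v d"
  shows "A *\<^sub>v v = 0\<^sub>v n"
proof -
  have Av: "A *\<^sub>v v \<in> carrier_vec n" using A v by simp
  have "mat_adjoint A *\<^sub>v (A *\<^sub>v v) = 0\<^sub>v d"
    using 0 assoc_mult_mat_vec[OF mat_adjoint_carrier[OF A] A v] by simp
  then have "(\<Sum>k<d. cnj (vec_index v k) * vec_index (mat_adjoint A *\<^sub>v (A *\<^sub>v v)) k) = 0" by simp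
  moreover have "(\<Sum>k<d. cnj (vec_index v k) * vec_index (mat_adjoint A *\<^sub>v (A *\<^sub>v v)) k)
      = (\<Sum>k<d. \<Sum>j<n. cnj (vec_index v k) * (cnj (A $$ (j, k)) * vec_index (A *\<^sub>v v) j))"
    by (intro sum.cong refl) (simp add: adjoint_mult_vec_index[OF A Av] sum_distrib_left)
  moreover have "\<dots> = (\<Sum>j<n. \<Sum>k<d. cnj (vec_index v k) * (cnj (A $$ (j, k)) * vec_index (A *\<^sub>v v) j))"
    by (rule sum.swap)
  moreover have "\<dots> = (\<Sum>j<n. of_real ((cmod (vec_index (A *\<^sub>v v) j))\<^sup>2))"
  proof (intro sum.cong refl)
    fix j assume "j \<in> {..<n}"
    then have j: "j < n" by simp
    have "(\<Sum>k<d. cnj (vec_index v k) * (cnj (A $$ (j, k)) * vec_index (A *\<^sub>v v) j))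
        = vec_index (A *\<^sub>v v) j * cnj (\<Sum>k<d. A $$ (j, k) * vec_index v k)"
      by (simp add: sum_distrib_left ac_simps)
    also have "\<dots> = of_real ((cmod (vec_index (A *\<^sub>v v) j))\<^sup>2)"
      unfolding mult_mat_vec_index_sum[OF A v j, symmetric] by (simp only: complex_norm_square)
    finally show "(\<Sum>k<d. cnj (vec_index v k) * (cnj (A $$ (j, k)) * vec_index (A *\<^sub>v v) j))
        = of_real ((cmod (vec_index (A *\<^sub>v v) j))\<^sup>2)" .
  qed
  ultimately have "complex_of_real (\<Sum>j<n. (cmod (vec_index (A *\<^sub>v v) j))\<^sup>2) = 0" by simp
  then have "(\<Sum>j<n. (cmod (vec_index (A *\<^sub>v v) j))\<^sup>2) = 0" using of_real_eq_0_iff by blast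
  then have "\<forall>j<n. vec_index (A *\<^sub>v v) j = 0" by (simp add: sum_nonneg_eq_0_iff)
  then show ?thesis using A by (intro eq_vecI) auto
qed

lemma det_gram_iff:
  fixes A :: "complex mat"
  assumes A: "A \<in> carrier_mat n d"
  shows "det (mat_adjoint A * A) \<noteq> 0 \<longleftrightarrow> (\<forall>v\<in>carrier_vec d. A *\<^sub>v v = 0\<^sub>v n \<longrightarrow> v = 0\<^sub>v d)"
proof -
  have B: "mat_adjoint A * A \<in> carrier_mat d d" using mat_adjoint_carrier[OF A] A by simp
  have "(mat_adjoint A * A) *\<^sub>v v = 0\<^sub>v d \<longleftrightarrow> A *\<^sub>v v = 0\<^sub>v n" if v: "v \<in> carrier_vec d" for v
  proof
    assume "A *\<^sub>v v = 0\<^sub>v n"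
    then show "(mat_adjoint A * A) *\<^sub>v v = 0\<^sub>v d"
      using assoc_mult_mat_vec[OF mat_adjoint_carrier[OF A] A v] mat_adjoint_carrier[OF A] by auto
  qed (rule gram_kernel[OF A v])
  then show ?thesis using det_0_iff_vec_prod_zero_field[OF B] by auto
qed

lemma full_column_rank_iff:
  fixes A :: "complex mat"
  assumes A: "A \<in> carrier_mat n d"
  shows "vec_space.rank n A = d \<longleftrightarrow> (\<forall>v\<in>carrier_vec d. A *\<^sub>v v = 0\<^sub>v n \<longrightarrow> v = 0\<^sub>v d)"
proof -
  interpret vec_space "TYPE(complex)" n .
  show ?thesis
  proof
    assume r: "rank A = d"
    \<comment> \<open>Linear independence here is that of the set of columns. A repeated column
      would leave fewer than \<open>d\<close> elements in this set and so a rank below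
      \<open>d\<close>.\<close>
    have "distinct (cols A)"
    proof (rule ccontr)
      assume nd: "\<not> distinct (cols A)"
      obtain S where S: "maximal S (\<lambda>T. T \<subseteq> set (cols A) \<and> lin_indpt T)"
        using maximal_exists[of "(\<lambda>T. T \<subseteq> set (cols A) \<and> lin_indpt T)" "card (set (cols A))" "{}"]
        by (meson List.finite_set card_mono empty_iff empty_subsetI finite_lin_indpt2 rev_finite_subset)
      then have "card S \<le> card (set (cols A))" by (simp add: card_mono maximal_def)
      also have "\<dots> < length (cols A)"
        using nd card_distinct card_length le_neq_implies_less by blast
      finally show False using rank_card_indpt[OF A S] r A by simp
    qed
    then show "\<forall>v\<in>carrier_vec d. A *\<^sub>v v = 0\<^sub>v n \<longrightarrow> v = 0\<^sub>v d"
      using full_rank_lin_indpt[OF A r] lin_depI[OF A] by blast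
  next
    assume ker: "\<forall>v\<in>carrier_vec d. A *\<^sub>v v = 0\<^sub>v n \<longrightarrow> v = 0\<^sub>v d"
    have dist: "distinct (cols A)"
    proof (subst distinct_conv_nth, intro allI impI)
      fix i j assume ij: "i < length (cols A)" "j < length (cols A)" "i \<noteq> j"
      then have ij': "i < d" "j < d" using A by auto
      show "cols A ! i \<noteq> cols A ! j"
      proof
        assume eq: "cols A ! i = cols A ! j"
        then have c: "col A i = col A j" using ij by simp
        let ?v = "unit_vec d i - unit_vec d j :: complex vec"
        have "A *\<^sub>v ?v = A *\<^sub>v unit_vec d i - A *\<^sub>v unit_vec d j"
          using A by (intro mult_minus_distrib_mat_vec) auto
        also have "\<dots> = 0\<^sub>v n"
        proof -
          have "A *\<^sub>v unit_vec d k = col A k" if "k < d" for k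
            using A that by (intro eq_vecI) auto
          then show ?thesis using A ij' c by (auto intro!: eq_vecI)
        qed
        finally have "?v = 0\<^sub>v d" using ker by auto
        then have "vec_index ?v i = vec_index (0\<^sub>v d :: complex vec) i" by simp
        then show False using ij(3) ij' by simp
      qed
    qed
    have "lin_indpt (set (cols A))"
    proof
      assume "lin_dep (set (cols A))"
      then show False using lin_depE[OF A _ dist] ker by blast
    qed
    then show "rank A = d" using lin_indpt_full_rank[OF A dist] by blast
  qed
qed

text \<open>\<open>mat_inverse\<close> is an elimination procedure with case distinctions. The
  adjugate formula makes the entries of the inverse rational, hence visibly measurable, functions of
  the entries of the matrix.\<close>

lemma mat_inverse_eq_adj:
  fixes B :: "complex mat"
  assumes B: "B \<in> carrier_mat d d" and "det B \<noteq> 0"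
  shows "the (mat_inverse B) = (1 / det B) \<cdot>\<^sub>m adj_mat B"
proof -
  have "mat_inverse B \<noteq> None"
    using mat_inverse(1)[OF B, of "()"] det_non_zero_imp_unit[OF B assms(2), of "()"] by blast
  then obtain C where C: "mat_inverse B = Some C" by blast
  have C': "B * C = 1\<^sub>m d" "C * B = 1\<^sub>m d" "C \<in> carrier_mat d d" using mat_inverse(2)[OF B C] by auto
  let ?D = "(1 / det B) \<cdot>\<^sub>m adj_mat B"
  have D: "?D \<in> carrier_mat d d" using adj_mat(1)[OF B] by simp
  have "B * ?D = (1 / det B) \<cdot>\<^sub>m (B * adj_mat B)" using B adj_mat(1)[OF B] by (simp add: mult_smult_distrib)
  also have "\<dots> = (1 / det B * det B) \<cdot>\<^sub>m 1\<^sub>m d" unfolding adj_mat(2)[OF B] by auto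
  also have "\<dots> = 1\<^sub>m d" using assms(2) by auto
  finally have BD: "B * ?D = 1\<^sub>m d" .
  have "C = C * (B * ?D)" using BD C'(3) by simp
  also have "\<dots> = C * B * ?D" by (rule assoc_mult_mat[symmetric, OF C'(3) B D])
  also have "\<dots> = ?D" unfolding C'(2) using D by (simp add: left_mult_one_mat)
  finally show ?thesis using C by simp
qed

section \<open>Measurability of determinants and adjugates\<close>

lemma det_measurable:
  fixes A :: "'w \<Rightarrow> complex mat"
  assumes "\<And>\<omega>. A \<omega> \<in> carrier_mat d d"
    and "\<And>i j. i < d \<Longrightarrow> j < d \<Longrightarrow> (\<lambda>\<omega>. A \<omega> $$ (i, j)) \<in> borel_measurable P"
  shows "(\<lambda>\<omega>. det (A \<omega>)) \<in> borel_measurable P"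
  unfolding det_def'[OF assms(1)]
  by (intro borel_measurable_sum borel_measurable_times borel_measurable_const borel_measurable_prod assms(2))
     (auto simp: permutes_in_image)

lemma adj_mat_measurable:
  fixes A :: "'w \<Rightarrow> complex mat"
  assumes A: "\<And>\<omega>. A \<omega> \<in> carrier_mat d d"
    and m: "\<And>i j. i < d \<Longrightarrow> j < d \<Longrightarrow> (\<lambda>\<omega>. A \<omega> $$ (i, j)) \<in> borel_measurable P"
    and ij: "i < d" "j < d"
  shows "(\<lambda>\<omega>. adj_mat (A \<omega>) $$ (i, j)) \<in> borel_measurable P"
proof -
  have "adj_mat (A \<omega>) $$ (i, j) = (-1) ^ (j + i) * det (mat_delete (A \<omega>) j i)" for \<omega>
    using A[of \<omega>] ij by (simp add: adj_mat_def cofactor_def)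
  moreover have "(\<lambda>\<omega>. det (mat_delete (A \<omega>) j i)) \<in> borel_measurable P"
  proof (rule det_measurable[where d = "d - 1"])
    show "mat_delete (A \<omega>) j i \<in> carrier_mat (d - 1) (d - 1)" for \<omega>
      using mat_delete_carrier[OF A] .
    fix a b assume ab: "a < d - 1" "b < d - 1"
    have "mat_delete (A \<omega>) j i $$ (a, b) = A \<omega> $$ (if a < j then a else Suc a, if b < i then b else Suc b)" for \<omega>
      using A[of \<omega>] ab by (simp add: mat_delete_def)
    then show "(\<lambda>\<omega>. mat_delete (A \<omega>) j i $$ (a, b)) \<in> borel_measurable P"
      using m ab by auto
  qed
  ultimately show ?thesis by simp
qed

text \<open>Common form of the entries of \<open>wls_matrix\<close> and \<open>wls_data\<close>,
  with the same value 0 where the density vanishes.\<close>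

definition weighted :: "('x \<Rightarrow> real) \<Rightarrow> ('x \<Rightarrow> complex) \<Rightarrow> 'x \<Rightarrow> complex" where
  "weighted rho f x = (if rho x \<noteq> 0 then f x / of_real (sqrt (rho x)) else 0)"

section \<open>Normal equations, measurability and stability of the coefficients\<close>

context
  fixes rho :: "'x \<Rightarrow> real" and b :: "nat \<Rightarrow> 'x \<Rightarrow> complex" and m n :: nat
begin

abbreviation "Lm X \<equiv> wls_matrix rho b m n X"
abbreviation "Gm X \<equiv> mat_adjoint (Lm X) * Lm X"

lemma wls_matrix_carrier: "Lm X \<in> carrier_mat n (m - 1)"
  by (simp add: wls_matrix_def)

lemma wls_matrix_index: "j < n \<Longrightarrow> k < m - 1 \<Longrightarrow> Lm X $$ (j, k) = weighted rho (b (Suc k)) (X (Suc j))"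
  by (simp add: wls_matrix_def weighted_def)

lemma wls_data_index: "j < n \<Longrightarrow> vec_index (wls_data rho n X f) j = weighted rho f (X (Suc j))"
  by (simp add: wls_data_def weighted_def)

lemma wls_data_carrier: "wls_data rho n X f \<in> carrier_vec n"
  by (simp add: wls_data_def)

lemma gram_carrier: "Gm X \<in> carrier_mat (m - 1) (m - 1)"
  using mat_adjoint_carrier[OF wls_matrix_carrier] wls_matrix_carrier by (metis mult_carrier_mat)

lemma wls_defined_iff_det: "wls_defined rho b m n X \<longleftrightarrow> det (Gm X) \<noteq> 0"
  unfolding wls_defined_def full_column_rank_iff[OF wls_matrix_carrier] det_gram_iff[OF wls_matrix_carrier] ..

lemma wls_definedI:
  assumes "\<And>a. (\<forall>j<n. (\<Sum>k<m-1. weighted rho (b (Suc k)) (X (Suc j)) * a k) = 0) \<Longrightarrow> \<forall>k<m-1. a k = 0"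
  shows "wls_defined rho b m n X"
  unfolding wls_defined_def full_column_rank_iff[OF wls_matrix_carrier]
proof (intro ballI impI)
  fix v :: "complex vec" assume v: "v \<in> carrier_vec (m - 1)" "Lm X *\<^sub>v v = 0\<^sub>v n"
  have "(\<Sum>k<m-1. weighted rho (b (Suc k)) (X (Suc j)) * vec_index v k) = 0" if j: "j < n" for j
  proof -
    have "vec_index (Lm X *\<^sub>v v) j = (\<Sum>k<m-1. Lm X $$ (j, k) * vec_index v k)"
      by (rule mult_mat_vec_index_sum[OF wls_matrix_carrier v(1) j])
    then show ?thesis using v(2) j by (simp add: wls_matrix_index)
  qed
  then have "\<forall>k<m-1. vec_index v k = 0" using assms by blast
  then show "v = 0\<^sub>v (m - 1)" using v(1) by (intro eq_vecI) auto
qed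

lemma wls_coeffs_carrier:
  assumes "wls_defined rho b m n X"
  shows "wls_coeffs rho b m n X f \<in> carrier_vec (m - 1)"
proof -
  have "the (mat_inverse (Gm X)) \<in> carrier_mat (m - 1) (m - 1)"
    using mat_inverse_eq_adj[OF gram_carrier] adj_mat(1)[OF gram_carrier] assms wls_defined_iff_det by simp
  then show ?thesis
    unfolding wls_coeffs_def Let_def using mat_adjoint_carrier[OF wls_matrix_carrier] wls_data_carrier
    by (meson mult_carrier_mat mult_mat_vec_carrier)
qed

lemma wls_coeffs_eq:
  assumes "wls_defined rho b m n X"
  shows "wls_coeffs rho b m n X f
    = ((1 / det (Gm X)) \<cdot>\<^sub>m adj_mat (Gm X)) *\<^sub>v (mat_adjoint (Lm X) *\<^sub>v wls_data rho n X f)"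
proof -
  have "the (mat_inverse (Gm X)) = (1 / det (Gm X)) \<cdot>\<^sub>m adj_mat (Gm X)"
    using mat_inverse_eq_adj[OF gram_carrier] assms wls_defined_iff_det by blast
  moreover have "(1 / det (Gm X)) \<cdot>\<^sub>m adj_mat (Gm X) \<in> carrier_mat (m - 1) (m - 1)"
    using adj_mat(1)[OF gram_carrier] by simp
  ultimately show ?thesis
    unfolding wls_coeffs_def Let_def
    using assoc_mult_mat_vec[OF _ mat_adjoint_carrier[OF wls_matrix_carrier] wls_data_carrier] by metis
qed

lemma wls_coeffs_index:
  assumes "wls_defined rho b m n X" "k < m - 1"
  shows "vec_index (wls_coeffs rho b m n X f) k
    = (\<Sum>l<m-1. 1 / det (Gm X) * adj_mat (Gm X) $$ (k, l)
        * (\<Sum>j<n. cnj (weighted rho (b (Suc l)) (X (Suc j))) * weighted rho f (X (Suc j))))"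
proof -
  have A: "(1 / det (Gm X)) \<cdot>\<^sub>m adj_mat (Gm X) \<in> carrier_mat (m - 1) (m - 1)"
    using adj_mat(1)[OF gram_carrier] by simp
  have v: "mat_adjoint (Lm X) *\<^sub>v wls_data rho n X f \<in> carrier_vec (m - 1)"
    using mat_adjoint_carrier[OF wls_matrix_carrier] wls_data_carrier by (meson mult_mat_vec_carrier)
  have "vec_index (mat_adjoint (Lm X) *\<^sub>v wls_data rho n X f) l
      = (\<Sum>j<n. cnj (weighted rho (b (Suc l)) (X (Suc j))) * weighted rho f (X (Suc j)))" if "l < m - 1" for l
    unfolding adjoint_mult_vec_index[OF wls_matrix_carrier wls_data_carrier that]
    using that by (simp add: wls_matrix_index wls_data_index)
  then show ?thesis
    unfolding wls_coeffs_eq[OF assms(1)] mult_mat_vec_index_sum[OF A v assms(2)]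
    using adj_mat(1)[OF gram_carrier, of X] assms(2) by (intro sum.cong refl) simp
qed

lemma wls_normal_equations:
  fixes f :: "'x \<Rightarrow> complex"
  assumes "wls_defined rho b m n X" "k < m - 1"
  defines "c \<equiv> wls_coeffs rho b m n X f"
  shows "(\<Sum>j<n. cnj (weighted rho (b (Suc k)) (X (Suc j))) * (\<Sum>l<m-1. weighted rho (b (Suc l)) (X (Suc j)) * vec_index c l))
    = (\<Sum>j<n. cnj (weighted rho (b (Suc k)) (X (Suc j))) * weighted rho f (X (Suc j)))"
proof -
  let ?G = "Gm X" and ?L = "Lm X" and ?y = "mat_adjoint (Lm X) *\<^sub>v wls_data rho n X f"
  let ?I = "(1 / det ?G) \<cdot>\<^sub>m adj_mat ?G"
  have d: "det ?G \<noteq> 0" using assms(1) wls_defined_iff_det by blast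
  have c: "c \<in> carrier_vec (m - 1)" using wls_coeffs_carrier[OF assms(1)] by (simp add: c_def)
  have I: "?I \<in> carrier_mat (m - 1) (m - 1)" using adj_mat(1)[OF gram_carrier] by simp
  have y: "?y \<in> carrier_vec (m - 1)"
    using mat_adjoint_carrier[OF wls_matrix_carrier] wls_data_carrier by (meson mult_mat_vec_carrier)
  have "?G * ?I = (1 / det ?G) \<cdot>\<^sub>m (?G * adj_mat ?G)"
    using gram_carrier adj_mat(1)[OF gram_carrier] by (rule mult_smult_distrib)
  also have "\<dots> = 1\<^sub>m (m - 1)" unfolding adj_mat(2)[OF gram_carrier] using d by auto
  finally have GI: "?G * ?I = 1\<^sub>m (m - 1)" .
  have "?G *\<^sub>v c = (?G * ?I) *\<^sub>v ?y"
    unfolding c_def wls_coeffs_eq[OF assms(1)] by (rule assoc_mult_mat_vec[OF gram_carrier I y, symmetric])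
  also have "\<dots> = ?y" unfolding GI using y by simp
  finally have "mat_adjoint ?L *\<^sub>v (?L *\<^sub>v c) = ?y"
    using assoc_mult_mat_vec[OF mat_adjoint_carrier[OF wls_matrix_carrier] wls_matrix_carrier c] by metis
  then have "vec_index (mat_adjoint ?L *\<^sub>v (?L *\<^sub>v c)) k = vec_index ?y k" by simp
  moreover have "vec_index (mat_adjoint ?L *\<^sub>v (?L *\<^sub>v c)) k
      = (\<Sum>j<n. cnj (weighted rho (b (Suc k)) (X (Suc j))) * (\<Sum>l<m-1. weighted rho (b (Suc l)) (X (Suc j)) * vec_index c l))"
  proof -
    have "?L *\<^sub>v c \<in> carrier_vec n" using wls_matrix_carrier c by (rule mult_mat_vec_carrier)
    from adjoint_mult_vec_index[OF wls_matrix_carrier this assms(2)] show ?thesis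
      using assms(2) by (simp add: wls_matrix_index mult_mat_vec_index_sum[OF wls_matrix_carrier c])
  qed
  moreover have "vec_index ?y k = (\<Sum>j<n. cnj (weighted rho (b (Suc k)) (X (Suc j))) * weighted rho f (X (Suc j)))"
    unfolding adjoint_mult_vec_index[OF wls_matrix_carrier wls_data_carrier assms(2)]
    using assms(2) by (simp add: wls_matrix_index wls_data_index)
  ultimately show ?thesis by simp
qed

lemma gram_index_measurable:
  assumes "\<And>j k. j < n \<Longrightarrow> k < m - 1 \<Longrightarrow> (\<lambda>\<omega>. weighted rho (b (Suc k)) (Y \<omega> (Suc j))) \<in> borel_measurable P"
    and "k < m - 1" "l < m - 1"
  shows "(\<lambda>\<omega>. Gm (Y \<omega>) $$ (k, l)) \<in> borel_measurable P"
proof -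
  have cnjm: "cnj \<in> borel_measurable borel"
    by (intro borel_measurable_continuous_onI continuous_intros)
  have "Gm X $$ (k, l) = (\<Sum>j<n. cnj (weighted rho (b (Suc k)) (X (Suc j))) * weighted rho (b (Suc l)) (X (Suc j)))" for X
  proof -
    have "Gm X $$ (k, l) = (\<Sum>j<n. mat_adjoint (Lm X) $$ (k, j) * Lm X $$ (j, l))"
      using mat_adjoint_carrier[OF wls_matrix_carrier, of X] wls_matrix_carrier[of X] assms(2,3)
      by (simp add: scalar_prod_def atLeast0LessThan)
    then show ?thesis
      using assms(2,3) by (simp add: mat_adjoint_index[OF wls_matrix_carrier] wls_matrix_index)
  qed
  then show ?thesis
    using assms by (auto intro!: borel_measurable_sum borel_measurable_times measurable_compose[OF _ cnjm])
qed

text \<open>This concerns the explicit formula with which \<open>wls_coeffs\<close> agrees wherever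
  the operator is defined. The formula is measurable on the whole space, the quotient being 0 for a
  singular Gram matrix.\<close>

lemma wls_coeffs_measurable:
  assumes w: "\<And>j k. j < n \<Longrightarrow> k < m - 1 \<Longrightarrow> (\<lambda>\<omega>. weighted rho (b (Suc k)) (Y \<omega> (Suc j))) \<in> borel_measurable P"
    and f: "\<And>j. j < n \<Longrightarrow> (\<lambda>\<omega>. weighted rho f (Y \<omega> (Suc j))) \<in> borel_measurable P"
    and k: "k < m - 1"
  shows "(\<lambda>\<omega>. \<Sum>l<m-1. 1 / det (Gm (Y \<omega>)) * adj_mat (Gm (Y \<omega>)) $$ (k, l)
        * (\<Sum>j<n. cnj (weighted rho (b (Suc l)) (Y \<omega> (Suc j))) * weighted rho f (Y \<omega> (Suc j)))) \<in> borel_measurable P"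
proof -
  have cnjm: "cnj \<in> borel_measurable borel"
    by (intro borel_measurable_continuous_onI continuous_intros)
  show ?thesis
    using k w f
    by (intro borel_measurable_sum borel_measurable_times borel_measurable_divide borel_measurable_const
        det_measurable[where d = "m - 1"] adj_mat_measurable[where d = "m - 1"] gram_carrier gram_index_measurable
        measurable_compose[OF _ cnjm]) auto
qed

lemma wls_defined_measurable:
  assumes w: "\<And>j k. j < n \<Longrightarrow> k < m - 1 \<Longrightarrow> (\<lambda>\<omega>. weighted rho (b (Suc k)) (Y \<omega> (Suc j))) \<in> borel_measurable P"
  shows "{\<omega> \<in> space P. wls_defined rho b m n (Y \<omega>)} \<in> sets P"
proof -
  have [measurable]: "(\<lambda>\<omega>. det (Gm (Y \<omega>))) \<in> borel_measurable P"
    by (intro det_measurable[where d = "m - 1"] gram_carrier gram_index_measurable w)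
  show ?thesis unfolding wls_defined_iff_det by measurable
qed

text \<open>Subtracting \<open>a\<close> from the coefficients leaves the normal equations with data
  from \<open>g\<close>. Their solution makes \<open>u\<close> the orthogonal projection of
  \<open>y\<close> onto the column space, so \<open>u\<close> is no longer than \<open>y\<close>,
  while the hypothesis bounds \<open>u\<close> from below by the coefficients.\<close>

lemma wls_coeffs_stable:
  assumes def: "wls_defined rho b m n X"
    and low: "\<And>z. t * (\<Sum>k<m-1. (cmod (z k))\<^sup>2)
        \<le> (\<Sum>j<n. (cmod (\<Sum>k<m-1. weighted rho (b (Suc k)) (X (Suc j)) * z k))\<^sup>2)"
    and f: "\<And>j. j < n \<Longrightarrow> weighted rho f (X (Suc j))
        = (\<Sum>k<m-1. weighted rho (b (Suc k)) (X (Suc j)) * a k) + weighted rho g (X (Suc j))"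
  shows "t * (\<Sum>k<m-1. (cmod (vec_index (wls_coeffs rho b m n X f) k - a k))\<^sup>2)
    \<le> (\<Sum>j<n. (cmod (weighted rho g (X (Suc j))))\<^sup>2)"
proof -
  define w where "w j k = weighted rho (b (Suc k)) (X (Suc j))" for j k
  define y where "y j = weighted rho g (X (Suc j))" for j
  define \<delta> where "\<delta> k = vec_index (wls_coeffs rho b m n X f) k - a k" for k
  define u where "u j = (\<Sum>k<m-1. w j k * \<delta> k)" for j
  have ne: "(\<Sum>j<n. cnj (w j k) * u j) = (\<Sum>j<n. cnj (w j k) * y j)" if k: "k < m - 1" for k
  proof -
    have "(\<Sum>j<n. cnj (w j k) * (\<Sum>l<m-1. w j l * vec_index (wls_coeffs rho b m n X f) l))
        = (\<Sum>j<n. cnj (w j k) * weighted rho f (X (Suc j)))"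
      using wls_normal_equations[OF def k] by (simp add: w_def)
    also have "\<dots> = (\<Sum>j<n. cnj (w j k) * ((\<Sum>l<m-1. w j l * a l) + y j))"
      by (intro sum.cong refl) (simp add: f w_def y_def)
    finally show ?thesis
      by (simp add: u_def \<delta>_def algebra_simps sum_subtractf sum.distrib)
  qed
  \<comment> \<open>\<open>u\<close> is a combination of the columns, and by \<open>ne\<close> the
    difference of \<open>u\<close> and \<open>y\<close> is orthogonal to every column.\<close>
  have uu: "dotc n u u = dotc n y u"
  proof -
    have cu: "cnj (u j) = (\<Sum>k<m-1. cnj (\<delta> k) * cnj (w j k))" for j by (simp add: u_def mult.commute)
    have "dotc n v u = (\<Sum>k<m-1. cnj (\<delta> k) * (\<Sum>j<n. cnj (w j k) * v j))" for v
      unfolding dotc_def cu sum_distrib_left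
      by (subst sum.swap) (simp add: ac_simps)
    then show ?thesis using ne by simp
  qed
  have "(\<Sum>j<n. (cmod (u j))\<^sup>2) \<le> (\<Sum>j<n. (cmod (y j))\<^sup>2)"
  proof -
    let ?U = "\<Sum>j<n. (cmod (u j))\<^sup>2"
    have "?U\<^sup>2 = (cmod (dotc n y u))\<^sup>2"
      by (simp add: uu[symmetric] dotc_self del: of_real_sum)
    also have "\<dots> \<le> (\<Sum>j<n. (cmod (y j))\<^sup>2) * ?U" by (rule dotc_cauchy_schwarz)
    finally have "?U * ?U \<le> (\<Sum>j<n. (cmod (y j))\<^sup>2) * ?U" by (simp add: power2_eq_square)
    moreover have "0 \<le> ?U" "0 \<le> (\<Sum>j<n. (cmod (y j))\<^sup>2)" by (simp_all add: sum_nonneg)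
    ultimately show ?thesis by (cases "?U = 0") (auto simp: mult_le_cancel_right)
  qed
  moreover have "t * (\<Sum>k<m-1. (cmod (\<delta> k))\<^sup>2) \<le> (\<Sum>j<n. (cmod (u j))\<^sup>2)"
    using low[of \<delta>] by (simp add: u_def w_def)
  ultimately show ?thesis by (simp add: \<delta>_def y_def)
qed

end

section \<open>Sampling from the density\<close>

lemma weighted_measurable:
  assumes "f \<in> borel_measurable N" "rho \<in> borel_measurable N"
  shows "weighted rho f \<in> borel_measurable N"
proof -
  note [measurable] = assms
  show ?thesis unfolding weighted_def[abs_def] by measurable
qed

locale wls_sampling = rkhs_eigen D M K H ip lam e + prob_space P
  for D :: "'x set" and M K H ip lam e and P :: "'w measure" +
  fixes X :: "nat \<Rightarrow> 'w \<Rightarrow> 'x" and m n :: nat and rho :: "'x \<Rightarrow> real"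
  assumes m: "2 \<le> m" and n: "0 < n"
    and rho: "rho = sampling_density M K lam e m"
    and indep: "indep_vars (\<lambda>_. M) X {1..n}"
    and distr: "i \<in> {1..n} \<Longrightarrow> distributed P M (X i) (\<lambda>x. ennreal (rho x))"
begin

abbreviation "\<eta> \<equiv> eta lam e"

definition T :: real where "T = (\<Sum>j. lam (m + j))"

lemma lam_nonneg: "1 \<le> j \<Longrightarrow> 0 \<le> lam j"
  using lam_pos less_imp_le by blast

lemma T_pos: "0 < T"
  unfolding T_def using m lam_pos by (intro suminf_pos summable_lam_shift) auto

text \<open>By \<open>trace_tail\<close> the denominator of the second part of the density is
  \<open>T\<close>, which is positive.\<close>

lemma rho_eq: "rho x = 1/2 * (1 / (real m - 1) * (\<Sum>j\<in>{1..<m}. (cmod (\<eta> j x))\<^sup>2) + rk m x / T)"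
proof -
  have "{1..m-1} = {1..<m}" using m by auto
  then show ?thesis
    using trace_tail[of m] m unfolding rho sampling_density_def rk_def T_def by simp
qed

lemma \<eta>_eq: "\<eta> j = (\<lambda>x. of_real (1 / sing lam j) * e j x)"
  by (simp add: eta_def fun_eq_iff)

lemma \<eta>_mem: "1 \<le> j \<Longrightarrow> \<eta> j \<in> H"
  unfolding \<eta>_eq by (intro scale_closed e_mem)

lemma sing_pos: "1 \<le> j \<Longrightarrow> 0 < sing lam j"
  using lam_pos by (simp add: sing_def)

lemma sing_sq: "1 \<le> j \<Longrightarrow> (sing lam j)\<^sup>2 = lam j"
  using lam_nonneg by (simp add: sing_def)

lemma l2_\<eta>:
  assumes "1 \<le> j" "f \<in> H"
  shows "l2_inner M f (\<eta> j) = of_real (sing lam j) * ip f (e j)"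
proof -
  have "l2_inner M f (\<eta> j) = of_real (1 / sing lam j) * (of_real (lam j) * ip f (e j))"
    unfolding \<eta>_eq using L2.scale_right[OF e_mem[OF assms(1)] assms(2), of "of_real (1 / sing lam j)"]
      l2_e[OF assms] by simp
  also have "\<dots> = of_real (sing lam j) * ip f (e j)"
    using sing_pos[OF assms(1)] sing_sq[OF assms(1), symmetric] by (simp add: power2_eq_square)
  finally show ?thesis .
qed

lemma l2_\<eta>_\<eta>: "1 \<le> i \<Longrightarrow> 1 \<le> j \<Longrightarrow> l2_inner M (\<eta> i) (\<eta> j) = (if i = j then 1 else 0)"
proof -
  assume i: "1 \<le> i" and j: "1 \<le> j"
  have "l2_inner M (\<eta> i) (\<eta> j) = of_real (sing lam j) * ip (\<eta> i) (e j)" using l2_\<eta> i j \<eta>_mem by blast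
  also have "ip (\<eta> i) (e j) = of_real (1 / sing lam i) * (if i = j then 1 else 0)"
    unfolding \<eta>_eq scale_left[OF e_mem[OF i] e_mem[OF j]] ip_e[OF i j] by (rule refl)
  finally show ?thesis using sing_pos[OF i] sing_pos[OF j] by (cases "i = j") auto
qed

lemma meas: "f \<in> H \<Longrightarrow> f \<in> borel_measurable M"
  using H_meas by blast

lemma rho_meas: "rho \<in> borel_measurable M"
proof -
  have [measurable]: "\<And>j. j \<in> {1..<m} \<Longrightarrow> \<eta> j \<in> borel_measurable M" using \<eta>_mem meas by auto
  have [measurable]: "rk m \<in> borel_measurable M" using rk_integrable by blast
  have "rho = (\<lambda>x. 1/2 * (1 / (real m - 1) * (\<Sum>j\<in>{1..<m}. (cmod (\<eta> j x))\<^sup>2) + rk m x / T))"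
    using rho_eq by blast
  then show ?thesis by simp
qed

lemma rho_nonneg: "x \<in> D \<Longrightarrow> 0 \<le> rho x"
  unfolding rho_eq using m rk_nonneg T_pos by (intro mult_nonneg_nonneg add_nonneg_nonneg sum_nonneg divide_nonneg_pos) auto

text \<open>Each half of the density is at most \<open>rho\<close>, and each controls one family:
  the first the \<eta> j with \<open>j < m\<close>, the second the residual kernel and through it
  the \<open>e j\<close> with \<open>j \<ge> m\<close>. This is the purpose of the mixture.\<close>

lemma sum_\<eta>_le: "x \<in> D \<Longrightarrow> (\<Sum>j\<in>{1..<m}. (cmod (\<eta> j x))\<^sup>2) \<le> 2 * (real m - 1) * rho x"
  and rk_le: "x \<in> D \<Longrightarrow> rk m x \<le> 2 * T * rho x"
proof -
  assume x: "x \<in> D"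
  define a where "a = (\<Sum>j\<in>{1..<m}. (cmod (\<eta> j x))\<^sup>2)"
  define M1 where "M1 = real m - 1"
  have p: "0 < M1" "0 < T" "0 \<le> rk m x" "0 \<le> a"
    using m T_pos rk_nonneg[OF x] by (auto simp: a_def M1_def sum_nonneg)
  have r: "2 * rho x = a / M1 + rk m x / T" unfolding rho_eq a_def[symmetric] M1_def[symmetric] by (simp add: mult.commute)
  have "a / M1 \<le> 2 * rho x" "rk m x / T \<le> 2 * rho x" unfolding r using p by simp_all
  then have "a \<le> 2 * M1 * rho x" "rk m x \<le> 2 * T * rho x" using p by (simp_all add: field_simps)
  then show "(\<Sum>j\<in>{1..<m}. (cmod (\<eta> j x))\<^sup>2) \<le> 2 * (real m - 1) * rho x" "rk m x \<le> 2 * T * rho x"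
    by (simp_all add: a_def M1_def)
qed

lemma sum_e_le: "x \<in> D \<Longrightarrow> (\<Sum>i<N. (cmod (e (m + i) x))\<^sup>2) \<le> rk m x"
proof -
  assume x: "x \<in> D"
  have "(\<Sum>j\<in>{1..<N + m}. (cmod (e j x))\<^sup>2) = (\<Sum>j\<in>{1..<m}. (cmod (e j x))\<^sup>2) + (\<Sum>i<N. (cmod (e (m + i) x))\<^sup>2)"
    using m by (intro sum_shift_tail) simp
  then show ?thesis using rk_nonneg[OF x, of "N + m"] by (simp add: rk_def)
qed

text \<open>Points of density 0 get weight 0 in the sample matrices. As the basis functions vanish
  there, such points contribute nothing to the L2 products either, as \<open>covariance\<close>
  requires.\<close>

lemma \<eta>_zero: "x \<in> D \<Longrightarrow> rho x = 0 \<Longrightarrow> 1 \<le> j \<Longrightarrow> j < m \<Longrightarrow> \<eta> j x = 0"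
proof -
  assume "x \<in> D" "rho x = 0" "1 \<le> j" "j < m"
  moreover have "(cmod (\<eta> j x))\<^sup>2 \<le> (\<Sum>j\<in>{1..<m}. (cmod (\<eta> j x))\<^sup>2)"
    using \<open>1 \<le> j\<close> \<open>j < m\<close> by (intro member_le_sum) auto
  moreover have "(\<Sum>j\<in>{1..<m}. (cmod (\<eta> j x))\<^sup>2) \<le> 0"
    using sum_\<eta>_le[of x] \<open>x \<in> D\<close> \<open>rho x = 0\<close> by simp
  ultimately have "(cmod (\<eta> j x))\<^sup>2 \<le> 0" by (meson order.trans)
  then show ?thesis by simp
qed

lemma e_zero: "x \<in> D \<Longrightarrow> rho x = 0 \<Longrightarrow> e (m + i) x = 0"
proof -
  assume "x \<in> D" "rho x = 0"
  moreover have "(cmod (e (m + i) x))\<^sup>2 \<le> (\<Sum>i<Suc i. (cmod (e (m + i) x))\<^sup>2)"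
    by (intro member_le_sum) auto
  moreover have "(\<Sum>i<Suc i. (cmod (e (m + i) x))\<^sup>2) \<le> 0"
    using order.trans[OF sum_e_le[of x "Suc i"] rk_le[of x]] \<open>x \<in> D\<close> \<open>rho x = 0\<close> by simp
  ultimately have "(cmod (e (m + i) x))\<^sup>2 \<le> 0" by (meson order.trans)
  then show ?thesis by simp
qed

lemma weighted_sq: "x \<in> D \<Longrightarrow> rho x \<noteq> 0 \<Longrightarrow> (cmod (weighted rho f x))\<^sup>2 = (cmod (f x))\<^sup>2 / rho x"
  using rho_nonneg[of x] by (simp add: weighted_def norm_divide power_divide)

lemma weighted_\<eta>_bound: "x \<in> D \<Longrightarrow> (\<Sum>k<m-1. (cmod (weighted rho (\<eta> (Suc k)) x))\<^sup>2) \<le> 2 * (real m - 1)"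
proof (cases "rho x = 0")
  case True
  then show ?thesis using m by (simp add: weighted_def)
next
  case False
  assume x: "x \<in> D"
  have p: "0 < rho x" using rho_nonneg[OF x] False by simp
  have "(\<Sum>k<m-1. (cmod (weighted rho (\<eta> (Suc k)) x))\<^sup>2) = (\<Sum>k<m-1. (cmod (\<eta> (Suc k) x))\<^sup>2) / rho x"
    by (simp add: weighted_sq[OF x False] sum_divide_distrib)
  also have "(\<Sum>k<m-1. (cmod (\<eta> (Suc k) x))\<^sup>2) = (\<Sum>j\<in>{1..<m}. (cmod (\<eta> j x))\<^sup>2)"
    using sum.shift_bounds_Suc_ivl[of "\<lambda>j. (cmod (\<eta> j x))\<^sup>2" 0 "m - 1"] m by (simp add: lessThan_atLeast0)
  also have "\<dots> / rho x \<le> 2 * (real m - 1)" using sum_\<eta>_le[OF x] p by (simp add: divide_le_eq)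
  finally show ?thesis .
qed

lemma weighted_e_bound: "x \<in> D \<Longrightarrow> (\<Sum>i<N. (cmod (weighted rho (e (m + i)) x))\<^sup>2) \<le> 2 * T"
proof (cases "rho x = 0")
  case True
  then show ?thesis using T_pos by (simp add: weighted_def)
next
  case False
  assume x: "x \<in> D"
  have p: "0 < rho x" using rho_nonneg[OF x] False by simp
  have "(\<Sum>i<N. (cmod (weighted rho (e (m + i)) x))\<^sup>2) = (\<Sum>i<N. (cmod (e (m + i) x))\<^sup>2) / rho x"
    by (simp add: weighted_sq[OF x False] sum_divide_distrib)
  also have "\<dots> \<le> (2 * T * rho x) / rho x"
    using order.trans[OF sum_e_le[OF x] rk_le[OF x]] p by (intro divide_right_mono) auto
  finally show ?thesis using p by simp
qed

section \<open>Covariances and exceptional events at the nodes\<close>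

lemma X_meas: "k \<in> {1..n} \<Longrightarrow> X k \<in> measurable P M"
  using distr by (rule distributed_measurable)

lemma X_D: "k \<in> {1..n} \<Longrightarrow> \<omega> \<in> space P \<Longrightarrow> X k \<omega> \<in> D"
  using measurable_space[OF X_meas] space_M by simp

lemma weighted_X_meas: "f \<in> H \<Longrightarrow> k \<in> {1..n} \<Longrightarrow> (\<lambda>\<omega>. weighted rho f (X k \<omega>)) \<in> borel_measurable P"
  using measurable_compose[OF X_meas weighted_measurable[OF meas rho_meas]] .

text \<open>Importance sampling: the two factors \<open>1 / sqrt (rho x)\<close> cancel the density
  of the node, and where the density is 0 the condition on \<open>f\<close> makes both integrands
  vanish.\<close>

lemma covariance:
  assumes k: "k \<in> {1..n}" and f: "f \<in> H" and g: "g \<in> H"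
    and z: "\<And>x. x \<in> D \<Longrightarrow> rho x = 0 \<Longrightarrow> f x = 0"
  shows "expectation (\<lambda>\<omega>. weighted rho f (X k \<omega>) * cnj (weighted rho g (X k \<omega>))) = l2_inner M f g"
proof -
  have cnjm: "cnj \<in> borel_measurable borel"
    by (intro borel_measurable_continuous_onI continuous_intros)
  define h where "h x = weighted rho f x * cnj (weighted rho g x)" for x
  have h: "h \<in> borel_measurable M"
    unfolding h_def[abs_def]
    by (intro borel_measurable_times measurable_compose[OF _ cnjm] weighted_measurable meas rho_meas f g)
  have "expectation (\<lambda>\<omega>. h (X k \<omega>)) = (\<integral>x. h x \<partial>(distr P M (X k)))"
    by (rule integral_distr[OF X_meas[OF k] h, symmetric])
  also have "distr P M (X k) = density M (\<lambda>x. ennreal (rho x))"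
    by (rule distributed_distr_eq_density[OF distr[OF k]])
  also have "(\<integral>x. h x \<partial>(density M (\<lambda>x. ennreal (rho x)))) = (\<integral>x. rho x *\<^sub>R h x \<partial>M)"
    by (rule integral_density[OF h rho_meas]) (use rho_nonneg space_M in auto)
  also have "\<dots> = l2_inner M f g"
    unfolding l2_inner_def
  proof (rule Bochner_Integration.integral_cong[OF refl])
    fix x assume "x \<in> space M"
    then have x: "x \<in> D" by (simp add: space_M)
    show "rho x *\<^sub>R h x = f x * cnj (g x)"
    proof (cases "rho x = 0")
      case True
      then show ?thesis using z[OF x] by simp
    next
      case False
      have "complex_of_real (sqrt (rho x)) * of_real (sqrt (rho x)) = of_real (rho x)"
        using rho_nonneg[OF x] by (simp flip: of_real_mult)
      moreover have "complex_of_real (sqrt (rho x)) \<noteq> 0" using False by simp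
      ultimately show ?thesis using False
        by (simp add: h_def weighted_def scaleR_conv_of_real field_simps)
    qed
  qed
  finally show ?thesis by (simp add: h_def)
qed

text \<open>Orthonormality in L2 gives the weighted \<eta> k identity covariance, and the density
  gives them squared norm at most 2 (m - 1).\<close>

lemma lower_event:
  shows "\<exists>E\<in>events. prob E \<le> (real m - 1) * exp (- (real n / (2 * (real m - 1))) * (1 - ln 2) / 2) \<and>
    (\<forall>\<omega>\<in>space P - E. \<forall>z. real n / 2 * (\<Sum>k<m-1. (cmod (z k))\<^sup>2)
       \<le> (\<Sum>j<n. (cmod (\<Sum>k<m-1. weighted rho (\<eta> (Suc k)) (X (Suc j) \<omega>) * z k))\<^sup>2))"
proof -
  interpret iid_sample P M X n "\<lambda>x k. weighted rho (\<eta> (Suc k)) x" "m - 1" "2 * (real m - 1)" "\<lambda>_. 1"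
  proof
    show "(\<lambda>x. weighted rho (\<eta> (Suc i)) x) \<in> borel_measurable M" for i
      by (intro weighted_measurable meas \<eta>_mem rho_meas) simp
    show "expectation (\<lambda>\<omega>. weighted rho (\<eta> (Suc i)) (X k \<omega>) * cnj (weighted rho (\<eta> (Suc j)) (X k \<omega>)))
        = (if i = j then complex_of_real 1 else 0)" if "k \<in> {1..n}" "i < m - 1" "j < m - 1" for k i j
      using covariance[OF that(1) \<eta>_mem \<eta>_mem, of "Suc i" "Suc j"] \<eta>_zero[of _ "Suc i"] that
        l2_\<eta>_\<eta>[of "Suc i" "Suc j"] by auto
  qed (use indep m space_M weighted_\<eta>_bound in auto)
  have rm: "real (m - 1) = real m - 1" using m by simp
  have "1 \<le> 2 * (real m - 1)" using m by simp
  then obtain E where E: "E \<in> events" "prob E \<le> real (m - 1) * exp (- (real n / (2 * (real m - 1))) * (1 - ln 2) / 2)"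
    "\<And>\<omega> z. \<omega> \<in> space P - E \<Longrightarrow> real n / 2 * (\<Sum>i<m-1. (cmod (z i))\<^sup>2)
       \<le> (\<Sum>k=1..n. (cmod (dotc (m - 1) z (\<lambda>i. weighted rho (\<eta> (Suc i)) (X k \<omega>))))\<^sup>2)"
    using lower_tail[OF refl _ n] by blast
  have "real n / 2 * (\<Sum>k<m-1. (cmod (z k))\<^sup>2)
       \<le> (\<Sum>j<n. (cmod (\<Sum>k<m-1. weighted rho (\<eta> (Suc k)) (X (Suc j) \<omega>) * z k))\<^sup>2)"
    if \<omega>: "\<omega> \<in> space P - E" for \<omega> z
  proof -
    \<comment> \<open>\<open>dotc\<close> conjugates its second argument, so the tail bound is
      applied to the conjugate of \<open>z\<close>.\<close>
    have "dotc (m - 1) (\<lambda>i. cnj (z i)) (\<lambda>i. weighted rho (\<eta> (Suc i)) x) = cnj (\<Sum>k<m-1. weighted rho (\<eta> (Suc k)) x * z k)" for x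
      by (simp add: dotc_def mult.commute)
    note dc = this
    have sh: "(\<Sum>k=1..n. g k) = (\<Sum>j<n. g (Suc j))" for g :: "nat \<Rightarrow> real"
      by (simp add: sum.atLeast1_atMost_eq)
    show ?thesis using E(3)[OF \<omega>, of "\<lambda>i. cnj (z i)"] by (simp only: sh dc complex_mod_cnj)
  qed
  then show ?thesis using E(1,2) unfolding rm by blast
qed

text \<open>The covariance is diagonal with entries \<open>lam (m + i)\<close>, at most \<mu> each
  and at most \<open>T\<close> in total, so the probability bound does not involve
  \<open>N\<close>.\<close>

lemma upper_event:
  assumes \<mu>: "lam m \<le> \<mu>"
  shows "\<exists>E\<in>events. prob E \<le> T / \<mu> * exp (- (real n * \<mu> / (2 * T)) * (2 * ln 2 - 1)) \<and>
    (\<forall>\<omega>\<in>space P - E. \<forall>z. (\<Sum>j<n. (cmod (\<Sum>i<N. weighted rho (e (m + i)) (X (Suc j) \<omega>) * z i))\<^sup>2)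
       \<le> 2 * real n * \<mu> * (\<Sum>i<N. (cmod (z i))\<^sup>2))"
proof -
  interpret iid_sample P M X n "\<lambda>x i. weighted rho (e (m + i)) x" N "2 * T" "\<lambda>i. lam (m + i)"
  proof
    show "(\<lambda>x. weighted rho (e (m + i)) x) \<in> borel_measurable M" for i
      using m by (intro weighted_measurable meas e_mem rho_meas) simp
    show "expectation (\<lambda>\<omega>. weighted rho (e (m + i)) (X k \<omega>) * cnj (weighted rho (e (m + j)) (X k \<omega>)))
        = (if i = j then complex_of_real (lam (m + i)) else 0)" if "k \<in> {1..n}" for k i j
      using covariance[OF that e_mem e_mem, of "m + i" "m + j"] e_zero m
        l2_e[of "m + j" "e (m + i)"] e_mem[of "m + i"] ip_e[of "m + i" "m + j"] by auto
  qed (use indep m space_M weighted_e_bound T_pos in auto)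
  have \<mu>0: "0 < \<mu>" using lam_pos[of m] m \<mu> by simp
  have l: "0 \<le> lam (m + i) \<and> lam (m + i) \<le> \<mu>" for i
    using lam_nonneg[of "m + i"] lam_antimono[of m "m + i"] m \<mu> by simp
  have "(\<Sum>i<N. lam (m + i)) \<le> T"
    unfolding T_def using l m by (intro sum_le_suminf summable_lam_shift) auto
  then obtain E where E: "E \<in> events" "prob E \<le> T / \<mu> * exp (- (real n * \<mu> / (2 * T)) * (2 * ln 2 - 1))"
    "\<And>\<omega> z. \<omega> \<in> space P - E \<Longrightarrow> (\<Sum>k=1..n. (cmod (dotc N z (\<lambda>i. weighted rho (e (m + i)) (X k \<omega>))))\<^sup>2)
       \<le> 2 * real n * \<mu> * (\<Sum>i<N. (cmod (z i))\<^sup>2)"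
    using upper_tail[OF l _ \<mu>0 n, of T] by blast
  have "(\<Sum>j<n. (cmod (\<Sum>i<N. weighted rho (e (m + i)) (X (Suc j) \<omega>) * z i))\<^sup>2)
       \<le> 2 * real n * \<mu> * (\<Sum>i<N. (cmod (z i))\<^sup>2)"
    if \<omega>: "\<omega> \<in> space P - E" for \<omega> z
  proof -
    have "dotc N (\<lambda>i. cnj (z i)) (\<lambda>i. weighted rho (e (m + i)) x) = cnj (\<Sum>i<N. weighted rho (e (m + i)) x * z i)" for x
      by (simp add: dotc_def mult.commute)
    note dc = this
    have sh: "(\<Sum>k=1..n. g k) = (\<Sum>j<n. g (Suc j))" for g :: "nat \<Rightarrow> real"
      by (simp add: sum.atLeast1_atMost_eq)
    show ?thesis using E(3)[OF \<omega>, of "\<lambda>i. cnj (z i)"] by (simp only: sh dc complex_mod_cnj)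
  qed
  then show ?thesis using E(1,2) by blast
qed

text \<open>The weighted sum of squares over the nodes for the eigenexpansion of \<open>s\<close>
  from index \<open>m\<close> on, cut after \<open>N\<close> terms. Being a finite sum it fits the
  matrix bound; in the limit it becomes the energy of \<open>res m s\<close> at the nodes.\<close>

definition tail_energy :: "('x \<Rightarrow> complex) \<Rightarrow> nat \<Rightarrow> 'w \<Rightarrow> real" where
  "tail_energy s N \<omega> = (\<Sum>j<n. (cmod (\<Sum>i<N. weighted rho (e (m + i)) (X (Suc j) \<omega>) * ip s (e (m + i))))\<^sup>2)"

lemma tail_energy_measurable: "tail_energy s N \<in> borel_measurable P"
proof -
  have [measurable]: "(\<lambda>\<omega>. weighted rho (e (m + i)) (X (Suc j) \<omega>)) \<in> borel_measurable P" if "j \<in> {..<n}" for i j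
    using that m e_mem by (intro weighted_X_meas) auto
  show ?thesis unfolding tail_energy_def[abs_def]
    by (intro borel_measurable_sum borel_measurable_power borel_measurable_norm borel_measurable_times) auto
qed

lemma bessel_tail: "s \<in> H \<Longrightarrow> (\<Sum>i<N. (cmod (ip s (e (m + i))))\<^sup>2) \<le> Re (ip s s)"
proof -
  assume s: "s \<in> H"
  have "(\<Sum>i<N. (cmod (ip s (e (m + i))))\<^sup>2) \<le> (\<Sum>j\<in>{1..<N + m}. (cmod (ip s (e j)))\<^sup>2)"
    using m by (subst sum_shift_tail) (simp_all add: sum_nonneg)
  also have "\<dots> \<le> Re (ip s s)"
    using bessel_eq[OF s, of "N + m"] nonneg[OF res_mem[OF s, of "N + m"]] by simp
  finally show ?thesis .
qed

text \<open>A countable family suffices, which makes the exceptional sets measurable; they increase with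
  the truncation index, so the bound passes to their union.\<close>

lemma upper_event_countable:
  assumes \<mu>: "lam m \<le> \<mu>" and S: "countable S" "S \<subseteq> H" "\<And>s. s \<in> S \<Longrightarrow> sn s \<le> 1"
  shows "\<exists>E\<in>events. prob E \<le> T / \<mu> * exp (- (real n * \<mu> / (2 * T)) * (2 * ln 2 - 1)) \<and>
    (\<forall>\<omega>\<in>space P - E. \<forall>s\<in>S. \<forall>N. tail_energy s N \<omega> \<le> 2 * real n * \<mu>)"
proof -
  define p where "p = T / \<mu> * exp (- (real n * \<mu> / (2 * T)) * (2 * ln 2 - 1))"
  define B where "B N = (\<Union>s\<in>S. \<Union>N'\<in>{..N}. {\<omega> \<in> space P. 2 * real n * \<mu> < tail_energy s N' \<omega>})" for N
  have \<mu>0: "0 < \<mu>" using lam_pos[of m] m \<mu> by simp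
  have B: "B N \<in> events" for N
  proof -
    have "{\<omega> \<in> space P. 2 * real n * \<mu> < tail_energy s N' \<omega>} \<in> events" for s N'
      using tail_energy_measurable[of s N'] by measurable
    then show ?thesis unfolding B_def using S(1) by (intro sets.countable_UN' sets.finite_UN) auto
  qed
  have pB: "prob (B N) \<le> p" for N
  proof -
    obtain E where E: "E \<in> events" "prob E \<le> p"
      "\<And>\<omega> z. \<omega> \<in> space P - E \<Longrightarrow> (\<Sum>j<n. (cmod (\<Sum>i<N. weighted rho (e (m + i)) (X (Suc j) \<omega>) * z i))\<^sup>2)
         \<le> 2 * real n * \<mu> * (\<Sum>i<N. (cmod (z i))\<^sup>2)"
      using upper_event[OF \<mu>, of N] unfolding p_def by blast
    have "B N \<subseteq> E"
    proof
      fix \<omega> assume "\<omega> \<in> B N"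
      then obtain s N' where s: "s \<in> S" "N' \<le> N" "\<omega> \<in> space P" "2 * real n * \<mu> < tail_energy s N' \<omega>"
        by (auto simp: B_def)
      show "\<omega> \<in> E"
      proof (rule ccontr)
        assume "\<omega> \<notin> E"
        \<comment> \<open>Padding with zeros lets the event for \<open>N\<close> handle all shorter
          truncations.\<close>
        define z where "z i = (if i < N' then ip s (e (m + i)) else 0)" for i
        have sub: "{..<N'} \<subseteq> {..<N}" using s(2) by auto
        have "(\<Sum>i<N. c i * z i) = (\<Sum>i<N'. c i * ip s (e (m + i)))" for c
          by (rule sum.mono_neutral_cong_right[OF _ sub]) (auto simp: z_def)
        then have "tail_energy s N' \<omega> \<le> 2 * real n * \<mu> * (\<Sum>i<N. (cmod (z i))\<^sup>2)"
          using E(3)[of \<omega> z] s(3) \<open>\<omega> \<notin> E\<close> by (simp add: tail_energy_def)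
        also have "(\<Sum>i<N. (cmod (z i))\<^sup>2) = (\<Sum>i<N'. (cmod (ip s (e (m + i))))\<^sup>2)"
          by (rule sum.mono_neutral_cong_right[OF _ sub]) (auto simp: z_def)
        also have "\<dots> \<le> 1"
        proof -
          have "Re (ip s s) \<le> 1" using S(3)[OF s(1)] by (simp add: sn_def real_sqrt_le_1_iff)
          then show ?thesis using bessel_tail[of s N'] s(1) S(2) by (meson order.trans subsetD)
        qed
        finally have "tail_energy s N' \<omega> \<le> 2 * real n * \<mu> * 1" using \<mu>0 by (simp add: mult_left_mono)
        then show False using s(4) by simp
      qed
    qed
    then show ?thesis using finite_measure_mono[OF _ E(1)] E(2) by (meson order.trans)
  qed
  have "incseq B" unfolding incseq_def B_def by (auto intro: order.trans)
  then have "(\<lambda>N. prob (B N)) \<longlonglongrightarrow> prob (\<Union>N. B N)"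
    using B by (intro finite_Lim_measure_incseq) auto
  then have "prob (\<Union>N. B N) \<le> p" using LIMSEQ_le_const2 pB by blast
  moreover have "(\<Union>N. B N) \<in> events" using B by blast
  moreover have "tail_energy s N \<omega> \<le> 2 * real n * \<mu>" if "\<omega> \<in> space P - (\<Union>N. B N)" "s \<in> S" for \<omega> s N
    using that by (force simp: B_def not_less)
  ultimately show ?thesis unfolding p_def by blast
qed

text \<open>The law of a node has a density with respect to \<open>M\<close>, so the exceptional
  null set of \<open>rk_tendsto_0\<close> is almost surely missed by all of the finitely many
  nodes.\<close>

lemma AE_rk_tendsto: "AE \<omega> in P. \<forall>j\<in>{1..n}. (\<lambda>N. rk N (X j \<omega>)) \<longlonglongrightarrow> 0"
proof (rule AE_finite_allI)
  fix j assume j: "j \<in> {1..n}"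
  have "AE x in density M (\<lambda>x. ennreal (rho x)). (\<lambda>N. rk N x) \<longlonglongrightarrow> 0"
    using rk_tendsto_0 rho_meas by (subst AE_density) auto
  then have "AE x in distr P M (X j). (\<lambda>N. rk N x) \<longlonglongrightarrow> 0"
    by (simp only: distributed_distr_eq_density[OF distr[OF j]])
  then show "AE \<omega> in P. (\<lambda>N. rk N (X j \<omega>)) \<longlonglongrightarrow> 0"
    by (rule AE_distrD[OF X_meas[OF j]])
qed simp

section \<open>The error functional on the unit ball\<close>

abbreviation "W \<omega> f \<equiv> wls rho \<eta> m n (\<lambda>i. X i \<omega>) f"
abbreviation "cf \<omega> f k \<equiv> vec_index (wls_coeffs rho \<eta> m n (\<lambda>i. X i \<omega>) f) k"
abbreviation "def \<omega> \<equiv> wls_defined rho \<eta> m n (\<lambda>i. X i \<omega>)"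

lemma sum_shift: "(\<Sum>j\<in>{1..<m}. g j) = (\<Sum>k<m-1. g (Suc k))" for g :: "nat \<Rightarrow> 'z :: comm_monoid_add"
  using sum.shift_bounds_Suc_ivl[of g 0 "m - 1"] m by (simp add: lessThan_atLeast0)

lemma W_eq: "W \<omega> f = (\<lambda>x. \<Sum>k<m-1. cf \<omega> f k * \<eta> (Suc k) x)"
proof
  fix x
  have "{1..m-1} = {1..<m}" using m by auto
  then show "W \<omega> f x = (\<Sum>k<m-1. cf \<omega> f k * \<eta> (Suc k) x)" using sum_shift[of "\<lambda>k. cf \<omega> f (k - 1) * \<eta> k x"] by (simp add: wls_def)
qed

lemma \<eta>_sum_mem: "(\<lambda>x. \<Sum>k<N. c k * \<eta> (Suc k) x) \<in> H"
  using \<eta>_mem by (intro sum_closed zero_mem) auto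

lemma q_\<eta>_sum: "l2_inner M (\<lambda>x. \<Sum>k<N. c k * \<eta> (Suc k) x) (\<lambda>x. \<Sum>k<N. c k * \<eta> (Suc k) x) = of_real (\<Sum>k<N. (cmod (c k))\<^sup>2)"
proof -
  have "l2_inner M (\<lambda>x. \<Sum>k<N. c k * \<eta> (Suc k) x) (\<lambda>x. \<Sum>k<N. c k * \<eta> (Suc k) x)
      = (\<Sum>k<N. c k * l2_inner M (\<eta> (Suc k)) (\<lambda>x. \<Sum>k<N. c k * \<eta> (Suc k) x))"
    using \<eta>_mem \<eta>_sum_mem by (intro L2.sum_left) auto
  also have "\<dots> = (\<Sum>k<N. c k * (\<Sum>l<N. cnj (c l) * l2_inner M (\<eta> (Suc k)) (\<eta> (Suc l))))"
    using \<eta>_mem by (intro sum.cong refl arg_cong2[of _ _ _ _ "(*)"] L2.sum_right) auto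
  also have "\<dots> = (\<Sum>k<N. c k * (\<Sum>l<N. if l = k then cnj (c l) else 0))"
    by (intro sum.cong refl arg_cong2[of _ _ _ _ "(*)"]) (simp add: l2_\<eta>_\<eta>)
  also have "\<dots> = (\<Sum>k<N. of_real ((cmod (c k))\<^sup>2))"
    by (intro sum.cong refl) (simp only: complex_norm_square, simp)
  finally show ?thesis by simp
qed

text \<open>With \<open>c\<close> the least squares coefficients, this makes the squared error an
  explicit function of finitely many coefficients, from which its continuity in \<open>f\<close> and
  its measurability in \<omega> are read off.\<close>

lemma q_minus_\<eta>_sum:
  assumes f: "f \<in> H"
  shows "q (\<lambda>x. f x - (\<Sum>k<N. c k * \<eta> (Suc k) x))
    = q f - 2 * Re (\<Sum>k<N. c k * l2_inner M (\<eta> (Suc k)) f) + (\<Sum>k<N. (cmod (c k))\<^sup>2)"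
proof -
  have "l2_inner M (\<lambda>x. \<Sum>k<N. c k * \<eta> (Suc k) x) f = (\<Sum>k<N. c k * l2_inner M (\<eta> (Suc k)) f)"
    using \<eta>_mem f by (intro L2.sum_left) auto
  then show ?thesis using L2.diff_sq[OF f \<eta>_sum_mem[where N = N and c = c]] q_\<eta>_sum[where N = N and c = c] by simp
qed

lemma q_error: "f \<in> H \<Longrightarrow> q (\<lambda>x. f x - W \<omega> f x)
    = q f - 2 * Re (\<Sum>k<m-1. cf \<omega> f k * l2_inner M (\<eta> (Suc k)) f) + (\<Sum>k<m-1. (cmod (cf \<omega> f k))\<^sup>2)"
  unfolding W_eq by (rule q_minus_\<eta>_sum)

lemma error_mem: "f \<in> H \<Longrightarrow> (\<lambda>x. f x - W \<omega> f x) \<in> H"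
  unfolding W_eq by (rule diff_closed[OF _ \<eta>_sum_mem])

text \<open>Point evaluations are continuous on \<open>H\<close>, so for fixed nodes the
  coefficients are too. Consequently the supremum over the unit ball can be taken over a countable
  dense subset.\<close>

lemma error_tendsto:
  assumes def: "def \<omega>" and \<omega>: "\<omega> \<in> space P"
    and f: "\<And>k. f k \<in> H" "g \<in> H" "(\<lambda>k. sn (\<lambda>x. f k x - g x)) \<longlonglongrightarrow> 0"
  shows "(\<lambda>k. q (\<lambda>x. f k x - W \<omega> (f k) x)) \<longlonglongrightarrow> q (\<lambda>x. g x - W \<omega> g x)"
proof -
  have ev: "(\<lambda>k. weighted rho (f k) (X (Suc j) \<omega>)) \<longlonglongrightarrow> weighted rho g (X (Suc j) \<omega>)" if "j < n" for j
  proof -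
    have x: "X (Suc j) \<omega> \<in> D" using X_D[OF _ \<omega>, of "Suc j"] that by simp
    have "(\<lambda>k. f k (X (Suc j) \<omega>)) \<longlonglongrightarrow> g (X (Suc j) \<omega>)"
      using tendsto_ip[OF f ks_mem[OF x]] repr[OF f(1) x] repr[OF f(2) x] by simp
    then show ?thesis unfolding weighted_def by (cases "rho (X (Suc j) \<omega>) = 0") (auto intro!: tendsto_intros)
  qed
  have c: "(\<lambda>k. cf \<omega> (f k) i) \<longlonglongrightarrow> cf \<omega> g i" if i: "i < m - 1" for i
    unfolding wls_coeffs_index[OF def i]
    by (intro tendsto_sum tendsto_mult tendsto_const ev) auto
  have l2: "(\<lambda>k. l2_inner M (f k) h) \<longlonglongrightarrow> l2_inner M g h" if h: "h \<in> H" for h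
  proof (rule tendsto_functional[OF f, where B = "L2.sn h * sqrt tr"])
    fix u assume u: "u \<in> H"
    have "cmod (l2_inner M u h) \<le> L2.sn u * L2.sn h" by (rule L2.cauchy_schwarz_sn[OF u h])
    also have "\<dots> \<le> (sqrt tr * sn u) * L2.sn h"
      by (intro mult_right_mono L2_sn_le u L2.sn_nonneg h)
    finally show "cmod (l2_inner M u h) \<le> L2.sn h * sqrt tr * sn u" by (simp add: ac_simps)
  qed (simp add: L2.diff_left h)
  have l2': "(\<lambda>k. l2_inner M (\<eta> (Suc i)) (f k)) \<longlonglongrightarrow> l2_inner M (\<eta> (Suc i)) g" for i
  proof -
    have h: "\<eta> (Suc i) \<in> H" by (rule \<eta>_mem) simp
    show ?thesis using tendsto_cnj[OF l2[OF h]] L2.herm[OF h f(1)] L2.herm[OF h f(2)] by simp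
  qed
  have qf: "(\<lambda>k. q (f k)) \<longlonglongrightarrow> q g" by (rule tendsto_q[OF f])
  show ?thesis
    unfolding q_error[OF f(1)] q_error[OF f(2)] 
    by (intro tendsto_add tendsto_diff qf tendsto_mult tendsto_const tendsto_Re tendsto_sum
        tendsto_power tendsto_norm c l2') auto
qed

text \<open>Pythagoras in L2: the residual \<open>g\<close> is orthogonal to the \<eta> k with
  \<open>k < m\<close>, so the squared error is \<open>q g\<close>, at most \<open>lam m\<close>,
  plus the squared coefficient error, at most (2/n) 2 n \<mu>.\<close>

lemma good_error:
  assumes \<omega>: "\<omega> \<in> space P" and def: "def \<omega>" and s: "s \<in> H" "sn s \<le> 1" and \<mu>: "0 \<le> \<mu>"
    and low: "\<And>z. real n / 2 * (\<Sum>k<m-1. (cmod (z k))\<^sup>2)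
       \<le> (\<Sum>j<n. (cmod (\<Sum>k<m-1. weighted rho (\<eta> (Suc k)) (X (Suc j) \<omega>) * z k))\<^sup>2)"
    and up: "\<And>N. tail_energy s N \<omega> \<le> 2 * real n * \<mu>"
    and rk0: "\<forall>j\<in>{1..n}. (\<lambda>N. rk N (X j \<omega>)) \<longlonglongrightarrow> 0"
  shows "q (\<lambda>x. s x - W \<omega> s x) \<le> lam m + 4 * \<mu>"
proof -
  define g where "g = res m s"
  have g: "g \<in> H" using res_mem[OF s(1)] by (simp add: g_def)
  have s1: "Re (ip s s) \<le> 1" using s by (simp add: sn_def real_sqrt_le_1_iff)
  \<comment> \<open>Coefficients of the projection of \<open>s\<close>; the singular number undoes
    the normalisation of \<open>\<eta>\<close>.\<close>
  define a where "a k = of_real (sing lam (Suc k)) * ip s (e (Suc k))" for k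
  have s_eq: "s x = (\<Sum>k<m-1. a k * \<eta> (Suc k) x) + g x" for x
  proof -
    have "(\<Sum>k<m-1. a k * \<eta> (Suc k) x) = (\<Sum>k<m-1. ip s (e (Suc k)) * e (Suc k) x)"
      using sing_pos by (intro sum.cong refl) (simp add: a_def eta_def less_imp_neq[THEN not_sym])
    then show ?thesis by (simp only: g_def res_def sum_shift) simp
  qed
  have wn: "weighted rho s x = (\<Sum>k<m-1. weighted rho (\<eta> (Suc k)) x * a k) + weighted rho g x" for x
    by (simp add: weighted_def s_eq add_divide_distrib sum_divide_distrib mult.commute)
  \<comment> \<open>In \<open>H\<close> the tail sums reach \<open>g\<close> only up to a component
    in the kernel of the embedding, which may be nontrivial. At the nodes the difference is
    \<open>res (N + m) s\<close>, bounded by the root of \<open>rk (N + m)\<close> and hence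
    vanishing in the limit.\<close>
  have energy: "(\<Sum>j<n. (cmod (weighted rho g (X (Suc j) \<omega>)))\<^sup>2) \<le> 2 * real n * \<mu>"
  proof (rule LIMSEQ_le_const2)
    show "(\<lambda>N. tail_energy s N \<omega>) \<longlonglongrightarrow> (\<Sum>j<n. (cmod (weighted rho g (X (Suc j) \<omega>)))\<^sup>2)"
      unfolding tail_energy_def
    proof (intro tendsto_sum tendsto_power tendsto_norm)
      fix j assume "j \<in> {..<n}"
      then have j: "Suc j \<in> {1..n}" by auto
      define x where "x = X (Suc j) \<omega>"
      have x: "x \<in> D" using X_D[OF j \<omega>] by (simp add: x_def)
      have "(\<lambda>N. res (N + m) s x) \<longlonglongrightarrow> 0"
      proof (rule Lim_null_comparison)
        have "(\<lambda>N. rk (N + m) x) \<longlonglongrightarrow> 0"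
          using rk0 j unfolding x_def by (intro LIMSEQ_ignore_initial_segment) auto
        then show "(\<lambda>N. sqrt (rk (N + m) x)) \<longlonglongrightarrow> 0" using tendsto_real_sqrt by force
        show "\<forall>\<^sub>F N in sequentially. norm (res (N + m) s x) \<le> sqrt (rk (N + m) x)"
        proof (intro always_eventually allI)
          fix N
          have "(cmod (res (N + m) s x))\<^sup>2 \<le> Re (ip s s) * rk (N + m) x" by (rule res_eval_bound[OF s(1) x])
          also have "\<dots> \<le> 1 * rk (N + m) x" using s1 rk_nonneg[OF x] by (intro mult_right_mono)
          finally show "norm (res (N + m) s x) \<le> sqrt (rk (N + m) x)" using real_le_rsqrt by simp
        qed
      qed
      then have "(\<lambda>N. g x - res (N + m) s x) \<longlonglongrightarrow> g x - 0" by (intro tendsto_intros)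
      moreover have "g x - res (N + m) s x = (\<Sum>i<N. ip s (e (m + i)) * e (m + i) x)" for N
      proof -
        have "(\<Sum>j\<in>{1..<N + m}. ip s (e j) * e j x)
            = (\<Sum>j\<in>{1..<m}. ip s (e j) * e j x) + (\<Sum>i<N. ip s (e (m + i)) * e (m + i) x)"
          using m by (intro sum_shift_tail) simp
        then show ?thesis by (simp add: g_def res_def)
      qed
      ultimately have lim: "(\<lambda>N. \<Sum>i<N. ip s (e (m + i)) * e (m + i) x) \<longlonglongrightarrow> g x" by simp
      show "(\<lambda>N. \<Sum>i<N. weighted rho (e (m + i)) (X (Suc j) \<omega>) * ip s (e (m + i))) \<longlonglongrightarrow> weighted rho g (X (Suc j) \<omega>)"
      proof (cases "rho x = 0")
        case True
        then show ?thesis by (simp add: weighted_def x_def)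
      next
        case False
        have "(\<lambda>N. (\<Sum>i<N. ip s (e (m + i)) * e (m + i) x) / of_real (sqrt (rho x))) \<longlonglongrightarrow> g x / of_real (sqrt (rho x))"
          using False by (intro tendsto_divide lim tendsto_const) simp
        then show ?thesis using False
          by (simp add: weighted_def x_def[symmetric] sum_divide_distrib mult.commute)
      qed
    qed
  qed (use up in auto)
  have "real n / 2 * (\<Sum>k<m-1. (cmod (cf \<omega> s k - a k))\<^sup>2) \<le> (\<Sum>j<n. (cmod (weighted rho g (X (Suc j) \<omega>)))\<^sup>2)"
    by (rule wls_coeffs_stable[OF def low wn])
  note st = this
  have "real n / 2 * (\<Sum>k<m-1. (cmod (cf \<omega> s k - a k))\<^sup>2) \<le> real n / 2 * (4 * \<mu>)"
  proof -
    have "2 * real n * \<mu> = real n / 2 * (4 * \<mu>)" by simp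
    then show ?thesis using order.trans[OF st energy] by metis
  qed
  then have \<delta>: "(\<Sum>k<m-1. (cmod (cf \<omega> s k - a k))\<^sup>2) \<le> 4 * \<mu>" using n by (simp add: mult_le_cancel_left)
  have "(\<lambda>x. s x - W \<omega> s x) = (\<lambda>x. g x - (\<Sum>k<m-1. (cf \<omega> s k - a k) * \<eta> (Suc k) x))"
    unfolding W_eq by (rule ext) (simp add: s_eq algebra_simps sum_subtractf)
  then have "q (\<lambda>x. s x - W \<omega> s x) = q g - 2 * Re (\<Sum>k<m-1. (cf \<omega> s k - a k) * l2_inner M (\<eta> (Suc k)) g)
      + (\<Sum>k<m-1. (cmod (cf \<omega> s k - a k))\<^sup>2)"
    by (simp only: q_minus_\<eta>_sum[OF g])
  also have "(\<Sum>k<m-1. (cf \<omega> s k - a k) * l2_inner M (\<eta> (Suc k)) g) = 0"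
  proof (rule sum.neutral, intro ballI)
    fix k assume "k \<in> {..<m-1}"
    then have "l2_inner M g (\<eta> (Suc k)) = 0"
      using l2_\<eta>[OF _ g, of "Suc k"] ip_res[OF s(1), of "Suc k" m] by (auto simp: g_def)
    then show "(cf \<omega> s k - a k) * l2_inner M (\<eta> (Suc k)) g = 0"
      using L2.herm[OF \<eta>_mem g, of "Suc k"] by simp
  qed
  also have "q g \<le> lam m * 1"
    using q_res_le[OF s(1), of m] m s1 lam_nonneg[of m] unfolding g_def
    by (meson mult_left_mono order.trans one_le_numeral)
  finally show ?thesis using \<delta> by simp
qed

text \<open>Dense elements are pulled back into the unit ball by dividing by
  \<open>max 1 (sn s)\<close>. This moves \<open>s\<close> by no more than its distance to any point
  \<open>f\<close> of the ball, so the distance to \<open>f\<close> at most doubles.\<close>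

lemma countable_dense_ball:
  obtains S where "countable S" "S \<subseteq> H" "\<And>s. s \<in> S \<Longrightarrow> sn s \<le> 1"
    "\<And>f. f \<in> H \<Longrightarrow> sn f \<le> 1 \<Longrightarrow> \<exists>g. (\<forall>k::nat. g k \<in> S) \<and> (\<lambda>k. sn (\<lambda>x. g k x - f x)) \<longlonglongrightarrow> 0"
proof -
  obtain S where S: "countable S" "S \<subseteq> H" "\<And>f \<epsilon>. f \<in> H \<Longrightarrow> 0 < \<epsilon> \<Longrightarrow> \<exists>s\<in>S. sn (\<lambda>x. f x - s x) < \<epsilon>"
    using countable_dense by blast
  define N where "N s = (\<lambda>x. of_real (1 / max 1 (sn s)) * s x)" for s :: "'x \<Rightarrow> complex"
  have NH: "N s \<in> H" if "s \<in> H" for s unfolding N_def using scale_closed[OF that] .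
  have N1: "sn (N s) \<le> 1" if "s \<in> H" for s
    unfolding N_def sn_scale[OF that] norm_of_real by (simp add: abs_div_pos divide_le_eq)
  have close: "sn (\<lambda>x. N s x - f x) \<le> 2 * sn (\<lambda>x. f x - s x)" if s: "s \<in> H" and f: "f \<in> H" "sn f \<le> 1" for s f
  proof -
    have "sn (\<lambda>x. N s x - s x) \<le> sn (\<lambda>x. f x - s x)"
    proof -
      define M1 where "M1 = max 1 (sn s)"
      have M1: "1 \<le> M1" by (simp add: M1_def)
      have "(\<lambda>x. N s x - s x) = (\<lambda>x. of_real (1 / M1 - 1) * s x)"
        by (simp add: N_def M1_def algebra_simps)
      then have "sn (\<lambda>x. N s x - s x) = \<bar>1 / M1 - 1\<bar> * sn s"
        using sn_scale[OF s, of "of_real (1 / M1 - 1)"] norm_of_real by metis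
      also have "\<dots> \<le> M1 - 1"
      proof (cases "sn s \<le> 1")
        case True
        then show ?thesis by (simp add: M1_def)
      next
        case False
        then have "M1 = sn s" by (simp add: M1_def)
        then show ?thesis using M1 by (simp add: field_simps abs_if)
      qed
      also have "\<dots> \<le> sn (\<lambda>x. f x - s x)"
        using sn_abs_diff[OF f(1) s] f(2) sn_nonneg[OF diff_closed[OF f(1) s]] by (auto simp: M1_def)
      finally show ?thesis .
    qed
    then show ?thesis
      using sn_diff_triangle[OF NH[OF s] s f(1)] sn_minus_commute[OF f(1) s] by simp
  qed
  show ?thesis
  proof (rule that[of "N ` S"])
    show "countable (N ` S)" "N ` S \<subseteq> H" using S NH by auto
    show "\<And>s. s \<in> N ` S \<Longrightarrow> sn s \<le> 1" using N1 S by auto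
    fix f assume f: "f \<in> H" "sn f \<le> 1"
    have "\<forall>k. \<exists>s\<in>S. sn (\<lambda>x. f x - s x) < 1 / (real k + 1)" using S(3)[OF f(1)] by simp
    then obtain g where g: "\<And>k. g k \<in> S" "\<And>k. sn (\<lambda>x. f x - g k x) < 1 / (real k + 1)" by metis
    have "(\<lambda>k. sn (\<lambda>x. N (g k) x - f x)) \<longlonglongrightarrow> 0"
    proof (rule Lim_null_comparison)
      show "(\<lambda>k. 2 * (1 / (real k + 1))) \<longlonglongrightarrow> 0" by real_asymp
      show "\<forall>\<^sub>F k in sequentially. norm (sn (\<lambda>x. N (g k) x - f x)) \<le> 2 * (1 / (real k + 1))"
      proof (intro always_eventually allI)
        fix k
        have gk: "g k \<in> H" using g(1) S(2) by blast
        have "sn (\<lambda>x. N (g k) x - f x) \<le> 2 * sn (\<lambda>x. f x - g k x)" by (rule close[OF gk f])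
        moreover have "0 \<le> sn (\<lambda>x. N (g k) x - f x)" using sn_nonneg[OF diff_closed[OF NH[OF gk] f(1)]] .
        ultimately show "norm (sn (\<lambda>x. N (g k) x - f x)) \<le> 2 * (1 / (real k + 1))"
          using g(2)[of k] by simp
      qed
    qed
    then show "\<exists>g. (\<forall>k::nat. g k \<in> N ` S) \<and> (\<lambda>k. sn (\<lambda>x. g k x - f x)) \<longlonglongrightarrow> 0"
      using g(1) by (intro exI[of _ "\<lambda>k. N (g k)"]) auto
  qed
qed

lemma error_measurable:
  assumes s: "s \<in> H"
  shows "{\<omega> \<in> space P. def \<omega> \<and> q (\<lambda>x. s x - W \<omega> s x) \<le> C} \<in> events"
proof -
  define c where "c \<omega> k = (\<Sum>l<m-1. 1 / det (Gm rho \<eta> m n (\<lambda>i. X i \<omega>)) * adj_mat (Gm rho \<eta> m n (\<lambda>i. X i \<omega>)) $$ (k, l)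
        * (\<Sum>j<n. cnj (weighted rho (\<eta> (Suc l)) (X (Suc j) \<omega>)) * weighted rho s (X (Suc j) \<omega>)))" for \<omega> k
  have w: "(\<lambda>\<omega>. weighted rho (\<eta> (Suc k)) (X (Suc j) \<omega>)) \<in> borel_measurable P" if "j < n" for j k
    using that \<eta>_mem by (intro weighted_X_meas) auto
  have ws: "(\<lambda>\<omega>. weighted rho s (X (Suc j) \<omega>)) \<in> borel_measurable P" if "j < n" for j
    using that s by (intro weighted_X_meas) auto
  have c[measurable]: "(\<lambda>\<omega>. c \<omega> k) \<in> borel_measurable P" if "k \<in> {..<m-1}" for k
    unfolding c_def using that
    by (intro wls_coeffs_measurable[where Y = "\<lambda>\<omega> i. X i \<omega>" and b = \<eta>] w ws) auto
  define err where "err \<omega> = q s - 2 * Re (\<Sum>k<m-1. c \<omega> k * l2_inner M (\<eta> (Suc k)) s) + (\<Sum>k<m-1. (cmod (c \<omega> k))\<^sup>2)" for \<omega>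
  have [measurable]: "err \<in> borel_measurable P" unfolding err_def[abs_def] by measurable
  have [measurable]: "{\<omega> \<in> space P. def \<omega>} \<in> events"
    by (rule wls_defined_measurable[where Y = "\<lambda>\<omega> i. X i \<omega>" and b = \<eta>]) (rule w)
  have "q (\<lambda>x. s x - W \<omega> s x) = err \<omega>" if "def \<omega>" for \<omega>
    unfolding q_error[OF s] err_def using wls_coeffs_index[OF that] by (simp add: c_def)
  then have "{\<omega> \<in> space P. def \<omega> \<and> q (\<lambda>x. s x - W \<omega> s x) \<le> C} = {\<omega> \<in> space P. def \<omega>} \<inter> {\<omega> \<in> space P. err \<omega> \<le> C}"
    by auto
  then show ?thesis by simp
qed

theorem wls_error_probability:
  assumes \<mu>: "lam m \<le> \<mu>"
  shows "1 - ((real m - 1) * exp (- (real n / (2 * (real m - 1))) * (1 - ln 2) / 2)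
      + T / \<mu> * exp (- (real n * \<mu> / (2 * T)) * (2 * ln 2 - 1)))
    \<le> prob {\<omega> \<in> space P. def \<omega> \<and> (SUP f\<in>{f\<in>H. hnorm ip f \<le> 1}. l2_norm_sq M (\<lambda>x. f x - W \<omega> f x)) \<le> ennreal (5 * \<mu>)}"
proof -
  define p1 where "p1 = (real m - 1) * exp (- (real n / (2 * (real m - 1))) * (1 - ln 2) / 2)"
  define p2 where "p2 = T / \<mu> * exp (- (real n * \<mu> / (2 * T)) * (2 * ln 2 - 1))"
  have \<mu>0: "0 < \<mu>" using lam_pos[of m] m \<mu> by simp
  obtain S where S: "countable S" "S \<subseteq> H" "\<And>s. s \<in> S \<Longrightarrow> sn s \<le> 1"
    "\<And>f. f \<in> H \<Longrightarrow> sn f \<le> 1 \<Longrightarrow> \<exists>g. (\<forall>k::nat. g k \<in> S) \<and> (\<lambda>k. sn (\<lambda>x. g k x - f x)) \<longlonglongrightarrow> 0"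
    using countable_dense_ball by blast
  define G where "G = {\<omega> \<in> space P. def \<omega> \<and> (SUP f\<in>{f\<in>H. hnorm ip f \<le> 1}. l2_norm_sq M (\<lambda>x. f x - W \<omega> f x)) \<le> ennreal (5 * \<mu>)}"
  \<comment> \<open>Continuity of the error reduces the supremum to \<open>S\<close>; this also
    exhibits \<open>G\<close> as a countable intersection of events.\<close>
  have G_iff: "\<omega> \<in> G \<longleftrightarrow> \<omega> \<in> space P \<and> def \<omega> \<and> (\<forall>s\<in>S. q (\<lambda>x. s x - W \<omega> s x) \<le> 5 * \<mu>)" for \<omega>
  proof -
    have SUP: "(SUP f\<in>{f\<in>H. hnorm ip f \<le> 1}. l2_norm_sq M (\<lambda>x. f x - W \<omega> f x)) \<le> ennreal (5 * \<mu>)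
        \<longleftrightarrow> (\<forall>f\<in>H. sn f \<le> 1 \<longrightarrow> q (\<lambda>x. f x - W \<omega> f x) \<le> 5 * \<mu>)"
      using \<mu>0 by (auto simp: SUP_le_iff hnorm_eq l2_norm_sq_eq[OF error_mem] ennreal_le_iff)
    have "q (\<lambda>x. f x - W \<omega> f x) \<le> 5 * \<mu>"
      if \<omega>: "\<omega> \<in> space P" "def \<omega>" and le: "\<forall>s\<in>S. q (\<lambda>x. s x - W \<omega> s x) \<le> 5 * \<mu>" and f: "f \<in> H" "sn f \<le> 1" for f
    proof -
      obtain g where g: "\<And>k::nat. g k \<in> S" "(\<lambda>k. sn (\<lambda>x. g k x - f x)) \<longlonglongrightarrow> 0" using S(4)[OF f] by blast
      then have gH: "g k \<in> H" for k using S(2) by blast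
      show ?thesis
        by (rule LIMSEQ_le_const2[OF error_tendsto[OF \<omega>(2,1) gH f(1) g(2)]]) (use le g(1) in blast)
    qed
    then show ?thesis unfolding G_def using SUP S(2,3) by blast
  qed
  have Gm: "G \<in> events"
  \<comment> \<open>The countable intersection requires a nonempty index set; emptiness is
    contradictory because some sequence in \<open>S\<close> approximates 0.\<close>
  proof (cases "S = {}")
    case True
    then show ?thesis using S(4)[OF zero_mem] sn_eq_zero_iff[OF zero_mem] by auto
  next
    case False
    have "G = (\<Inter>s\<in>S. {\<omega> \<in> space P. def \<omega> \<and> q (\<lambda>x. s x - W \<omega> s x) \<le> 5 * \<mu>})"
      using False by (auto simp: G_iff)
    then show ?thesis using False S(1,2) error_measurable by (auto intro!: sets.countable_INT')
  qed
  obtain E1 where E1: "E1 \<in> events" "prob E1 \<le> p1"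
    "\<And>\<omega> z. \<omega> \<in> space P - E1 \<Longrightarrow> real n / 2 * (\<Sum>k<m-1. (cmod (z k))\<^sup>2)
       \<le> (\<Sum>j<n. (cmod (\<Sum>k<m-1. weighted rho (\<eta> (Suc k)) (X (Suc j) \<omega>) * z k))\<^sup>2)"
    using lower_event unfolding p1_def by blast
  obtain E2 where E2: "E2 \<in> events" "prob E2 \<le> p2"
    "\<And>\<omega> s N. \<omega> \<in> space P - E2 \<Longrightarrow> s \<in> S \<Longrightarrow> tail_energy s N \<omega> \<le> 2 * real n * \<mu>"
    using upper_event_countable[OF \<mu> S(1-3)] unfolding p2_def by blast
  obtain Z where Z: "{\<omega> \<in> space P. \<not> (\<forall>j\<in>{1..n}. (\<lambda>N. rk N (X j \<omega>)) \<longlonglongrightarrow> 0)} \<subseteq> Z" "emeasure P Z = 0" "Z \<in> events"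
    using AE_E[OF AE_rk_tendsto] by blast
  have sub: "space P - (E1 \<union> E2 \<union> Z) \<subseteq> G"
  proof
    fix \<omega> assume "\<omega> \<in> space P - (E1 \<union> E2 \<union> Z)"
    then have \<omega>: "\<omega> \<in> space P" "\<omega> \<in> space P - E1" "\<omega> \<in> space P - E2" and
      rk0: "\<forall>j\<in>{1..n}. (\<lambda>N. rk N (X j \<omega>)) \<longlonglongrightarrow> 0" using Z(1) by auto
    \<comment> \<open>The positive lower bound n/2 leaves no kernel of the design matrix, so the
      operator is defined outside the lower event.\<close>
    have d: "def \<omega>"
    proof (rule wls_definedI)
      fix a assume a: "\<forall>j<n. (\<Sum>k<m-1. weighted rho (\<eta> (Suc k)) (X (Suc j) \<omega>) * a k) = 0"
      have "real n / 2 * (\<Sum>k<m-1. (cmod (a k))\<^sup>2) \<le> 0" using E1(3)[OF \<omega>(2), of a] a by simp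
      then have "(\<Sum>k<m-1. (cmod (a k))\<^sup>2) \<le> 0" using n by (simp add: mult_le_0_iff)
      then have "(\<Sum>k<m-1. (cmod (a k))\<^sup>2) = 0" by (intro antisym sum_nonneg) auto
      then show "\<forall>k<m-1. a k = 0" by (simp add: sum_nonneg_eq_0_iff)
    qed
    have "q (\<lambda>x. s x - W \<omega> s x) \<le> 5 * \<mu>" if "s \<in> S" for s
      using good_error[OF \<omega>(1) d _ S(3)[OF that] less_imp_le[OF \<mu>0] E1(3)[OF \<omega>(2)] E2(3)[OF \<omega>(3) that] rk0] \<mu> S(2) that
      by force
    then show "\<omega> \<in> G" using \<omega>(1) d by (simp add: G_iff)
  qed
  have "prob (E1 \<union> E2 \<union> Z) \<le> prob E1 + prob E2 + prob Z"
    using measure_Un_le[OF E1(1) E2(1)] measure_Un_le[OF sets.Un[OF E1(1) E2(1)] Z(3)] by simp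
  also have "\<dots> \<le> p1 + p2" using E1(2) E2(2) Z(2) by (simp add: measure_def)
  finally have "1 - (p1 + p2) \<le> prob (space P - (E1 \<union> E2 \<union> Z))"
    using E1(1) E2(1) Z(3) by (subst prob_compl) auto
  also have "\<dots> \<le> prob G" by (rule finite_measure_mono[OF sub Gm])
  finally show ?thesis by (simp only: p1_def p2_def G_def)
qed

end

section \<open>The error bound\<close>

text \<open>The 14 makes n / (2 d) at least 7 r ln n, and 7 (1 - ln 2) / 2 is at least 77/72, just
  above 1. The prefactor \<open>d \<le> n\<close> turns n^(-r) into n^(1-r).\<close>

lemma lower_tail_numerics:
  fixes n d r :: real
  assumes "1 < r" "3 \<le> n" "1 \<le> d" "d \<le> n / (14 * r * ln n)"
  shows "d * exp (- (n / (2 * d)) * (1 - ln 2) / 2) \<le> n powr (1 - r)"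
proof -
  \<comment> \<open>\<open>exp_le\<close> says that exp 1 is at most 3, whence the condition on
    \<open>n\<close>.\<close>
  have ln1: "1 \<le> ln n"
    using assms(2) exp_le by (subst ln_ge_iff) auto
  have rl: "1 \<le> r * ln n" using mult_mono[of 1 r 1 "ln n"] assms(1) ln1 by simp
  have dn: "14 * (r * ln n) * d \<le> n" using assms(4) rl by (simp add: field_simps)
  have "d \<le> n"
  proof -
    have "1 * d \<le> 14 * (r * ln n) * d" using rl assms(3) by (intro mult_right_mono) auto
    then show ?thesis using dn by simp
  qed
  moreover have "r * ln n \<le> (n / (2 * d)) * (1 - ln 2) / 2"
  proof -
    have "7 * (r * ln n) \<le> n / (2 * d)" using dn assms(3) by (simp add: field_simps)
    moreover have "11/36 \<le> 1 - ln (2::real)" using ln2_le_25_over_36 by simp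
    ultimately have "7 * (r * ln n) * (11/36) \<le> (n / (2 * d)) * (1 - ln 2)"
      using rl by (intro mult_mono) auto
    then have "7 * (r * ln n) * (11/36) / 2 \<le> (n / (2 * d)) * (1 - ln 2) / 2"
      by (rule divide_right_mono) simp
    moreover have "r * ln n \<le> 7 * (r * ln n) * (11/36) / 2" using rl by simp
    ultimately show ?thesis by (rule order.trans[rotated])
  qed
  ultimately have "d * exp (- (n / (2 * d)) * (1 - ln 2) / 2) \<le> n * exp (- (r * ln n))"
    using assms by (intro mult_mono) auto
  also have "\<dots> = n powr (1 - r)" using assms(2) by (simp add: powr_def left_diff_distrib exp_diff exp_minus divide_inverse)
  finally show ?thesis .
qed

text \<open>The 16 makes the factor n \<mu> / (2 T) at least 8 r ln n, and 2 ln 2 - 1 is at least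
  1/3. The same inequality also bounds the prefactor \<open>T / \<mu>\<close> by
  \<open>n\<close>.\<close>

lemma upper_tail_numerics:
  fixes n r \<kappa> T \<mu> :: real
  assumes "1 < r" "3 \<le> n" "1 \<le> \<kappa>\<^sup>2" "0 < T" "16 * r * \<kappa>\<^sup>2 * ln n / n * T \<le> \<mu>"
  shows "T / \<mu> * exp (- (n * \<mu> / (2 * T)) * (2 * ln 2 - 1)) \<le> n powr (1 - r)"
proof -
  have ln1: "1 \<le> ln n"
    using assms(2) exp_le by (subst ln_ge_iff) auto
  have rl: "1 \<le> r * ln n" using mult_mono[of 1 r 1 "ln n"] assms(1) ln1 by simp
  have "1 * (r * ln n) \<le> \<kappa>\<^sup>2 * (r * ln n)" using assms(3) rl by (intro mult_right_mono) auto
  then have "16 * (r * ln n) * T \<le> 16 * r * \<kappa>\<^sup>2 * ln n * T" using assms(4) by (simp add: ac_simps)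
  also have "\<dots> \<le> n * \<mu>" using assms(2,5) by (simp add: field_simps)
  finally have key: "16 * (r * ln n) * T \<le> n * \<mu>" .
  have "1 * T \<le> 16 * (r * ln n) * T" using rl assms(4) by (intro mult_right_mono) auto
  then have Tn: "T \<le> n * \<mu>" using key by simp
  have \<mu>0: "0 < \<mu>"
    using zero_less_mult_pos[OF less_le_trans[OF assms(4) Tn]] assms(2) by simp
  have "T / \<mu> \<le> n" using Tn \<mu>0 by (simp add: field_simps)
  moreover have "r * ln n \<le> (n * \<mu> / (2 * T)) * (2 * ln 2 - 1)"
  proof -
    have "8 * (r * ln n) \<le> n * \<mu> / (2 * T)" using key assms(4) by (simp add: field_simps)
    moreover have "1/3 \<le> 2 * ln 2 - (1::real)" using ln2_ge_two_thirds by simp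
    ultimately have "8 * (r * ln n) * (1/3) \<le> (n * \<mu> / (2 * T)) * (2 * ln 2 - 1)"
      using rl by (intro mult_mono) auto
    then show ?thesis using rl by simp
  qed
  ultimately have "T / \<mu> * exp (- (n * \<mu> / (2 * T)) * (2 * ln 2 - 1)) \<le> n * exp (- (r * ln n))"
    using assms \<mu>0 by (intro mult_mono) auto
  also have "\<dots> = n powr (1 - r)" using assms(2) by (simp add: powr_def left_diff_distrib exp_diff exp_minus divide_inverse)
  finally show ?thesis .
qed

theorem theorem5p2:
  fixes D :: "(real ^ 'd) set"
    and M :: "(real ^ 'd) measure"
    and K :: "real ^ 'd \<Rightarrow> real ^ 'd \<Rightarrow> complex"
    and H :: "(real ^ 'd \<Rightarrow> complex) set"
    and ip :: "(real ^ 'd \<Rightarrow> complex) \<Rightarrow> (real ^ 'd \<Rightarrow> complex) \<Rightarrow> complex"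
    and lam :: "nat \<Rightarrow> real"
    and e :: "nat \<Rightarrow> real ^ 'd \<Rightarrow> complex"
    and r :: real and n m :: nat and \<kappa> \<eta> :: real
    and rho :: "real ^ 'd \<Rightarrow> real"
    and P :: "'w measure" and X :: "nat \<Rightarrow> 'w \<Rightarrow> real ^ 'd"
  assumes "space M = D"
    and "pos_def_hermitian D K"
    and "rkhs D K H ip"
    and "separable_on H ip"
    and "H \<subseteq> borel_measurable M"
    and "integrable M (\<lambda>x. Re (K x x))"
    and "eigensystem M H ip lam e"
    and "r > 1" and "n \<ge> 3"
    and "m = nat \<lfloor>real n / (14 * r * ln (real n))\<rfloor>" and "m \<ge> 2"
    and "\<eta> = 2 powr (3/4) + 1" and "\<kappa> = (1 + sqrt 5) / 2"
    and "rho = sampling_density M K lam e m"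
    and "prob_space P"
    and "prob_space.indep_vars P (\<lambda>_. M) X {1..n}"
    and "\<forall>i\<in>{1..n}. distributed P M (X i) (\<lambda>x. ennreal (rho x))"
  shows "measure P {\<omega> \<in> space P.
           wls_defined rho (eta lam e) m n (\<lambda>i. X i \<omega>) \<and>
           (SUP f\<in>{f\<in>H. hnorm ip f \<le> 1}.
              l2_norm_sq M (\<lambda>x. f x - wls rho (eta lam e) m n (\<lambda>i. X i \<omega>) f x))
           \<le> ennreal (5 * max ((sing lam m)\<^sup>2)
                (16 * r * \<kappa>\<^sup>2 * ln (real n) / real n * (\<Sum>j. (sing lam (m + j))\<^sup>2)))}
         \<ge> 1 - \<eta> * real n powr (1 - r)"
proof -
  note as = assms
  interpret wls_sampling D M K H ip lam e P X m n rho
    by (intro wls_sampling.intro rkhs_eigen.intro rkhs_l2.intro rkhs_eigen_axioms.intro wls_sampling_axioms.intro)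
       (use as in auto)
  \<comment> \<open>The first entry makes \<mu> dominate the covariance of the tail, the second
    makes it large enough against \<open>T\<close> for the upper tail exponent.\<close>
  define \<mu> where "\<mu> = max (lam m) (16 * r * \<kappa>\<^sup>2 * ln (real n) / real n * T)"
  have sq: "(sing lam (m + j))\<^sup>2 = lam (m + j)" for j using sing_sq[of "m + j"] m by simp
  have \<mu>_eq: "max ((sing lam m)\<^sup>2) (16 * r * \<kappa>\<^sup>2 * ln (real n) / real n * (\<Sum>j. (sing lam (m + j))\<^sup>2)) = \<mu>"
    using sq[of 0] by (simp add: \<mu>_def T_def sq)
  have n3: "3 \<le> real n" using as(9) by simp
  have "0 < ln (real n)" using n3 by simp
  then have nn: "0 \<le> real n / (14 * r * ln (real n))" using as(8) by simp
  have "real m \<le> real n / (14 * r * ln (real n))"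
    unfolding as(10) using nn by (simp add: le_floor_iff[symmetric])
  then have md: "real m - 1 \<le> real n / (14 * r * ln (real n))" by simp
  have "1 \<le> \<kappa>"
  proof -
    have "1 \<le> sqrt (5::real)" by simp
    then show ?thesis unfolding as(13) by simp
  qed
  then have \<kappa>: "1 \<le> \<kappa>\<^sup>2" by simp
  have p1: "(real m - 1) * exp (- (real n / (2 * (real m - 1))) * (1 - ln 2) / 2) \<le> real n powr (1 - r)"
    using as(8) n3 md m by (intro lower_tail_numerics) auto
  have p2: "T / \<mu> * exp (- (real n * \<mu> / (2 * T)) * (2 * ln 2 - 1)) \<le> real n powr (1 - r)"
    using as(8) n3 \<kappa> T_pos by (intro upper_tail_numerics) (auto simp: \<mu>_def)
  \<comment> \<open>There are two exceptional events of probability at most n^(1-r) each, so \<eta>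
    has to be at least 2.\<close>
  have "(2::real) powr 0 \<le> 2 powr (3/4)" by (intro powr_mono) auto
  then have "2 \<le> \<eta>" using as(12) by simp
  then have "2 * real n powr (1 - r) \<le> \<eta> * real n powr (1 - r)" by (intro mult_right_mono) auto
  then have "1 - \<eta> * real n powr (1 - r) \<le> 1 - ((real m - 1) * exp (- (real n / (2 * (real m - 1))) * (1 - ln 2) / 2)
      + T / \<mu> * exp (- (real n * \<mu> / (2 * T)) * (2 * ln 2 - 1)))"
    using p1 p2 by linarith
  also have "\<dots> \<le> prob {\<omega> \<in> space P. wls_defined rho (eta lam e) m n (\<lambda>i. X i \<omega>) \<and>
      (SUP f\<in>{f\<in>H. hnorm ip f \<le> 1}. l2_norm_sq M (\<lambda>x. f x - wls rho (eta lam e) m n (\<lambda>i. X i \<omega>) f x))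
      \<le> ennreal (5 * \<mu>)}"
    by (rule wls_error_probability) (simp add: \<mu>_def)
  finally show ?thesis unfolding \<mu>_eq .
qed

end
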